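(* Let $\mathcal V$ be a braided closed monoidal category. The following are equivalent for a tensored closed $\mathcal V$-monoidal category $\mathcal C$: (1) Every $\mathcal V$-representable functor $\mathcal R^a=\mathcal C(a\to-):\mathcal C\to\widehat{\mathcal V}$ is tensored. (2) The $\mathcal V$-monoidal functor $\mathcal I:\mathcal C\to\overline{\mathcal C}$, $a\mapsto a\blacktriangleleft1_{\mathcal V}$, is tensored. (3) The $1_{\mathcal V}$-graded monoidal $\mathcal V$-natural transformation $\tau:\mathrm{id}^{\overline{\mathcal C}}\Rightarrow\overline{\mathrm{id}^{\mathcal C}}\circ\mathcal I$, $\tau_{a\blacktriangleleft u}=\mu^{\mathcal I}_{a,u}$, is an isomorphism. (4) The $\mathcal V$-monoidal functors $\mathcal I:\mathcal C\to\overline{\mathcal C}$ and $\overline{\mathrm{id}^{\mathcal C}}:\overline{\mathcal C}\to\mathcal C$ witness a $\mathcal V$-monoidal equivalence.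
   Context: Conventions: composition (also of functors) is written left to right; tensor products in $\mathcal V$ are juxtaposition; associators and unitors are suppressed; "mate" means the morphism corresponding under the indicated adjunction; $\beta_{u,v}:uv\to vu$ is the braiding. A $\mathcal V$-category $\mathcal C$ has hom objects $\mathcal C(a\to b)\in\mathcal V$, identities $j_a:1_{\mathcal V}\to\mathcal C(a\to a)$ and composition $-\circ_{\mathcal C}-:\mathcal C(a\to b)\mathcal C(b\to c)\to\mathcal C(a\to c)$, associative and unital. A $\mathcal V$-functor $F$ has morphisms $F_{a\to b}:\mathcal C(a\to b)\to\mathcal D(F(a)\to F(b))$ compatible with composition and identities. A $1_{\mathcal V}$-graded $\mathcal V$-natural transformation $\sigma:F\Rightarrow G$ is a family $\sigma_a\in\mathcal V(1_{\mathcal V}\to\mathcal D(F(a)\to G(a)))$ with $(\sigma_aG_{a\to b})\circ(-\circ_{\mathcal D}-)=(F_{a\to b}\sigma_b)\circ(-\circ_{\mathcal D}-)$. The underlying category $\mathcal C^{\mathcal V}$ has $\mathcal C^{\mathcal V}(a\to b)=\mathcal V(1_{\mathcal V}\to\mathcal C(a\to b))$. $\mathcal V$ closed: internal homs satisfy $\mathcal V(uw\to v)\cong\mathcal V(w\to\widehat{\mathcal V}(u\to v))$, with $\varepsilon^{\widehat{\mathcal V}}_{u\to v}:u\widehat{\mathcal V}(u\to v)\to v$ the mate of the identity. $\widehat{\mathcal V}$ is the self-enriched $\mathcal V$-category, with underlying category identified with $\mathcal V$. $\mathcal R^a:\mathcal C\to\widehat{\mathcal V}$ is $b\mapsto\mathcal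 C(a\to b)$, with action the mate of $-\circ_{\mathcal C}-$. $\mathcal C$ is tensored if each $\mathcal R^a$ has a left $\mathcal V$-adjoint $v\mapsto a\vartriangleleft v$, i.e. a $\mathcal V$-functor $\widehat{\mathcal V}\to\mathcal C$ with $\mathcal V$-natural isomorphisms $\mathcal C(a\vartriangleleft v\to b)\cong\widehat{\mathcal V}(v\to\mathcal C(a\to b))$. Then $\mathcal C^{\mathcal V}(a\vartriangleleft v\to b)\cong\mathcal V(v\to\mathcal C(a\to b))$ ( * ), with unit $\eta^{\mathcal C}_{a,v}:v\to\mathcal C(a\to a\vartriangleleft v)$ and counit $\varepsilon^{\mathcal C}_{a\to b}:a\vartriangleleft\mathcal C(a\to b)\to b$. $\vartriangleleft$ is a bifunctor $\mathcal C^{\mathcal V}\times\mathcal V\to\mathcal C^{\mathcal V}$, and $\alpha_{a,u,v}:a\vartriangleleft uv\to a\vartriangleleft u\vartriangleleft v$, the mate of $(\eta^{\mathcal C}_{a,u}\eta^{\mathcal C}_{a\vartriangleleft u,v})\circ(-\circ_{\mathcal C}-)$, is invertible. For $\widehat{\mathcal V}$, $u\vartriangleleft v=uv$. A $\mathcal V$-functor $F:\mathcal C\to\mathcal D$ of tensored $\mathcal V$-categories is tensored if for all $c,v$ the morphism $\mu^F_{c,v}\in\mathcal D^{\mathcal V}(F(c)\vartriangleleft v\to F(c\vartriangleleft v))$, the mate of $\eta^{\mathcal C}_{c,v}\circ F_{c\to c\vartriangleleft v}$, is an isomorphism. A (strict) $\mathcal V$-monoidal category is a $\mathcal V$-category $\mathcal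 C$ with a unit object $1_{\mathcal C}$, a strictly associative and unital product $ab$ of objects, and morphisms $-\otimes_{\mathcal C}-:\mathcal C(a\to b)\mathcal C(c\to d)\to\mathcal C(ac\to bd)$ that are associative, unital ($j_{1_{\mathcal C}}$ is a two-sided unit and $(j_aj_b)\circ(-\otimes_{\mathcal C}-)=j_{ab}$), and satisfy braided interchange: on $\mathcal C(a\to b)\mathcal C(d\to e)\mathcal C(b\to c)\mathcal C(e\to f)$, $((-\otimes_{\mathcal C}-)(-\otimes_{\mathcal C}-))\circ(-\circ_{\mathcal C}-)=(\mathrm{id}\,\beta_{\mathcal C(d\to e),\mathcal C(b\to c)}\,\mathrm{id})\circ((-\circ_{\mathcal C}-)(-\circ_{\mathcal C}-))\circ(-\otimes_{\mathcal C}-)$. It is closed if each $\mathcal V$-functor $a\otimes-:b\mapsto ab$, $(a\otimes-)_{b\to c}=(j_a\mathrm{id})\circ(-\otimes_{\mathcal C}-)$, has a right $\mathcal V$-adjoint $[a,-]$. A $\mathcal V$-monoidal functor $(F,\nu):\mathcal C\to\mathcal D$ is a $\mathcal V$-functor with $F(1_{\mathcal C})=1_{\mathcal D}$ and isomorphisms $\nu_{a,b}\in\mathcal D^{\mathcal V}(F(ab)\to F(a)F(b))$ which are unital, associative, and natural: as morphisms $\mathcal C(a\to c)\mathcal C(b\to d)\to\mathcal D(F(ab)\to F(c)F(d))$, $(-\otimes_{\mathcal C}-)\circ F_{ab\to cd}$ post-composed with $\nu_{c,d}$ equals $(F_{a\to c}F_{b\to d})\circ(-\otimes_{\mathcal D}-)$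 pre-composed with $\nu_{a,b}$. A $\mathcal V$-natural transformation $\sigma$ is monoidal if $\sigma_1=j_1$ and $\sigma_{ab}\circ\nu^G_{a,b}=\nu^F_{a,b}\circ(\sigma_a\sigma_b)$. Two $\mathcal V$-monoidal functors witness a $\mathcal V$-monoidal equivalence if both composites are isomorphic to identities via monoidal $\mathcal V$-natural isomorphisms. Completion: $\overline{\mathcal C}$ has objects formal symbols $a\blacktriangleleft u$ ($a\in\mathcal C$, $u\in\mathcal V$), hom objects $\overline{\mathcal C}(a\blacktriangleleft u\to b\blacktriangleleft v)=\widehat{\mathcal V}(u\to\mathcal C(a\to b)v)$, identity $j_{a\blacktriangleleft u}$ the mate of $j_a\mathrm{id}_u$, composition the mate of $(\varepsilon^{\widehat{\mathcal V}}_{u\to\mathcal C(a\to b)v}\mathrm{id})\circ(\mathrm{id}_{\mathcal C(a\to b)}\varepsilon^{\widehat{\mathcal V}}_{v\to\mathcal C(b\to c)w})\circ((-\circ_{\mathcal C}-)\mathrm{id}_w)$; it is tensored with $(a\blacktriangleleft u)\vartriangleleft v=a\blacktriangleleft uv$. Its $\mathcal V$-monoidal structure: $1_{\overline{\mathcal C}}=1_{\mathcal C}\blacktriangleleft1_{\mathcal V}$, $(a\blacktriangleleft u)(b\blacktriangleleft v)=ab\blacktriangleleft uv$, and $-\otimes_{\overline{\mathcal C}}-:\widehat{\mathcal V}(u\to\mathcal C(a\to b)v)\widehat{\mathcal V}(w\to\mathcal C(c\to d)x)\to\widehat{\mathcal V}(uw\to\mathcal C(ac\to bd)vx)$ is the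 mate of $(\mathrm{id}_u\beta_{w,\widehat{\mathcal V}(u\to\mathcal C(a\to b)v)}\mathrm{id})\circ(\varepsilon^{\widehat{\mathcal V}}\varepsilon^{\widehat{\mathcal V}})\circ(\mathrm{id}_{\mathcal C(a\to b)}\,(\beta_{\mathcal C(c\to d),v})^{-1}\,\mathrm{id}_x)\circ((-\otimes_{\mathcal C}-)\mathrm{id}_{vx})$. $\mathcal I_{a\to b}$ is the mate of $\mathrm{id}_{\mathcal C(a\to b)}$ and $\nu^{\mathcal I}_{a,b}=j_{ab\blacktriangleleft1_{\mathcal V}}$. So $\mu^{\mathcal I}_{a,u}\in\overline{\mathcal C}^{\mathcal V}(a\blacktriangleleft u\to(a\vartriangleleft u)\blacktriangleleft1_{\mathcal V})$. The functor $\overline{\mathrm{id}^{\mathcal C}}$: on objects $a\blacktriangleleft u\mapsto a\vartriangleleft u$; on hom objects the mate under ( * ) of $\alpha^{-1}_{a,u,\widehat{\mathcal V}(u\to\mathcal C(a\to b)v)}\circ(\mathrm{id}_a\vartriangleleft\varepsilon^{\widehat{\mathcal V}}_{u\to\mathcal C(a\to b)v})\circ\alpha_{a,\mathcal C(a\to b),v}\circ(\varepsilon^{\mathcal C}_{a\to b}\vartriangleleft\mathrm{id}_v)$. For its monoidal structure, let $\mathcal G:\mathcal V\to\mathcal C^{\mathcal V}$ be the left adjoint of $\mathcal C(1_{\mathcal C}\to-)$ with unit $\eta_v$, so that $a\vartriangleleft v=a\mathcal G(v)$; let $\nu^{\mathcal G}_{u,v}:\mathcal G(uv)\to\mathcal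 G(u)\mathcal G(v)$ be the mate of $(\eta_u\eta_v)\circ(-\otimes_{\mathcal C}-)$, and $e_{a,\mathcal G(v)}:a\mathcal G(v)\to\mathcal G(v)a$ the mate under ( * ) of $(\eta_vj_a)\circ(-\otimes_{\mathcal C}-)$. Then $\nu^{\overline{\mathrm{id}^{\mathcal C}}}_{a\blacktriangleleft u,b\blacktriangleleft v}=(\mathrm{id}_{ab}\nu^{\mathcal G}_{u,v})\circ(\mathrm{id}_a\,e_{b,\mathcal G(u)}\,\mathrm{id}_{\mathcal G(v)}):ab\,\mathcal G(uv)\to a\mathcal G(u)b\mathcal G(v)$. *)

theory Defs
  imports Main
begin

section \<open>Strict braided closed monoidal categories\<close>

text \<open>Composition is written from left to right throughout: \<open>f \<Zsemi> g\<close> is first \<open>f\<close>, then \<open>g\<close>.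
  Associators and unitors are suppressed, that is, \<open>V\<close> is strict. This is also what makes the
  product \<open>(a, u)(b, v) = (ab, uv)\<close> on the completion below strictly associative and unital.\<close>

record ('o, 'm) bcm_data =
  obj :: "'o set"
  arr :: "'m set"
  src :: "'m \<Rightarrow> 'o"
  trg :: "'m \<Rightarrow> 'o"
  idt :: "'o \<Rightarrow> 'm" ("\<iota>\<index>")
  cmp :: "'m \<Rightarrow> 'm \<Rightarrow> 'm" (infixl "\<Zsemi>\<index>" 65)
  unt :: "'o" ("\<one>\<index>")
  otens :: "'o \<Rightarrow> 'o \<Rightarrow> 'o" (infixl "\<odot>\<index>" 75)
  atens :: "'m \<Rightarrow> 'm \<Rightarrow> 'm" (infixl "\<otimes>\<index>" 70)
  brd :: "'o \<Rightarrow> 'o \<Rightarrow> 'm" ("\<beta>\<index>")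
  ihom :: "'o \<Rightarrow> 'o \<Rightarrow> 'o"
  evl :: "'o \<Rightarrow> 'o \<Rightarrow> 'm" ("\<epsilon>\<index>")

definition hom :: "('o, 'm, 'z) bcm_data_scheme \<Rightarrow> 'o \<Rightarrow> 'o \<Rightarrow> 'm set" where
  "hom V u v = {f \<in> arr V. src V f = u \<and> trg V f = v}"

locale base_category =
  fixes V :: "('o, 'm, 'z) bcm_data_scheme" (structure)
  assumes src_obj: "f \<in> arr V \<Longrightarrow> src V f \<in> obj V"
    and trg_obj: "f \<in> arr V \<Longrightarrow> trg V f \<in> obj V"
    and idt_hom: "u \<in> obj V \<Longrightarrow> \<iota> u \<in> hom V u u"
    and cmp_hom: "\<lbrakk>f \<in> hom V u v; g \<in> hom V v w\<rbrakk> \<Longrightarrow> f \<Zsemi> g \<in> hom V u w"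
    and idt_cmp: "f \<in> hom V u v \<Longrightarrow> \<iota> u \<Zsemi> f = f"
    and cmp_idt: "f \<in> hom V u v \<Longrightarrow> f \<Zsemi> \<iota> v = f"
    and cmp_assoc: "\<lbrakk>f \<in> hom V u v; g \<in> hom V v w; h \<in> hom V w x\<rbrakk>
      \<Longrightarrow> (f \<Zsemi> g) \<Zsemi> h = f \<Zsemi> (g \<Zsemi> h)"

definition is_inverse ::
  "('o, 'm, 'z) bcm_data_scheme \<Rightarrow> 'o \<Rightarrow> 'o \<Rightarrow> 'm \<Rightarrow> 'm \<Rightarrow> bool" where
  "is_inverse V u v f g \<longleftrightarrow> f \<in> hom V u v \<and> g \<in> hom V v u \<and>
     f \<Zsemi>\<^bsub>V\<^esub> g = \<iota>\<^bsub>V\<^esub> u \<and> g \<Zsemi>\<^bsub>V\<^esub> f = \<iota>\<^bsub>V\<^esub> v"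

definition is_iso :: "('o, 'm, 'z) bcm_data_scheme \<Rightarrow> 'o \<Rightarrow> 'o \<Rightarrow> 'm \<Rightarrow> bool" where
  "is_iso V u v f \<longleftrightarrow> (\<exists>g. is_inverse V u v f g)"

definition inverse_of :: "('o, 'm, 'z) bcm_data_scheme \<Rightarrow> 'm \<Rightarrow> 'm" where
  "inverse_of V f = (THE g. is_inverse V (src V f) (trg V f) f g)"

locale strict_monoidal = base_category +
  assumes unt_obj: "\<one> \<in> obj V"
    and otens_obj: "\<lbrakk>u \<in> obj V; v \<in> obj V\<rbrakk> \<Longrightarrow> u \<odot> v \<in> obj V"
    and otens_assoc: "\<lbrakk>u \<in> obj V; v \<in> obj V; w \<in> obj V\<rbrakk> \<Longrightarrow> (u \<odot> v) \<odot> w = u \<odot> (v \<odot> w)"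
    and unt_otens: "u \<in> obj V \<Longrightarrow> \<one> \<odot> u = u"
    and otens_unt: "u \<in> obj V \<Longrightarrow> u \<odot> \<one> = u"
    and atens_hom: "\<lbrakk>f \<in> hom V u v; g \<in> hom V w x\<rbrakk> \<Longrightarrow> f \<otimes> g \<in> hom V (u \<odot> w) (v \<odot> x)"
    and atens_idt: "\<lbrakk>u \<in> obj V; v \<in> obj V\<rbrakk> \<Longrightarrow> \<iota> u \<otimes> \<iota> v = \<iota> (u \<odot> v)"
    and atens_cmp: "\<lbrakk>f \<in> hom V u v; f' \<in> hom V v w; g \<in> hom V x y; g' \<in> hom V y z\<rbrakk>
      \<Longrightarrow> (f \<Zsemi> f') \<otimes> (g \<Zsemi> g') = f \<otimes> g \<Zsemi> f' \<otimes> g'"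
    and atens_assoc: "\<lbrakk>f \<in> arr V; g \<in> arr V; h \<in> arr V\<rbrakk> \<Longrightarrow> (f \<otimes> g) \<otimes> h = f \<otimes> (g \<otimes> h)"
    and unt_atens: "f \<in> arr V \<Longrightarrow> \<iota> \<one> \<otimes> f = f"
    and atens_unt: "f \<in> arr V \<Longrightarrow> f \<otimes> \<iota> \<one> = f"

locale braided_monoidal = strict_monoidal +
  assumes brd_iso: "\<lbrakk>u \<in> obj V; v \<in> obj V\<rbrakk> \<Longrightarrow> is_iso V (u \<odot> v) (v \<odot> u) (\<beta> u v)"
    and brd_natural: "\<lbrakk>f \<in> hom V u u'; g \<in> hom V v v'\<rbrakk>
      \<Longrightarrow> f \<otimes> g \<Zsemi> \<beta> u' v' = \<beta> u v \<Zsemi> g \<otimes> f"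
    and hexagon_right: "\<lbrakk>u \<in> obj V; v \<in> obj V; w \<in> obj V\<rbrakk>
      \<Longrightarrow> \<beta> u (v \<odot> w) = \<beta> u v \<otimes> \<iota> w \<Zsemi> \<iota> v \<otimes> \<beta> u w"
    and hexagon_left: "\<lbrakk>u \<in> obj V; v \<in> obj V; w \<in> obj V\<rbrakk>
      \<Longrightarrow> \<beta> (u \<odot> v) w = \<iota> u \<otimes> \<beta> v w \<Zsemi> \<beta> u w \<otimes> \<iota> v"

text \<open>\<open>ihom V u v\<close> is the internal hom and \<open>\<epsilon> u v : u \<odot> ihom V u v \<rightarrow> v\<close> its evaluation.\<close>

locale braided_closed_monoidal = braided_monoidal +
  assumes ihom_obj: "\<lbrakk>u \<in> obj V; v \<in> obj V\<rbrakk> \<Longrightarrow> ihom V u v \<in> obj V"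
    and evl_hom: "\<lbrakk>u \<in> obj V; v \<in> obj V\<rbrakk> \<Longrightarrow> \<epsilon> u v \<in> hom V (u \<odot> ihom V u v) v"
    and evl_universal: "\<lbrakk>u \<in> obj V; v \<in> obj V; w \<in> obj V\<rbrakk>
      \<Longrightarrow> bij_betw (\<lambda>h. \<iota> u \<otimes> h \<Zsemi> \<epsilon> u v) (hom V w (ihom V u v)) (hom V (u \<odot> w) v)"

text \<open>\<open>mate V u w v g : w \<rightarrow> ihom V u v\<close> is the mate of \<open>g : u \<odot> w \<rightarrow> v\<close>.\<close>

definition mate :: "('o, 'm, 'z) bcm_data_scheme \<Rightarrow> 'o \<Rightarrow> 'o \<Rightarrow> 'o \<Rightarrow> 'm \<Rightarrow> 'm" where
  "mate V u w v g =
     the_inv_into (hom V w (ihom V u v)) (\<lambda>h. \<iota>\<^bsub>V\<^esub> u \<otimes>\<^bsub>V\<^esub> h \<Zsemi>\<^bsub>V\<^esub> \<epsilon>\<^bsub>V\<^esub> u v) g"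


section \<open>Enriched categories and functors\<close>

record ('c, 'o, 'm) vcat_data =
  vob :: "'c set"
  vhom :: "'c \<Rightarrow> 'c \<Rightarrow> 'o"
  vid :: "'c \<Rightarrow> 'm"
  vcomp :: "'c \<Rightarrow> 'c \<Rightarrow> 'c \<Rightarrow> 'm"

locale v_category =
  fixes V :: "('o, 'm, 'z) bcm_data_scheme" (structure)
    and C :: "('c, 'o, 'm, 'y) vcat_data_scheme"
  assumes vhom_obj: "\<lbrakk>a \<in> vob C; b \<in> vob C\<rbrakk> \<Longrightarrow> vhom C a b \<in> obj V"
    and vid_hom: "a \<in> vob C \<Longrightarrow> vid C a \<in> hom V \<one> (vhom C a a)"
    and vcomp_hom: "\<lbrakk>a \<in> vob C; b \<in> vob C; c \<in> vob C\<rbrakk>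
      \<Longrightarrow> vcomp C a b c \<in> hom V (vhom C a b \<odot> vhom C b c) (vhom C a c)"
    and vcomp_assoc: "\<lbrakk>a \<in> vob C; b \<in> vob C; c \<in> vob C; d \<in> vob C\<rbrakk>
      \<Longrightarrow> vcomp C a b c \<otimes> \<iota> (vhom C c d) \<Zsemi> vcomp C a c d
        = \<iota> (vhom C a b) \<otimes> vcomp C b c d \<Zsemi> vcomp C a b d"
    and vid_vcomp: "\<lbrakk>a \<in> vob C; b \<in> vob C\<rbrakk>
      \<Longrightarrow> vid C a \<otimes> \<iota> (vhom C a b) \<Zsemi> vcomp C a a b = \<iota> (vhom C a b)"
    and vcomp_vid: "\<lbrakk>a \<in> vob C; b \<in> vob C\<rbrakk>
      \<Longrightarrow> \<iota> (vhom C a b) \<otimes> vid C b \<Zsemi> vcomp C a b b = \<iota> (vhom C a b)"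

text \<open>The underlying category: morphisms \<open>a \<rightarrow> b\<close> are the \<open>f : \<one> \<rightarrow> vhom C a b\<close>.\<close>

definition uhom ::
  "('o, 'm, 'z) bcm_data_scheme \<Rightarrow> ('c, 'o, 'm, 'y) vcat_data_scheme \<Rightarrow> 'c \<Rightarrow> 'c \<Rightarrow> 'm set" where
  "uhom V C a b = hom V \<one>\<^bsub>V\<^esub> (vhom C a b)"

definition ucomp ::
  "('o, 'm, 'z) bcm_data_scheme \<Rightarrow> ('c, 'o, 'm, 'y) vcat_data_scheme
    \<Rightarrow> 'c \<Rightarrow> 'c \<Rightarrow> 'c \<Rightarrow> 'm \<Rightarrow> 'm \<Rightarrow> 'm" where
  "ucomp V C a b c f g = f \<otimes>\<^bsub>V\<^esub> g \<Zsemi>\<^bsub>V\<^esub> vcomp C a b c"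

definition u_inverse ::
  "('o, 'm, 'z) bcm_data_scheme \<Rightarrow> ('c, 'o, 'm, 'y) vcat_data_scheme
    \<Rightarrow> 'c \<Rightarrow> 'c \<Rightarrow> 'm \<Rightarrow> 'm \<Rightarrow> bool" where
  "u_inverse V C a b f g \<longleftrightarrow> f \<in> uhom V C a b \<and> g \<in> uhom V C b a \<and>
     ucomp V C a b a f g = vid C a \<and> ucomp V C b a b g f = vid C b"

definition u_iso ::
  "('o, 'm, 'z) bcm_data_scheme \<Rightarrow> ('c, 'o, 'm, 'y) vcat_data_scheme
    \<Rightarrow> 'c \<Rightarrow> 'c \<Rightarrow> 'm \<Rightarrow> bool" where
  "u_iso V C a b f \<longleftrightarrow> (\<exists>g. u_inverse V C a b f g)"

record ('c, 'd, 'm) vfun_data =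
  fob :: "'c \<Rightarrow> 'd"
  fhom :: "'c \<Rightarrow> 'c \<Rightarrow> 'm"

locale v_functor =
  fixes V :: "('o, 'm, 'z) bcm_data_scheme" (structure)
    and C :: "('c, 'o, 'm, 'y) vcat_data_scheme"
    and D :: "('d, 'o, 'm, 'x) vcat_data_scheme"
    and F :: "('c, 'd, 'm) vfun_data"
  assumes fob_vob: "a \<in> vob C \<Longrightarrow> fob F a \<in> vob D"
    and fhom_hom: "\<lbrakk>a \<in> vob C; b \<in> vob C\<rbrakk>
      \<Longrightarrow> fhom F a b \<in> hom V (vhom C a b) (vhom D (fob F a) (fob F b))"
    and fhom_vid: "a \<in> vob C \<Longrightarrow> vid C a \<Zsemi> fhom F a a = vid D (fob F a)"
    and fhom_vcomp: "\<lbrakk>a \<in> vob C; b \<in> vob C; c \<in> vob C\<rbrakk>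
      \<Longrightarrow> vcomp C a b c \<Zsemi> fhom F a c
        = fhom F a b \<otimes> fhom F b c \<Zsemi> vcomp D (fob F a) (fob F b) (fob F c)"

definition id_vfun :: "('o, 'm, 'z) bcm_data_scheme \<Rightarrow> ('c, 'o, 'm, 'y) vcat_data_scheme
    \<Rightarrow> ('c, 'c, 'm) vfun_data" where
  "id_vfun V C = \<lparr>fob = (\<lambda>a. a), fhom = (\<lambda>a b. \<iota>\<^bsub>V\<^esub> (vhom C a b))\<rparr>"

text \<open>\<open>comp_vfun V F G\<close> is first \<open>F\<close>, then \<open>G\<close>.\<close>

definition comp_vfun :: "('o, 'm, 'z) bcm_data_scheme
    \<Rightarrow> ('c, 'd, 'm) vfun_data \<Rightarrow> ('d, 'e, 'm) vfun_data \<Rightarrow> ('c, 'e, 'm) vfun_data" where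
  "comp_vfun V F G = \<lparr>fob = (\<lambda>a. fob G (fob F a)),
     fhom = (\<lambda>a b. fhom F a b \<Zsemi>\<^bsub>V\<^esub> fhom G (fob F a) (fob F b))\<rparr>"

locale v_nat =
  fixes V :: "('o, 'm, 'z) bcm_data_scheme" (structure)
    and C :: "('c, 'o, 'm, 'y) vcat_data_scheme"
    and D :: "('d, 'o, 'm, 'x) vcat_data_scheme"
    and F :: "('c, 'd, 'm) vfun_data"
    and G :: "('c, 'd, 'm) vfun_data"
    and \<sigma> :: "'c \<Rightarrow> 'm"
  assumes component: "a \<in> vob C \<Longrightarrow> \<sigma> a \<in> uhom V D (fob F a) (fob G a)"
    and natural: "\<lbrakk>a \<in> vob C; b \<in> vob C\<rbrakk>
      \<Longrightarrow> \<sigma> a \<otimes> fhom G a b \<Zsemi> vcomp D (fob F a) (fob G a) (fob G b)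
        = fhom F a b \<otimes> \<sigma> b \<Zsemi> vcomp D (fob F a) (fob F b) (fob G b)"

text \<open>\<open>L : D \<rightarrow> C\<close> is left \<open>V\<close>-adjoint to \<open>R : C \<rightarrow> D\<close> via isomorphisms
  \<open>\<theta> v b : C(L v \<rightarrow> b) \<cong> D(v \<rightarrow> R b)\<close> of hom objects. \<open>V\<close>-naturality in \<open>b\<close> and in \<open>v\<close> is
  spelled out on \<open>C(L v \<rightarrow> b) C(b \<rightarrow> c)\<close> and on \<open>D(w \<rightarrow> v) C(L v \<rightarrow> b)\<close>.\<close>

locale v_adjunction =
  left: v_functor V D C L + right: v_functor V C D R
  for V :: "('o, 'm, 'z) bcm_data_scheme" (structure)
    and D :: "('d, 'o, 'm, 'x) vcat_data_scheme"
    and C :: "('c, 'o, 'm, 'y) vcat_data_scheme"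
    and L :: "('d, 'c, 'm) vfun_data"
    and R :: "('c, 'd, 'm) vfun_data" +
  fixes \<theta> :: "'d \<Rightarrow> 'c \<Rightarrow> 'm"
  assumes adj_iso: "\<lbrakk>v \<in> vob D; b \<in> vob C\<rbrakk>
      \<Longrightarrow> is_iso V (vhom C (fob L v) b) (vhom D v (fob R b)) (\<theta> v b)"
    and adj_natural_right: "\<lbrakk>v \<in> vob D; b \<in> vob C; c \<in> vob C\<rbrakk>
      \<Longrightarrow> vcomp C (fob L v) b c \<Zsemi> \<theta> v c
        = \<theta> v b \<otimes> fhom R b c \<Zsemi> vcomp D v (fob R b) (fob R c)"
    and adj_natural_left: "\<lbrakk>w \<in> vob D; v \<in> vob D; b \<in> vob C\<rbrakk>
      \<Longrightarrow> fhom L w v \<otimes> \<iota> (vhom C (fob L v) b) \<Zsemi> vcomp C (fob L w) (fob L v) b \<Zsemi> \<theta> w b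
        = \<iota> (vhom D w v) \<otimes> \<theta> v b \<Zsemi> vcomp D w v (fob R b)"

definition self_vcat :: "('o, 'm, 'z) bcm_data_scheme \<Rightarrow> ('o, 'o, 'm) vcat_data" where
  "self_vcat V = \<lparr>vob = obj V, vhom = ihom V,
     vid = (\<lambda>u. mate V u \<one>\<^bsub>V\<^esub> u (\<iota>\<^bsub>V\<^esub> u)),
     vcomp = (\<lambda>u v w. mate V u (ihom V u v \<odot>\<^bsub>V\<^esub> ihom V v w) w
       (\<epsilon>\<^bsub>V\<^esub> u v \<otimes>\<^bsub>V\<^esub> \<iota>\<^bsub>V\<^esub> (ihom V v w) \<Zsemi>\<^bsub>V\<^esub> \<epsilon>\<^bsub>V\<^esub> v w))\<rparr>"

definition repr_vfun :: "('o, 'm, 'z) bcm_data_scheme \<Rightarrow> ('c, 'o, 'm, 'y) vcat_data_scheme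
    \<Rightarrow> 'c \<Rightarrow> ('c, 'o, 'm) vfun_data" where
  "repr_vfun V C a = \<lparr>fob = vhom C a,
     fhom = (\<lambda>b c. mate V (vhom C a b) (vhom C b c) (vhom C a c) (vcomp C a b c))\<rparr>"


section \<open>Tensored categories and functors\<close>

text \<open>A tensoring consists of the objects \<open>tob T a v = a \<lhd> v\<close> and the isomorphisms
  \<open>tiso T a v b : C(a \<lhd> v \<rightarrow> b) \<cong> ihom v C(a \<rightarrow> b)\<close>. The action of \<open>a \<lhd> -\<close> on hom objects
  is determined by these and hence is not part of the data.\<close>

record ('c, 'o, 'm) tensoring_data =
  tob :: "'c \<Rightarrow> 'o \<Rightarrow> 'c"
  tiso :: "'c \<Rightarrow> 'o \<Rightarrow> 'c \<Rightarrow> 'm"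

definition tensoring :: "('o, 'm, 'z) bcm_data_scheme \<Rightarrow> ('c, 'o, 'm, 'y) vcat_data_scheme
    \<Rightarrow> ('c, 'o, 'm) tensoring_data \<Rightarrow> bool" where
  "tensoring V C T \<longleftrightarrow> (\<forall>a \<in> vob C. \<exists>act.
     v_adjunction V (self_vcat V) C \<lparr>fob = tob T a, fhom = act\<rparr> (repr_vfun V C a) (tiso T a))"

context
  fixes V :: "('o, 'm, 'z) bcm_data_scheme" (structure)
    and C :: "('c, 'o, 'm, 'y) vcat_data_scheme"
    and T :: "('c, 'o, 'm) tensoring_data"
begin

text \<open>The two directions of the bijection between the underlying morphisms \<open>a \<lhd> v \<rightarrow> b\<close> and
  \<open>V(v \<rightarrow> C(a \<rightarrow> b))\<close>.\<close>

definition tmate :: "'c \<Rightarrow> 'o \<Rightarrow> 'c \<Rightarrow> 'm \<Rightarrow> 'm" where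
  "tmate a v b g = mate V v \<one> (vhom C a b) g \<Zsemi> inverse_of V (tiso T a v b)"

definition tcomate :: "'c \<Rightarrow> 'o \<Rightarrow> 'c \<Rightarrow> 'm \<Rightarrow> 'm" where
  "tcomate a v b f = \<iota> v \<otimes> (f \<Zsemi> tiso T a v b) \<Zsemi> \<epsilon> v (vhom C a b)"

definition tunit :: "'c \<Rightarrow> 'o \<Rightarrow> 'm" where
  "tunit a v = tcomate a v (tob T a v) (vid C (tob T a v))"

definition tcounit :: "'c \<Rightarrow> 'c \<Rightarrow> 'm" where
  "tcounit a b = tmate a (vhom C a b) b (\<iota> (vhom C a b))"

text \<open>The action of \<open>\<lhd>\<close> on \<open>f : a \<rightarrow> b\<close> (in the underlying category) and \<open>g : u \<rightarrow> v\<close> (in \<open>V\<close>).\<close>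

definition tmap :: "'c \<Rightarrow> 'c \<Rightarrow> 'o \<Rightarrow> 'o \<Rightarrow> 'm \<Rightarrow> 'm \<Rightarrow> 'm" where
  "tmap a b u v f g =
     tmate a u (tob T b v) (f \<otimes> (g \<Zsemi> tunit b v) \<Zsemi> vcomp C a b (tob T b v))"

definition talpha :: "'c \<Rightarrow> 'o \<Rightarrow> 'o \<Rightarrow> 'm" where
  "talpha a u v = tmate a (u \<odot> v) (tob T (tob T a u) v)
     (tunit a u \<otimes> tunit (tob T a u) v \<Zsemi> vcomp C a (tob T a u) (tob T (tob T a u) v))"

definition talpha_inv :: "'c \<Rightarrow> 'o \<Rightarrow> 'o \<Rightarrow> 'm" where
  "talpha_inv a u v =
     (THE g. u_inverse V C (tob T a (u \<odot> v)) (tob T (tob T a u) v) (talpha a u v) g)"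

end

definition mu :: "('o, 'm, 'z) bcm_data_scheme
    \<Rightarrow> ('c, 'o, 'm, 'y) vcat_data_scheme \<Rightarrow> ('c, 'o, 'm) tensoring_data
    \<Rightarrow> ('d, 'o, 'm, 'x) vcat_data_scheme \<Rightarrow> ('d, 'o, 'm) tensoring_data
    \<Rightarrow> ('c, 'd, 'm) vfun_data \<Rightarrow> 'c \<Rightarrow> 'o \<Rightarrow> 'm" where
  "mu V C T D S F c v = tmate V D S (fob F c) v (fob F (tob T c v))
     (tunit V C T c v \<Zsemi>\<^bsub>V\<^esub> fhom F c (tob T c v))"

definition tensored_functor :: "('o, 'm, 'z) bcm_data_scheme
    \<Rightarrow> ('c, 'o, 'm, 'y) vcat_data_scheme \<Rightarrow> ('c, 'o, 'm) tensoring_data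
    \<Rightarrow> ('d, 'o, 'm, 'x) vcat_data_scheme \<Rightarrow> ('d, 'o, 'm) tensoring_data
    \<Rightarrow> ('c, 'd, 'm) vfun_data \<Rightarrow> bool" where
  "tensored_functor V C T D S F \<longleftrightarrow> v_functor V C D F \<and>
     (\<forall>c \<in> vob C. \<forall>v \<in> obj V.
        u_iso V D (tob S (fob F c) v) (fob F (tob T c v)) (mu V C T D S F c v))"

text \<open>Currying \<open>ihom (u \<odot> v) x \<rightarrow> ihom v (ihom u x)\<close>.\<close>

definition curry_iso :: "('o, 'm, 'z) bcm_data_scheme \<Rightarrow> 'o \<Rightarrow> 'o \<Rightarrow> 'o \<Rightarrow> 'm" where
  "curry_iso V u v x = mate V v (ihom V (u \<odot>\<^bsub>V\<^esub> v) x) (ihom V u x)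
     (mate V u (v \<odot>\<^bsub>V\<^esub> ihom V (u \<odot>\<^bsub>V\<^esub> v) x) x (\<epsilon>\<^bsub>V\<^esub> (u \<odot>\<^bsub>V\<^esub> v) x))"

definition self_tensoring :: "('o, 'm, 'z) bcm_data_scheme \<Rightarrow> ('o, 'o, 'm) tensoring_data" where
  "self_tensoring V = \<lparr>tob = (\<lambda>u v. u \<odot>\<^bsub>V\<^esub> v), tiso = curry_iso V\<rparr>"


section \<open>Enriched monoidal categories and functors\<close>

record ('c, 'o, 'm) vmoncat_data = "('c, 'o, 'm) vcat_data" +
  vunit :: "'c"
  vprod :: "'c \<Rightarrow> 'c \<Rightarrow> 'c"
  vtens :: "'c \<Rightarrow> 'c \<Rightarrow> 'c \<Rightarrow> 'c \<Rightarrow> 'm"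

text \<open>\<open>vtens C a b c d : C(a \<rightarrow> b) C(c \<rightarrow> d) \<rightarrow> C(ac \<rightarrow> bd)\<close>\<close>

locale v_monoidal_category = v_category V C
  for V :: "('o, 'm, 'z) bcm_data_scheme" (structure)
    and C :: "('c, 'o, 'm, 'y) vmoncat_data_scheme" +
  assumes vunit_vob: "vunit C \<in> vob C"
    and vprod_vob: "\<lbrakk>a \<in> vob C; b \<in> vob C\<rbrakk> \<Longrightarrow> vprod C a b \<in> vob C"
    and vprod_assoc: "\<lbrakk>a \<in> vob C; b \<in> vob C; c \<in> vob C\<rbrakk>
      \<Longrightarrow> vprod C (vprod C a b) c = vprod C a (vprod C b c)"
    and vunit_vprod: "a \<in> vob C \<Longrightarrow> vprod C (vunit C) a = a"
    and vprod_vunit: "a \<in> vob C \<Longrightarrow> vprod C a (vunit C) = a"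
    and vtens_hom: "\<lbrakk>a \<in> vob C; b \<in> vob C; c \<in> vob C; d \<in> vob C\<rbrakk>
      \<Longrightarrow> vtens C a b c d \<in> hom V (vhom C a b \<odot> vhom C c d) (vhom C (vprod C a c) (vprod C b d))"
    and vtens_assoc:
      "\<lbrakk>a \<in> vob C; b \<in> vob C; c \<in> vob C; d \<in> vob C; e \<in> vob C; f \<in> vob C\<rbrakk>
      \<Longrightarrow> vtens C a b c d \<otimes> \<iota> (vhom C e f) \<Zsemi> vtens C (vprod C a c) (vprod C b d) e f
        = \<iota> (vhom C a b) \<otimes> vtens C c d e f \<Zsemi> vtens C a b (vprod C c e) (vprod C d f)"
    and vunit_vtens: "\<lbrakk>a \<in> vob C; b \<in> vob C\<rbrakk>
      \<Longrightarrow> vid C (vunit C) \<otimes> \<iota> (vhom C a b) \<Zsemi> vtens C (vunit C) (vunit C) a b = \<iota> (vhom C a b)"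
    and vtens_vunit: "\<lbrakk>a \<in> vob C; b \<in> vob C\<rbrakk>
      \<Longrightarrow> \<iota> (vhom C a b) \<otimes> vid C (vunit C) \<Zsemi> vtens C a b (vunit C) (vunit C) = \<iota> (vhom C a b)"
    and vtens_vid: "\<lbrakk>a \<in> vob C; b \<in> vob C\<rbrakk>
      \<Longrightarrow> vid C a \<otimes> vid C b \<Zsemi> vtens C a a b b = vid C (vprod C a b)"
    and braided_interchange:
      "\<lbrakk>a \<in> vob C; b \<in> vob C; c \<in> vob C; d \<in> vob C; e \<in> vob C; f \<in> vob C\<rbrakk>
      \<Longrightarrow> vtens C a b d e \<otimes> vtens C b c e f
            \<Zsemi> vcomp C (vprod C a d) (vprod C b e) (vprod C c f)
        = \<iota> (vhom C a b) \<otimes> \<beta> (vhom C d e) (vhom C b c) \<otimes> \<iota> (vhom C e f)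
            \<Zsemi> vcomp C a b c \<otimes> vcomp C d e f
            \<Zsemi> vtens C a c d f"

definition prod_vfun :: "('o, 'm, 'z) bcm_data_scheme \<Rightarrow> ('c, 'o, 'm, 'y) vmoncat_data_scheme
    \<Rightarrow> 'c \<Rightarrow> ('c, 'c, 'm) vfun_data" where
  "prod_vfun V C a = \<lparr>fob = vprod C a,
     fhom = (\<lambda>b c. vid C a \<otimes>\<^bsub>V\<^esub> \<iota>\<^bsub>V\<^esub> (vhom C b c) \<Zsemi>\<^bsub>V\<^esub> vtens C a a b c)\<rparr>"

definition v_closed :: "('o, 'm, 'z) bcm_data_scheme \<Rightarrow> ('c, 'o, 'm, 'y) vmoncat_data_scheme
    \<Rightarrow> bool" where
  "v_closed V C \<longleftrightarrow> (\<forall>a \<in> vob C. \<exists>R \<theta>. v_adjunction V C C (prod_vfun V C a) R \<theta>)"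

definition utens ::
  "('o, 'm, 'z) bcm_data_scheme \<Rightarrow> ('c, 'o, 'm, 'y) vmoncat_data_scheme
    \<Rightarrow> 'c \<Rightarrow> 'c \<Rightarrow> 'c \<Rightarrow> 'c \<Rightarrow> 'm \<Rightarrow> 'm \<Rightarrow> 'm" where
  "utens V C a b c d f g = f \<otimes>\<^bsub>V\<^esub> g \<Zsemi>\<^bsub>V\<^esub> vtens C a b c d"

locale v_monoidal_functor = v_functor V C D F
  for V :: "('o, 'm, 'z) bcm_data_scheme" (structure)
    and C :: "('c, 'o, 'm, 'y) vmoncat_data_scheme"
    and D :: "('d, 'o, 'm, 'x) vmoncat_data_scheme"
    and F :: "('c, 'd, 'm) vfun_data" +
  fixes \<nu> :: "'c \<Rightarrow> 'c \<Rightarrow> 'm"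
  assumes fob_vunit: "fob F (vunit C) = vunit D"
    and nu_iso: "\<lbrakk>a \<in> vob C; b \<in> vob C\<rbrakk>
      \<Longrightarrow> u_iso V D (fob F (vprod C a b)) (vprod D (fob F a) (fob F b)) (\<nu> a b)"
    and nu_unit_left: "a \<in> vob C \<Longrightarrow> \<nu> (vunit C) a = vid D (fob F a)"
    and nu_unit_right: "a \<in> vob C \<Longrightarrow> \<nu> a (vunit C) = vid D (fob F a)"
    and nu_assoc: "\<lbrakk>a \<in> vob C; b \<in> vob C; c \<in> vob C\<rbrakk>
      \<Longrightarrow> ucomp V D (fob F (vprod C (vprod C a b) c)) (vprod D (fob F (vprod C a b)) (fob F c))
              (vprod D (vprod D (fob F a) (fob F b)) (fob F c))
            (\<nu> (vprod C a b) c)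
            (utens V D (fob F (vprod C a b)) (vprod D (fob F a) (fob F b)) (fob F c) (fob F c)
              (\<nu> a b) (vid D (fob F c)))
        = ucomp V D (fob F (vprod C a (vprod C b c))) (vprod D (fob F a) (fob F (vprod C b c)))
              (vprod D (fob F a) (vprod D (fob F b) (fob F c)))
            (\<nu> a (vprod C b c))
            (utens V D (fob F a) (fob F a) (fob F (vprod C b c)) (vprod D (fob F b) (fob F c))
              (vid D (fob F a)) (\<nu> b c))"
    and nu_natural: "\<lbrakk>a \<in> vob C; b \<in> vob C; c \<in> vob C; d \<in> vob C\<rbrakk>
      \<Longrightarrow> (vtens C a c b d \<Zsemi> fhom F (vprod C a b) (vprod C c d)) \<otimes> \<nu> c d
            \<Zsemi> vcomp D (fob F (vprod C a b)) (fob F (vprod C c d)) (vprod D (fob F c) (fob F d))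
        = \<nu> a b \<otimes> (fhom F a c \<otimes> fhom F b d \<Zsemi> vtens D (fob F a) (fob F c) (fob F b) (fob F d))
            \<Zsemi> vcomp D (fob F (vprod C a b)) (vprod D (fob F a) (fob F b))
                (vprod D (fob F c) (fob F d))"

definition id_nu :: "('c, 'o, 'm, 'y) vmoncat_data_scheme \<Rightarrow> 'c \<Rightarrow> 'c \<Rightarrow> 'm" where
  "id_nu C a b = vid C (vprod C a b)"

text \<open>The structure \<open>G(\<nu>\<^sup>F) \<Zsemi> \<nu>\<^sup>G : G(F(ab)) \<rightarrow> G(F(a)F(b)) \<rightarrow> G(F(a))G(F(b))\<close> of the composite
  of \<open>F : C \<rightarrow> D\<close> and \<open>G : D \<rightarrow> E\<close>.\<close>

definition comp_nu :: "('o, 'm, 'z) bcm_data_scheme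
    \<Rightarrow> ('c, 'o, 'm, 'y) vmoncat_data_scheme \<Rightarrow> ('d, 'o, 'm, 'x) vmoncat_data_scheme
    \<Rightarrow> ('e, 'o, 'm, 'w) vmoncat_data_scheme
    \<Rightarrow> ('c, 'd, 'm) vfun_data \<Rightarrow> ('c \<Rightarrow> 'c \<Rightarrow> 'm)
    \<Rightarrow> ('d, 'e, 'm) vfun_data \<Rightarrow> ('d \<Rightarrow> 'd \<Rightarrow> 'm) \<Rightarrow> 'c \<Rightarrow> 'c \<Rightarrow> 'm" where
  "comp_nu V C D E F \<nu>F G \<nu>G a b =
     ucomp V E (fob G (fob F (vprod C a b))) (fob G (vprod D (fob F a) (fob F b)))
         (vprod E (fob G (fob F a)) (fob G (fob F b)))
       (\<nu>F a b \<Zsemi>\<^bsub>V\<^esub> fhom G (fob F (vprod C a b)) (vprod D (fob F a) (fob F b)))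
       (\<nu>G (fob F a) (fob F b))"

locale v_monoidal_nat = v_nat V C D F G \<sigma>
  for V :: "('o, 'm, 'z) bcm_data_scheme" (structure)
    and C :: "('c, 'o, 'm, 'y) vmoncat_data_scheme"
    and D :: "('d, 'o, 'm, 'x) vmoncat_data_scheme"
    and F :: "('c, 'd, 'm) vfun_data"
    and \<nu>F :: "'c \<Rightarrow> 'c \<Rightarrow> 'm"
    and G :: "('c, 'd, 'm) vfun_data"
    and \<nu>G :: "'c \<Rightarrow> 'c \<Rightarrow> 'm"
    and \<sigma> :: "'c \<Rightarrow> 'm" +
  assumes component_vunit: "\<sigma> (vunit C) = vid D (vunit D)"
    and component_vprod: "\<lbrakk>a \<in> vob C; b \<in> vob C\<rbrakk>
      \<Longrightarrow> ucomp V D (fob F (vprod C a b)) (fob G (vprod C a b)) (vprod D (fob G a) (fob G b))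
            (\<sigma> (vprod C a b)) (\<nu>G a b)
        = ucomp V D (fob F (vprod C a b)) (vprod D (fob F a) (fob F b))
              (vprod D (fob G a) (fob G b))
            (\<nu>F a b) (utens V D (fob F a) (fob G a) (fob F b) (fob G b) (\<sigma> a) (\<sigma> b))"

definition v_monoidal_nat_iso :: "('o, 'm, 'z) bcm_data_scheme
    \<Rightarrow> ('c, 'o, 'm, 'y) vmoncat_data_scheme \<Rightarrow> ('d, 'o, 'm, 'x) vmoncat_data_scheme
    \<Rightarrow> ('c, 'd, 'm) vfun_data \<Rightarrow> ('c \<Rightarrow> 'c \<Rightarrow> 'm)
    \<Rightarrow> ('c, 'd, 'm) vfun_data \<Rightarrow> ('c \<Rightarrow> 'c \<Rightarrow> 'm) \<Rightarrow> ('c \<Rightarrow> 'm) \<Rightarrow> bool" where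
  "v_monoidal_nat_iso V C D F \<nu>F G \<nu>G \<sigma> \<longleftrightarrow> v_monoidal_nat V C D F \<nu>F G \<nu>G \<sigma> \<and>
     (\<forall>a \<in> vob C. u_iso V D (fob F a) (fob G a) (\<sigma> a))"

definition witness_v_monoidal_equivalence :: "('o, 'm, 'z) bcm_data_scheme
    \<Rightarrow> ('c, 'o, 'm, 'y) vmoncat_data_scheme \<Rightarrow> ('d, 'o, 'm, 'x) vmoncat_data_scheme
    \<Rightarrow> ('c, 'd, 'm) vfun_data \<Rightarrow> ('c \<Rightarrow> 'c \<Rightarrow> 'm)
    \<Rightarrow> ('d, 'c, 'm) vfun_data \<Rightarrow> ('d \<Rightarrow> 'd \<Rightarrow> 'm) \<Rightarrow> bool" where
  "witness_v_monoidal_equivalence V C D F \<nu>F G \<nu>G \<longleftrightarrow>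
     v_monoidal_functor V C D F \<nu>F \<and> v_monoidal_functor V D C G \<nu>G \<and>
     (\<exists>\<sigma>. v_monoidal_nat_iso V C C (comp_vfun V F G) (comp_nu V C D C F \<nu>F G \<nu>G)
            (id_vfun V C) (id_nu C) \<sigma>) \<and>
     (\<exists>\<sigma>. v_monoidal_nat_iso V D D (comp_vfun V G F) (comp_nu V D C D G \<nu>G F \<nu>F)
            (id_vfun V D) (id_nu D) \<sigma>)"


section \<open>The completion\<close>

text \<open>The objects, formal symbols consisting of an object of \<open>C\<close> and one of \<open>V\<close>, are pairs. In the
  definition of \<open>completion_tens\<close>, the sources and targets of the consecutive factors are
  \<open>u w X Y \<rightarrow> u X w Y \<rightarrow> C(a \<rightarrow> b) v C(c \<rightarrow> d) x \<rightarrow> C(a \<rightarrow> b) C(c \<rightarrow> d) v x \<rightarrow> C(ac \<rightarrow> bd) v x\<close>.\<close>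

context
  fixes V :: "('o, 'm, 'z) bcm_data_scheme" (structure)
    and C :: "('c, 'o, 'm, 'y) vmoncat_data_scheme"
begin

fun completion_hom :: "'c \<times> 'o \<Rightarrow> 'c \<times> 'o \<Rightarrow> 'o" where
  "completion_hom (a, u) (b, v) = ihom V u (vhom C a b \<odot> v)"

fun completion_id :: "'c \<times> 'o \<Rightarrow> 'm" where
  "completion_id (a, u) = mate V u \<one> (vhom C a a \<odot> u) (vid C a \<otimes> \<iota> u)"

fun completion_comp :: "'c \<times> 'o \<Rightarrow> 'c \<times> 'o \<Rightarrow> 'c \<times> 'o \<Rightarrow> 'm" where
  "completion_comp (a, u) (b, v) (c, w) =
     (let X = completion_hom (a, u) (b, v); Y = completion_hom (b, v) (c, w) in
      mate V u (X \<odot> Y) (vhom C a c \<odot> w)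
       (\<epsilon> u (vhom C a b \<odot> v) \<otimes> \<iota> Y
        \<Zsemi> \<iota> (vhom C a b) \<otimes> \<epsilon> v (vhom C b c \<odot> w)
        \<Zsemi> vcomp C a b c \<otimes> \<iota> w))"

fun completion_prod :: "'c \<times> 'o \<Rightarrow> 'c \<times> 'o \<Rightarrow> 'c \<times> 'o" where
  "completion_prod (a, u) (b, v) = (vprod C a b, u \<odot> v)"

fun completion_tens :: "'c \<times> 'o \<Rightarrow> 'c \<times> 'o \<Rightarrow> 'c \<times> 'o \<Rightarrow> 'c \<times> 'o \<Rightarrow> 'm" where
  "completion_tens (a, u) (b, v) (c, w) (d, x) =
     (let X = completion_hom (a, u) (b, v); Y = completion_hom (c, w) (d, x) in
      mate V (u \<odot> w) (X \<odot> Y) (vhom C (vprod C a c) (vprod C b d) \<odot> (v \<odot> x))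
       (\<iota> u \<otimes> \<beta> w X \<otimes> \<iota> Y
        \<Zsemi> \<epsilon> u (vhom C a b \<odot> v) \<otimes> \<epsilon> w (vhom C c d \<odot> x)
        \<Zsemi> \<iota> (vhom C a b) \<otimes> inverse_of V (\<beta> (vhom C c d) v) \<otimes> \<iota> x
        \<Zsemi> vtens C a b c d \<otimes> \<iota> (v \<odot> x)))"

definition completion :: "('c \<times> 'o, 'o, 'm) vmoncat_data" where
  "completion = \<lparr>vob = vob C \<times> obj V, vhom = completion_hom, vid = completion_id,
     vcomp = completion_comp, vunit = (vunit C, \<one>), vprod = completion_prod,
     vtens = completion_tens\<rparr>"

text \<open>\<open>(a, u) \<lhd> v = (a, u \<odot> v)\<close>\<close>

definition completion_tensoring :: "('c \<times> 'o, 'o, 'm) tensoring_data" where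
  "completion_tensoring = \<lparr>tob = (\<lambda>(a, u) v. (a, u \<odot> v)),
     tiso = (\<lambda>(a, u) v (b, w). curry_iso V u v (vhom C a b \<odot> w))\<rparr>"

definition incl_vfun :: "('c, 'c \<times> 'o, 'm) vfun_data" where
  "incl_vfun = \<lparr>fob = (\<lambda>a. (a, \<one>)),
     fhom = (\<lambda>a b. mate V \<one> (vhom C a b) (vhom C a b \<odot> \<one>) (\<iota> (vhom C a b)))\<rparr>"

definition incl_nu :: "'c \<Rightarrow> 'c \<Rightarrow> 'm" where
  "incl_nu a b = completion_id (vprod C a b, \<one>)"

end


section \<open>The functor from the completion induced by the identity\<close>

context
  fixes V :: "('o, 'm, 'z) bcm_data_scheme" (structure)
    and C :: "('c, 'o, 'm, 'y) vmoncat_data_scheme"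
    and T :: "('c, 'o, 'm) tensoring_data"
begin

text \<open>With \<open>X\<close> the hom object from \<open>(a, u)\<close> to \<open>(b, v)\<close>, this is the mate of the composite
  \<open>a \<lhd> u \<lhd> X \<rightarrow> a \<lhd> uX \<rightarrow> a \<lhd> C(a \<rightarrow> b)v \<rightarrow> a \<lhd> C(a \<rightarrow> b) \<lhd> v \<rightarrow> b \<lhd> v\<close>.\<close>

fun ext_hom :: "'c \<times> 'o \<Rightarrow> 'c \<times> 'o \<Rightarrow> 'm" where
  "ext_hom (a, u) (b, v) =
     (let H = vhom C a b;
          X = ihom V u (H \<odot> v);
          p = tob T (tob T a u) X;
          q = tob T a (u \<odot> X);
          r = tob T a (H \<odot> v);
          s = tob T (tob T a H) v;
          t = tob T b v
      in tcomate V C T (tob T a u) X t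
        (ucomp V C p s t
          (ucomp V C p r s
            (ucomp V C p q r
              (talpha_inv V C T a u X)
              (tmap V C T a a (u \<odot> X) (H \<odot> v) (vid C a) (\<epsilon> u (H \<odot> v))))
            (talpha V C T a H v))
          (tmap V C T (tob T a H) b v v (tcounit V C T a b) (\<iota> v))))"

definition ext_vfun :: "('c \<times> 'o, 'c, 'm) vfun_data" where
  "ext_vfun = \<lparr>fob = (\<lambda>(a, u). tob T a u), fhom = ext_hom\<rparr>"

definition free_ob :: "'o \<Rightarrow> 'c" where
  "free_ob v = tob T (vunit C) v"

definition free_unit :: "'o \<Rightarrow> 'm" where
  "free_unit v = tunit V C T (vunit C) v"

definition free_nu :: "'o \<Rightarrow> 'o \<Rightarrow> 'm" where
  "free_nu u v = tmate V C T (vunit C) (u \<odot> v) (vprod C (free_ob u) (free_ob v))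
     (free_unit u \<otimes> free_unit v \<Zsemi> vtens C (vunit C) (free_ob u) (vunit C) (free_ob v))"

definition half_braiding :: "'c \<Rightarrow> 'o \<Rightarrow> 'm" where
  "half_braiding a v = tmate V C T a v (vprod C (free_ob v) a)
     (free_unit v \<otimes> vid C a \<Zsemi> vtens C (vunit C) (free_ob v) a a)"

text \<open>\<open>ab G(uv) \<rightarrow> ab G(u) G(v) \<rightarrow> a G(u) b G(v)\<close>, where \<open>G = free_ob\<close>.\<close>

fun ext_nu :: "'c \<times> 'o \<Rightarrow> 'c \<times> 'o \<Rightarrow> 'm" where
  "ext_nu (a, u) (b, v) =
     (let ab = vprod C a b;
          gu = free_ob u;
          gv = free_ob v;
          bgu = vprod C b gu;
          gub = vprod C gu b
      in ucomp V C (vprod C ab (free_ob (u \<odot> v))) (vprod C ab (vprod C gu gv))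
           (vprod C (vprod C a gub) gv)
         (utens V C ab ab (free_ob (u \<odot> v)) (vprod C gu gv) (vid C ab) (free_nu u v))
         (utens V C (vprod C a bgu) (vprod C a gub) gv gv
           (utens V C a a bgu gub (vid C a) (half_braiding b u))
           (vid C gv)))"

text \<open>The conventions on the choice of the left adjoints \<open>a \<lhd> -\<close> of the representable functors
  under which \<open>ext_vfun\<close> and \<open>ext_nu\<close> form a \<open>V\<close>-monoidal functor: they are obtained from the left
  adjoint \<open>G\<close> of \<open>C(1 \<rightarrow> -)\<close> as \<open>a \<lhd> v = a G(v)\<close> with unit \<open>j \<otimes> \<eta>\<close>, and \<open>G\<close> is strictly
  unital. A closed and tensored \<open>V\<close>-monoidal category always admits such a choice, since
  \<open>C(a G(v) \<rightarrow> b) \<cong> C(G(v) \<rightarrow> [a, b]) \<cong> ihom v C(1 \<rightarrow> [a, b]) \<cong> ihom v C(a \<rightarrow> b)\<close>, and since the unit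
  object represents \<open>C(1 \<rightarrow> -)\<close>, so that \<open>G\<close> may be taken to map the unit of \<open>V\<close> to that of \<open>C\<close>.\<close>

definition monoidal_tensoring :: bool where
  "monoidal_tensoring \<longleftrightarrow>
     (\<forall>a \<in> vob C. \<forall>v \<in> obj V. tob T a v = vprod C a (free_ob v) \<and>
        tunit V C T a v = vid C a \<otimes> free_unit v \<Zsemi> vtens C a a (vunit C) (free_ob v)) \<and>
     free_ob \<one> = vunit C \<and> free_unit \<one> = vid C (vunit C)"

text \<open>The components \<open>(a, u) = (a, \<one>) \<lhd> u \<rightarrow> (a \<lhd> u, \<one>)\<close>.\<close>

definition tau :: "'c \<times> 'o \<Rightarrow> 'm" where
  "tau = (\<lambda>(a, u). mu V C T (completion V C) (completion_tensoring V C) (incl_vfun V C) a u)"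

end

end

theory Submission
  imports Defs
begin

text \<open>
  A graded element of \<open>C(a \<rightarrow> b)\<close> is a morphism \<open>f : u \<rightarrow> C(a \<rightarrow> b)\<close> of \<open>V\<close>; write \<open>f * g\<close> for the
  composite and \<open>f \<boxtimes> g\<close> for the product of graded elements (\<open>ucomp\<close> and \<open>utens\<close> make sense in all
  grades). The map \<open>\<phi> \<mapsto> \<eta> * \<phi>\<close> is a bijection from morphisms \<open>w \<rightarrow> C(a \<lhd> u \<rightarrow> b)\<close> to morphisms
  \<open>uw \<rightarrow> C(a \<rightarrow> b)\<close>, and all the structure is determined by it: \<open>ext_hom\<close> is characterised by
  \<open>\<eta> * ext_hom = \<epsilon> \<Zsemi> (id * \<eta>)\<close>, \<open>ext_nu\<close> by \<open>\<eta> * ext_nu = \<eta> \<boxtimes> \<eta>\<close>, and the component of \<open>\<tau>\<close> at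
  \<open>(a, u)\<close> is the mate of \<open>\<eta>\<close>. Hence \<open>\<tau>\<close> is always a monoidal natural transformation, the extension
  of the identity is always a functor with a unital, associative and natural \<open>ext_nu\<close>, and each
  of the four statements amounts to the invertibility of all components of \<open>\<tau>\<close>. For (1), an inverse
  of \<open>\<tau>\<close> yields one of \<open>id * \<eta>\<close> by composition in the completion, and conversely the inverse of
  \<open>\<tau>\<close> is the preimage of the identity under \<open>- * \<eta>\<close>. For (3) \<open>\<Rightarrow>\<close> (4), the half braidings in
  \<open>ext_nu\<close> are invertible because \<open>- \<otimes> b\<close> maps the isomorphism \<open>(1, u) \<cong> (G(u), 1)\<close> to
  \<open>(b, u) \<cong> (G(u)b, 1)\<close>. For (4) \<open>\<Rightarrow>\<close> (3), if \<open>\<sigma>\<close> is an isomorphism from the composite \<open>IE\<close>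
  to the identity, then \<open>\<sigma> * \<tau> = IE(\<sigma>)\<close>, since \<open>\<tau>\<close> is the identity at objects \<open>(c, 1)\<close>.
\<close>

section \<open>Calculus in a strict monoidal category\<close>

context base_category
begin

text \<open>Hom-set membership is traded for equations on \<open>src\<close> and \<open>trg\<close>,
  with which the simplifier computes; the endpoints are listed as objects because most rewrite rules
  ask for that.\<close>

lemma hom_iff:
  "f \<in> hom V u v \<longleftrightarrow> f \<in> arr V \<and> src V f = u \<and> trg V f = v \<and> u \<in> obj V \<and> v \<in> obj V"
  using src_obj trg_obj by (auto simp: hom_def)

lemma hom_objD: "f \<in> hom V u v \<Longrightarrow> u \<in> obj V" "f \<in> hom V u v \<Longrightarrow> v \<in> obj V"
  by (simp_all add: hom_iff)

lemma homI: "\<lbrakk>f \<in> arr V; src V f = u; trg V f = v\<rbrakk> \<Longrightarrow> f \<in> hom V u v"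
  by (simp add: hom_def)

declare src_obj [simp] trg_obj [simp]

lemma idt_simps [simp]:
  assumes "u \<in> obj V"
  shows "\<iota> u \<in> arr V" "src V (\<iota> u) = u" "trg V (\<iota> u) = u"
  using idt_hom [OF assms] by (simp_all add: hom_def)

lemma cmp_simps [simp]:
  assumes "f \<in> arr V" "g \<in> arr V" "trg V f = src V g"
  shows "f \<Zsemi> g \<in> arr V" "src V (f \<Zsemi> g) = src V f" "trg V (f \<Zsemi> g) = trg V g"
  using cmp_hom [of f "src V f" "src V g" g "trg V g"] assms by (simp_all add: hom_def)

lemma cmp_assoc' [simp]:
  "\<lbrakk>f \<in> arr V; g \<in> arr V; h \<in> arr V; trg V f = src V g; trg V g = src V h\<rbrakk>
    \<Longrightarrow> f \<Zsemi> g \<Zsemi> h = f \<Zsemi> (g \<Zsemi> h)"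
  by (rule cmp_assoc) (auto simp: hom_def)

lemma idt_cmp' [simp]: "\<lbrakk>f \<in> arr V; src V f = u\<rbrakk> \<Longrightarrow> \<iota> u \<Zsemi> f = f"
  by (rule idt_cmp) (auto simp: hom_def)

lemma cmp_idt' [simp]: "\<lbrakk>f \<in> arr V; trg V f = u\<rbrakk> \<Longrightarrow> f \<Zsemi> \<iota> u = f"
  by (rule cmp_idt) (auto simp: hom_def)

lemma is_inverse_unique:
  assumes "is_inverse V u v f g" "is_inverse V u v f h"
  shows "g = h"
proof -
  have "g = g \<Zsemi> (f \<Zsemi> h)" using assms by (auto simp: is_inverse_def hom_iff)
  also have "\<dots> = (g \<Zsemi> f) \<Zsemi> h" 
    using assms by (subst cmp_assoc) (auto simp: is_inverse_def)
  also have "\<dots> = h" using assms by (auto simp: is_inverse_def hom_iff)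
  finally show ?thesis .
qed

lemma inverse_of:
  assumes "is_iso V u v f"
  shows "is_inverse V u v f (inverse_of V f)"
proof -
  obtain g where g: "is_inverse V u v f g" using assms by (auto simp: is_iso_def)
  then have "src V f = u" "trg V f = v" by (auto simp: is_inverse_def hom_def)
  then show ?thesis using g unfolding inverse_of_def
    by (auto intro: theI is_inverse_unique)
qed

lemma inverse_of_eqI: "is_inverse V u v f g \<Longrightarrow> inverse_of V f = g"
  using inverse_of is_inverse_unique is_iso_def by metis

lemma inverse_of_idt [simp]: "u \<in> obj V \<Longrightarrow> inverse_of V (\<iota> u) = \<iota> u"
  by (rule inverse_of_eqI) (simp add: is_inverse_def hom_iff)

end

section \<open>Strict monoidal structure and interchange\<close>

context strict_monoidal
begin

declare unt_obj [simp] otens_obj [simp] otens_assoc [simp] unt_otens [simp] otens_unt [simp]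
  atens_idt [simp] atens_assoc [simp] unt_atens [simp] atens_unt [simp]

lemma atens_simps [simp]:
  assumes "f \<in> arr V" "g \<in> arr V"
  shows "f \<otimes> g \<in> arr V" "src V (f \<otimes> g) = src V f \<odot> src V g" "trg V (f \<otimes> g) = trg V f \<odot> trg V g"
  using atens_hom [of f "src V f" "trg V f" g "src V g" "trg V g"] assms by (simp_all add: hom_def)

text \<open>Interchange is oriented towards merging two tensor products into one. It is no default
  rewrite rule, because other steps split whiskered composites in the opposite direction.\<close>

lemma tens_cmp:
  "\<lbrakk>f \<in> arr V; f' \<in> arr V; g \<in> arr V; g' \<in> arr V; trg V f = src V f'; trg V g = src V g'\<rbrakk>
    \<Longrightarrow> f \<otimes> g \<Zsemi> f' \<otimes> g' = (f \<Zsemi> f') \<otimes> (g \<Zsemi> g')"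
  by (rule atens_cmp [symmetric]) (auto simp: hom_def)

text \<open>\<open>atens_assoc\<close> nests tensor products to the right, which hides adjacent
  identities from \<open>atens_idt\<close>; this rule merges them in that position.\<close>

lemma idt_atens_idt [simp]:
  "\<lbrakk>u \<in> obj V; v \<in> obj V; f \<in> arr V\<rbrakk> \<Longrightarrow> \<iota> u \<otimes> (\<iota> v \<otimes> f) = \<iota> (u \<odot> v) \<otimes> f"
  by (simp flip: atens_assoc atens_idt)

text \<open>Composites are nested to the right, so a mergeable pair of tensor products usually has a
  tail \<open>k\<close> behind it.\<close>

lemma tens_cmp_chain:
  "\<lbrakk>f \<in> arr V; f' \<in> arr V; g \<in> arr V; g' \<in> arr V; k \<in> arr V;
     trg V f = src V f'; trg V g = src V g'; src V k = trg V f' \<odot> trg V g'\<rbrakk>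
    \<Longrightarrow> f \<otimes> g \<Zsemi> (f' \<otimes> g' \<Zsemi> k) = (f \<Zsemi> f') \<otimes> (g \<Zsemi> g') \<Zsemi> k"
  by (simp flip: tens_cmp cmp_assoc')

lemma atens_factor:
  assumes "f \<in> arr V" "g \<in> arr V"
  shows "f \<otimes> g = f \<otimes> \<iota> (src V g) \<Zsemi> \<iota> (trg V f) \<otimes> g"
    and "f \<otimes> g = \<iota> (src V f) \<otimes> g \<Zsemi> f \<otimes> \<iota> (trg V g)"
  using assms by (simp_all add: tens_cmp)

end

section \<open>The braiding and the unit object\<close>

context braided_monoidal
begin

lemma brd_hom: "\<lbrakk>u \<in> obj V; v \<in> obj V\<rbrakk> \<Longrightarrow> \<beta> u v \<in> hom V (u \<odot> v) (v \<odot> u)"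
  using brd_iso by (auto simp: is_iso_def is_inverse_def)

lemma brd_simps [simp]:
  "\<lbrakk>u \<in> obj V; v \<in> obj V\<rbrakk> \<Longrightarrow> \<beta> u v \<in> arr V"
  "\<lbrakk>u \<in> obj V; v \<in> obj V\<rbrakk> \<Longrightarrow> src V (\<beta> u v) = u \<odot> v"
  "\<lbrakk>u \<in> obj V; v \<in> obj V\<rbrakk> \<Longrightarrow> trg V (\<beta> u v) = v \<odot> u"
  using brd_hom by (auto simp: hom_def)

lemma idempotent_iso:
  assumes "is_iso V u u f" "f \<Zsemi> f = f"
  shows "f = \<iota> u"
proof -
  obtain g where g: "is_inverse V u u f g" using assms(1) by (auto simp: is_iso_def)
  then have "f = (f \<Zsemi> f) \<Zsemi> g"
    by (subst cmp_assoc) (auto simp: is_inverse_def hom_iff)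
  then show ?thesis using g assms(2) by (simp add: is_inverse_def)
qed

text \<open>A hexagon with two unit arguments makes the braiding idempotent; being invertible, it is
  then the identity.\<close>

lemma brd_unt [simp]: assumes "u \<in> obj V" shows "\<beta> u \<one> = \<iota> u" "\<beta> \<one> u = \<iota> u"
  using hexagon_right [of u \<one> \<one>] hexagon_left [of \<one> \<one> u] brd_iso [of u \<one>] brd_iso [of \<one> u] assms
  by (auto intro: idempotent_iso)

lemma inverse_brd:
  assumes "u \<in> obj V" "v \<in> obj V"
  shows "inverse_of V (\<beta> u v) \<in> hom V (v \<odot> u) (u \<odot> v)"
    and "inverse_of V (\<beta> u v) \<Zsemi> \<beta> u v = \<iota> (v \<odot> u)"
  using inverse_of [OF brd_iso [OF assms]] by (auto simp: is_inverse_def)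

lemma inverse_brd_simps [simp]:
  assumes "u \<in> obj V" "v \<in> obj V"
  shows "inverse_of V (\<beta> u v) \<in> arr V" "src V (inverse_of V (\<beta> u v)) = v \<odot> u"
    "trg V (inverse_of V (\<beta> u v)) = u \<odot> v"
  using inverse_brd [OF assms] by (auto simp: hom_iff)

end

section \<open>Mates and currying\<close>

context braided_closed_monoidal
begin

declare ihom_obj [simp]

lemma evl_simps [simp]:
  assumes "u \<in> obj V" "v \<in> obj V"
  shows "\<epsilon> u v \<in> arr V" "src V (\<epsilon> u v) = u \<odot> ihom V u v" "trg V (\<epsilon> u v) = v"
  using evl_hom [OF assms] by (auto simp: hom_def)

lemma evl_inj:
  assumes "u \<in> obj V" "v \<in> obj V" "h \<in> hom V w (ihom V u v)" "k \<in> hom V w (ihom V u v)"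
    and "\<iota> u \<otimes> h \<Zsemi> \<epsilon> u v = \<iota> u \<otimes> k \<Zsemi> \<epsilon> u v"
  shows "h = k"
  using evl_universal [of u v w] assms hom_objD(1) [OF assms(3)]
  by (auto simp: bij_betw_def inj_on_def)

lemma mate_hom_evl:
  assumes "g \<in> hom V (u \<odot> w) v" "u \<in> obj V" "w \<in> obj V"
  shows "mate V u w v g \<in> hom V w (ihom V u v)" "\<iota> u \<otimes> mate V u w v g \<Zsemi> \<epsilon> u v = g"
proof -
  have "v \<in> obj V" using assms hom_objD by auto
  then have bij: "bij_betw (\<lambda>h. \<iota> u \<otimes> h \<Zsemi> \<epsilon> u v) (hom V w (ihom V u v)) (hom V (u \<odot> w) v)"
    using assms evl_universal by auto
  show "mate V u w v g \<in> hom V w (ihom V u v)"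
    unfolding mate_def using bij assms by (auto simp: bij_betw_def intro: the_inv_into_into)
  show "\<iota> u \<otimes> mate V u w v g \<Zsemi> \<epsilon> u v = g"
    unfolding mate_def using bij assms by (auto simp: bij_betw_def intro: f_the_inv_into_f)
qed

lemma mate_simps [simp]:
  assumes "g \<in> arr V" "src V g = u \<odot> w" "trg V g = v" "u \<in> obj V" "w \<in> obj V"
  shows "mate V u w v g \<in> arr V" "src V (mate V u w v g) = w" "trg V (mate V u w v g) = ihom V u v"
    and mate_evl: "\<iota> u \<otimes> mate V u w v g \<Zsemi> \<epsilon> u v = g"
  using mate_hom_evl [of g u w v] assms by (auto simp: hom_def)

lemma mate_eqI:
  assumes "h \<in> hom V w (ihom V u v)" "\<iota> u \<otimes> h \<Zsemi> \<epsilon> u v = g" "u \<in> obj V" "v \<in> obj V"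
  shows "h = mate V u w v g"
proof (rule evl_inj [OF assms(3,4,1)])
  have w: "w \<in> obj V" using assms hom_objD by auto
  have g: "g \<in> hom V (u \<odot> w) v" using assms w by (auto simp: hom_iff intro!: homI)
  show "mate V u w v g \<in> hom V w (ihom V u v)"
    "\<iota> u \<otimes> h \<Zsemi> \<epsilon> u v = \<iota> u \<otimes> mate V u w v g \<Zsemi> \<epsilon> u v"
    using mate_hom_evl [OF g assms(3) w] assms(2) by simp_all
qed

lemma uncurry_pre:
  assumes "u \<in> obj V" "v \<in> obj V" "p \<in> arr V" "h \<in> arr V" "trg V p = src V h"
    "trg V h = ihom V u v"
  shows "\<iota> u \<otimes> (p \<Zsemi> h) \<Zsemi> \<epsilon> u v = \<iota> u \<otimes> p \<Zsemi> (\<iota> u \<otimes> h \<Zsemi> \<epsilon> u v)"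
  using assms by (simp add: tens_cmp_chain)

text \<open>Naturality of mates in \<open>w\<close>: by uniqueness of mates it is enough to
  evaluate.\<close>

lemma mate_pre:
  assumes "u \<in> obj V" "p \<in> arr V" "trg V p = w" "g \<in> arr V" "src V g = u \<odot> w" "trg V g = v"
  shows "p \<Zsemi> mate V u w v g = mate V u (src V p) v (\<iota> u \<otimes> p \<Zsemi> g)"
proof (rule mate_eqI)
  show "p \<Zsemi> mate V u w v g \<in> hom V (src V p) (ihom V u v)"
    using assms by (auto intro!: homI)
  show "\<iota> u \<otimes> (p \<Zsemi> mate V u w v g) \<Zsemi> \<epsilon> u v = \<iota> u \<otimes> p \<Zsemi> g"
    using assms by (auto simp: uncurry_pre mate_evl)
  show "u \<in> obj V" "v \<in> obj V" using assms by auto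
qed

lemma curry_iso_hom:
  assumes "u \<in> obj V" "v \<in> obj V" "x \<in> obj V"
  shows "curry_iso V u v x \<in> hom V (ihom V (u \<odot> v) x) (ihom V v (ihom V u x))"
  using assms unfolding curry_iso_def by (auto intro!: homI)

text \<open>Precomposition moves inside both mates of \<open>curry_iso\<close>, where the evaluation
  cancels the mate over \<open>u \<odot> v\<close>.\<close>

lemma mate_curry_iso:
  assumes "u \<in> obj V" "v \<in> obj V" "w \<in> obj V" "h \<in> hom V (u \<odot> v \<odot> w) x"
  shows "mate V (u \<odot> v) w x h \<Zsemi> curry_iso V u v x
    = mate V v w (ihom V u x) (mate V u (v \<odot> w) x h)"
proof -
  have x: "x \<in> obj V" using assms hom_objD by auto
  have m: "mate V (u \<odot> v) w x h \<in> hom V w (ihom V (u \<odot> v) x)"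
    using assms by (intro mate_hom_evl) auto
  show ?thesis
    unfolding curry_iso_def using assms x m
    by (simp add: mate_pre hom_iff mate_evl)
qed

lemma curry_iso_is_iso:
  assumes "u \<in> obj V" "v \<in> obj V" "x \<in> obj V"
  shows "is_iso V (ihom V (u \<odot> v) x) (ihom V v (ihom V u x)) (curry_iso V u v x)"
proof -
  let ?w = "ihom V v (ihom V u x)"
  \<comment> \<open>The inverse is the mate over \<open>u \<odot> v\<close> of the double
    evaluation, first at \<open>v\<close> and then at \<open>u\<close>.\<close>
  let ?h = "\<iota> u \<otimes> \<epsilon> v (ihom V u x) \<Zsemi> \<epsilon> u x"
  let ?g = "mate V (u \<odot> v) ?w x ?h"
  have g: "?g \<in> hom V ?w (ihom V (u \<odot> v) x)" using assms by (auto intro!: homI)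
  have "mate V u (v \<odot> ?w) x ?h = \<epsilon> v (ihom V u x)"
    by (rule mate_eqI [symmetric]) (use assms in \<open>auto intro!: homI\<close>)
  then have gc: "?g \<Zsemi> curry_iso V u v x = \<iota> ?w"
    using assms by (auto simp: mate_curry_iso homI intro!: mate_eqI [symmetric])
  have c: "curry_iso V u v x \<in> hom V (ihom V (u \<odot> v) x) ?w"
    using assms by (rule curry_iso_hom)
  have "curry_iso V u v x \<Zsemi> ?g = \<iota> (ihom V (u \<odot> v) x)"
  proof -
    have "\<iota> v \<otimes> curry_iso V u v x \<Zsemi> \<epsilon> v (ihom V u x)
        = mate V u (v \<odot> ihom V (u \<odot> v) x) x (\<epsilon> (u \<odot> v) x)"
      using assms unfolding curry_iso_def by (intro mate_hom_evl) (auto intro!: homI)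
    then have "\<iota> (u \<odot> v) \<otimes> curry_iso V u v x \<Zsemi> ?h = \<epsilon> (u \<odot> v) x"
      using assms c 
      by (simp add: hom_iff tens_cmp_chain atens_idt [symmetric] del: atens_idt idt_atens_idt)
    then show ?thesis
      using assms c by (auto simp: mate_pre hom_iff intro!: mate_eqI [symmetric])
  qed
  then show ?thesis using g gc c by (auto simp: is_iso_def is_inverse_def)
qed

text \<open>The tensorings of the completion and of \<open>self_vcat V\<close> both use
  \<open>curry_iso\<close>, so \<open>tmate\<close> contains its inverse there; on iterated mates
  that inverse can be computed.\<close>

lemma uncurried_curry_inverse:
  assumes "u \<in> obj V" "v \<in> obj V" "w \<in> obj V" "h \<in> hom V (u \<odot> v \<odot> w) x"
  shows "mate V v w (ihom V u x) (mate V u (v \<odot> w) x h) \<Zsemi> inverse_of V (curry_iso V u v x)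
    = mate V (u \<odot> v) w x h"
proof -
  have x: "x \<in> obj V" using assms hom_objD by auto
  have "is_inverse V (ihom V (u \<odot> v) x) (ihom V v (ihom V u x))
      (curry_iso V u v x) (inverse_of V (curry_iso V u v x))"
    using curry_iso_is_iso [OF assms(1,2) x] by (rule inverse_of)
  moreover have "mate V (u \<odot> v) w x h \<in> hom V w (ihom V (u \<odot> v) x)"
    using assms by (intro mate_hom_evl) auto
  ultimately show ?thesis
    by (simp flip: mate_curry_iso [OF assms] add: hom_iff is_inverse_def)
qed

end

section \<open>Composition of graded elements\<close>

locale enriched_category = braided_closed_monoidal V + v_category V C
  for V :: "('o, 'm, 'z) bcm_data_scheme" (structure)
    and C :: "('c, 'o, 'm, 'y) vcat_data_scheme"
begin

abbreviation hm :: "'c \<Rightarrow> 'c \<Rightarrow> 'o" where "hm \<equiv> vhom C"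
abbreviation cp :: "'c \<Rightarrow> 'c \<Rightarrow> 'c \<Rightarrow> 'm \<Rightarrow> 'm \<Rightarrow> 'm" where "cp \<equiv> ucomp V C"

declare vhom_obj [simp]

lemma vid_simps [simp]:
  assumes "a \<in> vob C"
  shows "vid C a \<in> arr V" "src V (vid C a) = \<one>" "trg V (vid C a) = hm a a"
  using vid_hom [OF assms] by (simp_all add: hom_def)

lemma vcomp_simps [simp]:
  assumes "a \<in> vob C" "b \<in> vob C" "c \<in> vob C"
  shows "vcomp C a b c \<in> arr V" "src V (vcomp C a b c) = hm a b \<odot> hm b c"
    "trg V (vcomp C a b c) = hm a c"
  using vcomp_hom [OF assms] by (simp_all add: hom_def)

lemma cp_simps [simp]:
  assumes "a \<in> vob C" "b \<in> vob C" "c \<in> vob C" "f \<in> arr V" "trg V f = hm a b"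
    "g \<in> arr V" "trg V g = hm b c"
  shows "cp a b c f g \<in> arr V" "src V (cp a b c f g) = src V f \<odot> src V g"
    "trg V (cp a b c f g) = hm a c"
  using assms by (simp_all add: ucomp_def)

lemma pre_cp:
  assumes "a \<in> vob C" "b \<in> vob C" "c \<in> vob C" "f \<in> arr V" "trg V f = hm a b"
    "g \<in> arr V" "trg V g = hm b c" "p \<in> arr V" "trg V p = src V f" "q \<in> arr V" "trg V q = src V g"
  shows "p \<otimes> q \<Zsemi> cp a b c f g = cp a b c (p \<Zsemi> f) (q \<Zsemi> g)"
  using assms by (simp add: ucomp_def tens_cmp_chain)

text \<open>The identities of the hom objects are the universal graded elements; in this form the
  laws for \<open>cp\<close> apply to \<open>vcomp\<close> itself.\<close>

lemma vcomp_eq_cp: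
  "\<lbrakk>a \<in> vob C; b \<in> vob C; c \<in> vob C\<rbrakk> \<Longrightarrow> vcomp C a b c = cp a b c (\<iota> (hm a b)) (\<iota> (hm b c))"
  by (simp add: ucomp_def)

lemma cp_assoc [simp]:
  assumes "a \<in> vob C" "b \<in> vob C" "c \<in> vob C" "d \<in> vob C" "f \<in> arr V" "trg V f = hm a b"
    "g \<in> arr V" "trg V g = hm b c" "h \<in> arr V" "trg V h = hm c d"
  shows "cp a c d (cp a b c f g) h = cp a b d f (cp b c d g h)"
proof -
  have "cp a c d (cp a b c f g) h
      = f \<otimes> g \<otimes> h \<Zsemi> (vcomp C a b c \<otimes> \<iota> (hm c d) \<Zsemi> vcomp C a c d)"
    using assms by (simp add: ucomp_def tens_cmp_chain flip: atens_assoc)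
  also have "\<dots> = cp a b d f (cp b c d g h)"
    using assms by (simp add: vcomp_assoc ucomp_def tens_cmp_chain)
  finally show ?thesis .
qed

lemma vid_cp [simp]:
  assumes "a \<in> vob C" "b \<in> vob C" "f \<in> arr V" "trg V f = hm a b"
  shows "cp a a b (vid C a) f = f"
proof -
  have "cp a a b (vid C a) f = \<iota> \<one> \<otimes> f \<Zsemi> (vid C a \<otimes> \<iota> (hm a b) \<Zsemi> vcomp C a a b)"
    using assms unfolding ucomp_def by (subst tens_cmp_chain) auto
  then show ?thesis using assms by (simp add: vid_vcomp)
qed

lemma cp_vid [simp]:
  assumes "a \<in> vob C" "b \<in> vob C" "f \<in> arr V" "trg V f = hm a b"
  shows "cp a b b f (vid C b) = f"
proof -
  have "cp a b b f (vid C b) = f \<otimes> \<iota> \<one> \<Zsemi> (\<iota> (hm a b) \<otimes> vid C b \<Zsemi> vcomp C a b b)"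
    using assms unfolding ucomp_def by (subst tens_cmp_chain) auto
  then show ?thesis using assms by (simp add: vcomp_vid)
qed

lemma u_inverseD:
  assumes "u_inverse V C a b f g" "a \<in> vob C" "b \<in> vob C"
  shows "f \<in> arr V" "src V f = \<one>" "trg V f = hm a b" "g \<in> arr V" "src V g = \<one>"
    "trg V g = hm b a" "cp a b a f g = vid C a" "cp b a b g f = vid C b"
  using assms by (auto simp: u_inverse_def uhom_def hom_def)

lemma u_inverseI:
  assumes "f \<in> arr V" "src V f = \<one>" "trg V f = hm a b" "g \<in> arr V" "src V g = \<one>"
    "trg V g = hm b a" "cp a b a f g = vid C a" "cp b a b g f = vid C b"
  shows "u_inverse V C a b f g"
  using assms by (auto simp: u_inverse_def uhom_def hom_def)

lemma u_inverse_unique: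
  assumes "u_inverse V C a b f g" "u_inverse V C a b f h" "a \<in> vob C" "b \<in> vob C"
  shows "g = h"
proof -
  note [simp] = u_inverseD [OF assms(1) assms(3,4)] u_inverseD [OF assms(2) assms(3,4)] 
  have "g = cp b a a g (cp a b a f h)" using assms(3,4) by simp
  also have "\<dots> = cp b b a (cp b a b g f) h" using assms(3,4) by (subst cp_assoc) auto
  also have "\<dots> = h" using assms(3,4) by simp
  finally show ?thesis .
qed

lemma u_inverse_sym: "u_inverse V C a b f g \<Longrightarrow> u_inverse V C b a g f"
  by (auto simp: u_inverse_def)

lemma u_iso_vid: "a \<in> vob C \<Longrightarrow> u_iso V C a a (vid C a)"
  by (auto simp: u_iso_def intro!: exI [of _ "vid C a"] u_inverseI)

lemma u_inverse_cp:
  assumes "u_inverse V C a b f f'" "u_inverse V C b c g g'" "a \<in> vob C" "b \<in> vob C" "c \<in> vob C"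
  shows "u_inverse V C a c (cp a b c f g) (cp c b a g' f')"
proof -
  note [simp] = u_inverseD [OF assms(1) assms(3,4)] u_inverseD [OF assms(2) assms(4,5)] assms(3-)
  have "cp b c a g (cp c b a g' f') = cp b b a (cp b c b g g') f'" by (subst cp_assoc) auto
  moreover have "cp b a c f' (cp a b c f g) = cp b b c (cp b a b f' f) g" by (subst cp_assoc) auto
  ultimately show ?thesis by (auto intro!: u_inverseI)
qed

lemma u_iso_cp:
  assumes "u_iso V C a b f" "u_iso V C b c g" "a \<in> vob C" "b \<in> vob C" "c \<in> vob C"
  shows "u_iso V C a c (cp a b c f g)"
  using assms u_inverse_cp unfolding u_iso_def by meson

text \<open>The inverse of \<open>f\<close> is composed back on. Later \<open>f\<close> is a
  component of \<tau> or of a given natural isomorphism.\<close>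

lemma u_iso_cancel_left:
  assumes "u_iso V C a b f" "u_iso V C a c (cp a b c f g)" "g \<in> arr V" "trg V g = hm b c"
    "a \<in> vob C" "b \<in> vob C" "c \<in> vob C"
  shows "u_iso V C b c g"
proof -
  obtain f' where f': "u_inverse V C a b f f'" using assms by (auto simp: u_iso_def)
  note [simp] = u_inverseD [OF f' assms(5,6)]
  have "u_iso V C b a f'" using u_inverse_sym [OF f'] by (auto simp: u_iso_def)
  then have "u_iso V C b c (cp b a c f' (cp a b c f g))"
    by (rule u_iso_cp [OF _ assms(2,6,5,7)])
  moreover have "cp b a c f' (cp a b c f g) = cp b b c (cp b a b f' f) g"
    using assms(3-) by (subst cp_assoc) auto
  ultimately show ?thesis using assms(3-) by simp
qed

end

section \<open>Enriched functors acting on graded elements\<close>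

lemma (in v_functor) fhom_simps [simp]:
  assumes "a \<in> vob C" "b \<in> vob C"
  shows "fhom F a b \<in> arr V" "src V (fhom F a b) = vhom C a b"
    "trg V (fhom F a b) = vhom D (fob F a) (fob F b)"
  using fhom_hom [OF assms] by (simp_all add: hom_def)

lemma v_functor_ucomp:
  assumes "v_functor V C D F" "enriched_category V C" "enriched_category V D"
    and "a \<in> vob C" "b \<in> vob C" "c \<in> vob C"
    and "f \<in> arr V" "trg V f = vhom C a b" "g \<in> arr V" "trg V g = vhom C b c"
  shows "ucomp V C a b c f g \<Zsemi>\<^bsub>V\<^esub> fhom F a c
    = ucomp V D (fob F a) (fob F b) (fob F c) (f \<Zsemi>\<^bsub>V\<^esub> fhom F a b) (g \<Zsemi>\<^bsub>V\<^esub> fhom F b c)"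
proof -
  interpret v_functor V C D F by fact
  interpret C: enriched_category V C by fact
  interpret D: enriched_category V D by fact
  show ?thesis
    unfolding ucomp_def using assms(4-) fob_vob
    by (simp add: fhom_vcomp C.tens_cmp_chain)
qed

lemma v_functor_u_inverse:
  assumes "v_functor V C D F" "enriched_category V C" "enriched_category V D"
    and "a \<in> vob C" "b \<in> vob C" "u_inverse V C a b f g"
  shows "u_inverse V D (fob F a) (fob F b) (f \<Zsemi>\<^bsub>V\<^esub> fhom F a b) (g \<Zsemi>\<^bsub>V\<^esub> fhom F b a)"
proof -
  interpret v_functor V C D F by fact
  interpret C: enriched_category V C by fact
  interpret D: enriched_category V D by fact
  note [simp] = C.u_inverseD [OF assms(6,4,5)]
  show ?thesis
    using assms(4-) fob_vob
    by (auto intro!: D.u_inverseI simp: fhom_vid simp flip: v_functor_ucomp [OF assms(1-3)])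
qed


section \<open>The universal property of tensors\<close>

locale tensored_category = enriched_category V C
  for V :: "('o, 'm, 'z) bcm_data_scheme" (structure)
    and C :: "('c, 'o, 'm, 'y) vcat_data_scheme" +
  fixes T :: "('c, 'o, 'm) tensoring_data"
  assumes tensoring: "tensoring V C T"
begin

abbreviation tn where "tn \<equiv> tob T"
abbreviation eta where "eta \<equiv> tunit V C T"

text \<open>\<open>tensoring\<close> hides the adjunction behind an existential quantifier. It is
  opened here once, and the invertibility of \<open>tiso\<close> and its naturality in the target
  are recorded with \<open>self_vcat\<close> and \<open>repr_vfun\<close> unfolded.\<close>

lemma tensoring_facts:
  assumes "a \<in> vob C"
  shows tn_vob [simp]: "v \<in> obj V \<Longrightarrow> tn a v \<in> vob C"
    and tiso_inverse: "\<lbrakk>v \<in> obj V; b \<in> vob C\<rbrakk> \<Longrightarrow>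
      is_inverse V (hm (tn a v) b) (ihom V v (hm a b)) (tiso T a v b) (inverse_of V (tiso T a v b))"
    and tiso_natural: "\<lbrakk>v \<in> obj V; b \<in> vob C; c \<in> vob C\<rbrakk> \<Longrightarrow>
      vcomp C (tn a v) b c \<Zsemi> tiso T a v c
        = tiso T a v b \<otimes> mate V (hm a b) (hm b c) (hm a c) (vcomp C a b c)
          \<Zsemi> mate V v (ihom V v (hm a b) \<odot> ihom V (hm a b) (hm a c)) (hm a c)
            (\<epsilon> v (hm a b) \<otimes> \<iota> (ihom V (hm a b) (hm a c)) \<Zsemi> \<epsilon> (hm a b) (hm a c))"
proof -
  obtain act where "v_adjunction V (self_vcat V) C \<lparr>fob = tn a, fhom = act\<rparr> (repr_vfun V C a) (tiso T a)"
    using tensoring assms by (auto simp: tensoring_def)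
  then interpret adj: v_adjunction V "self_vcat V" C "\<lparr>fob = tn a, fhom = act\<rparr>"
    "repr_vfun V C a" "tiso T a" .
  show "v \<in> obj V \<Longrightarrow> tn a v \<in> vob C"
    using adj.left.fob_vob by (simp add: self_vcat_def)
  show "\<lbrakk>v \<in> obj V; b \<in> vob C\<rbrakk> \<Longrightarrow>
      is_inverse V (hm (tn a v) b) (ihom V v (hm a b)) (tiso T a v b) (inverse_of V (tiso T a v b))"
    using adj.adj_iso [of v b] by (intro inverse_of) (simp add: self_vcat_def repr_vfun_def)
  show "\<lbrakk>v \<in> obj V; b \<in> vob C; c \<in> vob C\<rbrakk> \<Longrightarrow>
      vcomp C (tn a v) b c \<Zsemi> tiso T a v c
        = tiso T a v b \<otimes> mate V (hm a b) (hm b c) (hm a c) (vcomp C a b c)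
          \<Zsemi> mate V v (ihom V v (hm a b) \<odot> ihom V (hm a b) (hm a c)) (hm a c)
            (\<epsilon> v (hm a b) \<otimes> \<iota> (ihom V (hm a b) (hm a c)) \<Zsemi> \<epsilon> (hm a b) (hm a c))"
    using adj.adj_natural_right [of v b c] by (simp add: self_vcat_def repr_vfun_def)
qed

lemma tiso_simps [simp]:
  assumes "a \<in> vob C" "v \<in> obj V" "b \<in> vob C"
  shows "tiso T a v b \<in> arr V" "src V (tiso T a v b) = hm (tn a v) b"
    "trg V (tiso T a v b) = ihom V v (hm a b)"
    "inverse_of V (tiso T a v b) \<in> arr V" "src V (inverse_of V (tiso T a v b)) = ihom V v (hm a b)"
    "trg V (inverse_of V (tiso T a v b)) = hm (tn a v) b"
    "inverse_of V (tiso T a v b) \<Zsemi> tiso T a v b = \<iota> (ihom V v (hm a b))"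
  using tiso_inverse [OF assms] by (auto simp: is_inverse_def hom_def)

lemma eta_simps [simp]:
  assumes "a \<in> vob C" "v \<in> obj V"
  shows "eta a v \<in> arr V" "src V (eta a v) = v" "trg V (eta a v) = hm a (tn a v)"
  using assms by (simp_all add: tunit_def tcomate_def)

text \<open>A Yoneda argument. Writing \<open>f\<close> as \<open>vid C (tn a v)\<close> composed
  with \<open>f\<close> and applying naturality of \<open>tiso\<close> in the target reduces the
  value at \<open>f\<close> to the value at the identity, whose uncurried form is
  \<open>eta a v\<close>.\<close>

lemma tiso_eq_eta:
  assumes "a \<in> vob C" "v \<in> obj V" "b \<in> vob C" "f \<in> arr V" "trg V f = hm (tn a v) b"
  shows "\<iota> v \<otimes> (f \<Zsemi> tiso T a v b) \<Zsemi> \<epsilon> v (hm a b) = cp a (tn a v) b (eta a v) f"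
proof -
  let ?t = "tn a v"
  let ?H = "hm a ?t" and ?K = "hm ?t b" and ?L = "hm a b"
  let ?m = "mate V ?H ?K ?L (vcomp C a ?t b)"
  let ?j = "vid C ?t \<Zsemi> tiso T a v ?t"
  have "f \<Zsemi> tiso T a v b = (vid C ?t \<otimes> f \<Zsemi> vcomp C ?t ?t b) \<Zsemi> tiso T a v b"
    using assms vid_cp [of ?t b f] by (simp add: ucomp_def)
  also have "\<dots> = vid C ?t \<otimes> f \<Zsemi> (vcomp C ?t ?t b \<Zsemi> tiso T a v b)"
    using assms by simp
  also have "\<dots> = ?j \<otimes> (f \<Zsemi> ?m)
      \<Zsemi> mate V v (ihom V v ?H \<odot> ihom V ?H ?L) ?L (\<epsilon> v ?H \<otimes> \<iota> (ihom V ?H ?L) \<Zsemi> \<epsilon> ?H ?L)"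
    using assms by (simp add: tiso_natural tens_cmp_chain)
  finally have "\<iota> v \<otimes> (f \<Zsemi> tiso T a v b) \<Zsemi> \<epsilon> v ?L
      = \<iota> v \<otimes> ?j \<otimes> (f \<Zsemi> ?m) \<Zsemi> (\<epsilon> v ?H \<otimes> \<iota> (ihom V ?H ?L) \<Zsemi> \<epsilon> ?H ?L)"
    using assms by (simp add: uncurry_pre mate_evl)
  also have "\<dots> = (\<iota> v \<otimes> ?j \<Zsemi> \<epsilon> v ?H) \<otimes> (f \<Zsemi> ?m) \<Zsemi> \<epsilon> ?H ?L"
    using assms by (simp add: tens_cmp_chain flip: atens_assoc)
  also have "\<iota> v \<otimes> ?j \<Zsemi> \<epsilon> v ?H = eta a v"
    by (simp add: tunit_def tcomate_def)
  also have "eta a v \<otimes> (f \<Zsemi> ?m) \<Zsemi> \<epsilon> ?H ?L = eta a v \<otimes> f \<Zsemi> (\<iota> ?H \<otimes> ?m \<Zsemi> \<epsilon> ?H ?L)"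
    using assms by (subst tens_cmp_chain) simp_all
  also have "\<dots> = cp a ?t b (eta a v) f"
    using assms by (simp add: mate_evl ucomp_def)
  finally show ?thesis .
qed

text \<open>This combines the invertibility of \<open>tiso\<close> with the uniqueness of mates.
  Later identities between elements out of \<open>tn a v\<close> are verified in this way, in every
  grade.\<close>

lemma eta_inj:
  assumes "cp a (tn a v) b (eta a v) f = cp a (tn a v) b (eta a v) g"
    and "a \<in> vob C" "v \<in> obj V" "b \<in> vob C" "f \<in> arr V" "trg V f = hm (tn a v) b"
    and "g \<in> arr V" "trg V g = hm (tn a v) b" "src V f = src V g"
  shows "f = g"
proof -
  have "f \<Zsemi> tiso T a v b = g \<Zsemi> tiso T a v b"
    by (rule evl_inj [of v "hm a b" _ "src V f"]) (use assms in \<open>auto simp: tiso_eq_eta hom_iff\<close>)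
  then have "(f \<Zsemi> tiso T a v b) \<Zsemi> inverse_of V (tiso T a v b)
      = (g \<Zsemi> tiso T a v b) \<Zsemi> inverse_of V (tiso T a v b)"
    by simp
  then show ?thesis using assms tiso_inverse [of a v b] by (simp add: is_inverse_def)
qed

text \<open>The grade \<open>w\<close> is arbitrary; \<open>tmate\<close> is the case where it is
  the unit object.\<close>

lemma eta_surj:
  assumes "a \<in> vob C" "v \<in> obj V" "w \<in> obj V" "b \<in> vob C"
    and "g \<in> arr V" "src V g = v \<odot> w" "trg V g = hm a b"
  defines "f \<equiv> mate V v w (hm a b) g \<Zsemi> inverse_of V (tiso T a v b)"
  shows "f \<in> arr V" "src V f = w" "trg V f = hm (tn a v) b" "cp a (tn a v) b (eta a v) f = g"
proof -
  show f: "f \<in> arr V" "src V f = w" "trg V f = hm (tn a v) b"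
    using assms by simp_all
  have "f \<Zsemi> tiso T a v b = mate V v w (hm a b) g"
    unfolding f_def using assms by simp
  then show "cp a (tn a v) b (eta a v) f = g"
    using assms f by (simp add: mate_evl flip: tiso_eq_eta)
qed

lemma eta_surj_ex:
  assumes "a \<in> vob C" "v \<in> obj V" "w \<in> obj V" "b \<in> vob C"
    and "g \<in> arr V" "src V g = v \<odot> w" "trg V g = hm a b"
  obtains f where "f \<in> arr V" "src V f = w" "trg V f = hm (tn a v) b"
    "cp a (tn a v) b (eta a v) f = g"
  using eta_surj [OF assms] that by blast

lemma tmate_simps [simp]:
  assumes "a \<in> vob C" "v \<in> obj V" "b \<in> vob C" "g \<in> arr V" "src V g = v" "trg V g = hm a b"
  shows "tmate V C T a v b g \<in> arr V" "src V (tmate V C T a v b g) = \<one>"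
    "trg V (tmate V C T a v b g) = hm (tn a v) b"
    and eta_tmate: "cp a (tn a v) b (eta a v) (tmate V C T a v b g) = g"
  using eta_surj [of a v \<one> b g] assms by (simp_all add: tmate_def)

lemma tcomate_eq:
  assumes "a \<in> vob C" "v \<in> obj V" "b \<in> vob C" "f \<in> arr V" "trg V f = hm (tn a v) b"
  shows "tcomate V C T a v b f = cp a (tn a v) b (eta a v) f"
  using tiso_eq_eta [OF assms] by (simp add: tcomate_def)

text \<open>The rule \<open>eta_tmate\<close> with a tail \<open>k\<close>: since
  \<open>cp_assoc\<close> nests composites to the right, \<open>eta\<close> meets the next factor in
  this shape. The later \<open>eta_cp_\<close> rules are of the same kind.\<close>

lemma eta_cp_tmate:
  assumes "a \<in> vob C" "v \<in> obj V" "b \<in> vob C" "g \<in> arr V" "src V g = v" "trg V g = hm a b"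
    "c \<in> vob C" "k \<in> arr V" "trg V k = hm b c"
  shows "cp a (tn a v) c (eta a v) (cp (tn a v) b c (tmate V C T a v b g) k) = cp a b c g k"
  using assms cp_assoc [of a "tn a v" b c "eta a v" "tmate V C T a v b g" k]
  by (simp add: eta_tmate del: cp_assoc)

lemma tmap_simps [simp]:
  assumes "a \<in> vob C" "b \<in> vob C" "f \<in> arr V" "src V f = \<one>" "trg V f = hm a b"
    "g \<in> arr V" "src V g = u" "trg V g = v"
  shows "tmap V C T a b u v f g \<in> arr V" "src V (tmap V C T a b u v f g) = \<one>"
    "trg V (tmap V C T a b u v f g) = hm (tn a u) (tn b v)"
    and eta_tmap: "cp a (tn a u) (tn b v) (eta a u) (tmap V C T a b u v f g)
      = cp a b (tn b v) f (g \<Zsemi> eta b v)"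
    and eta_cp_tmap: "\<lbrakk>c \<in> vob C; k \<in> arr V; trg V k = hm (tn b v) c\<rbrakk> \<Longrightarrow>
      cp a (tn a u) c (eta a u) (cp (tn a u) (tn b v) c (tmap V C T a b u v f g) k)
      = cp a b c f (cp b (tn b v) c (g \<Zsemi> eta b v) k)"
proof -
  have uv: "u \<in> obj V" "v \<in> obj V" using assms by auto
  then show "tmap V C T a b u v f g \<in> arr V" "src V (tmap V C T a b u v f g) = \<one>"
    "trg V (tmap V C T a b u v f g) = hm (tn a u) (tn b v)"
    "cp a (tn a u) (tn b v) (eta a u) (tmap V C T a b u v f g)
      = cp a b (tn b v) f (g \<Zsemi> eta b v)"
    using assms by (simp_all add: tmap_def eta_tmate flip: ucomp_def)
  show "cp a (tn a u) c (eta a u) (cp (tn a u) (tn b v) c (tmap V C T a b u v f g) k)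
      = cp a b c f (cp b (tn b v) c (g \<Zsemi> eta b v) k)"
    if "c \<in> vob C" "k \<in> arr V" "trg V k = hm (tn b v) c" for c k
    using that assms uv by (simp add: tmap_def eta_cp_tmate flip: ucomp_def)
qed

lemma tcounit_simps [simp]:
  assumes "a \<in> vob C" "b \<in> vob C"
  shows "tcounit V C T a b \<in> arr V" "src V (tcounit V C T a b) = \<one>"
    "trg V (tcounit V C T a b) = hm (tn a (hm a b)) b"
    and eta_cp_tcounit: "\<lbrakk>c \<in> vob C; k \<in> arr V; trg V k = hm b c\<rbrakk> \<Longrightarrow>
      cp a (tn a (hm a b)) c (eta a (hm a b)) (cp (tn a (hm a b)) b c (tcounit V C T a b) k)
      = cp a b c (\<iota> (hm a b)) k"
  using assms by (simp_all add: tcounit_def eta_cp_tmate)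

lemma talpha_simps [simp]:
  assumes "a \<in> vob C" "u \<in> obj V" "v \<in> obj V"
  shows "talpha V C T a u v \<in> arr V" "src V (talpha V C T a u v) = \<one>"
    "trg V (talpha V C T a u v) = hm (tn a (u \<odot> v)) (tn (tn a u) v)"
    and eta_cp_talpha: "\<lbrakk>c \<in> vob C; k \<in> arr V; trg V k = hm (tn (tn a u) v) c\<rbrakk> \<Longrightarrow>
      cp a (tn a (u \<odot> v)) c (eta a (u \<odot> v))
        (cp (tn a (u \<odot> v)) (tn (tn a u) v) c (talpha V C T a u v) k)
      = cp a (tn a u) c (eta a u) (cp (tn a u) (tn (tn a u) v) c (eta (tn a u) v) k)"
  using assms by (simp_all add: talpha_def eta_cp_tmate flip: ucomp_def)

text \<open>The inverse \<open>g\<close> comes from two uses of surjectivity: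
  \<open>eta a (u \<odot> v)\<close> is factored through \<open>eta a u\<close> by some
  \<open>h\<close> of grade \<open>v\<close>, and \<open>h\<close> through
  \<open>eta (tn a u) v\<close> by \<open>g\<close> of grade \<one>. Both inverse laws follow from
  \<open>eta_inj\<close>, the second after testing twice.\<close>

lemma talpha_inv:
  assumes "a \<in> vob C" "u \<in> obj V" "v \<in> obj V"
  shows "u_inverse V C (tn a (u \<odot> v)) (tn (tn a u) v) (talpha V C T a u v) (talpha_inv V C T a u v)"
proof -
  let ?p = "tn a (u \<odot> v)" and ?q = "tn (tn a u) v" and ?al = "talpha V C T a u v"
  note [simp] = assms
  obtain h where h: "h \<in> arr V" "src V h = v" "trg V h = hm (tn a u) ?p"
    "cp a (tn a u) ?p (eta a u) h = eta a (u \<odot> v)"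
    by (rule eta_surj_ex [of a u v ?p "eta a (u \<odot> v)"]) simp_all
  obtain g where g: "g \<in> arr V" "src V g = \<one>" "trg V g = hm ?q ?p"
    "cp (tn a u) ?q ?p (eta (tn a u) v) g = h"
    by (rule eta_surj_ex [of "tn a u" v \<one> ?p h]) (use h in simp_all)
  have 1: "cp ?p ?q ?p ?al g = vid C ?p"
    by (rule eta_inj [of a "u \<odot> v"]) (use g h in \<open>simp_all add: eta_cp_talpha\<close>)
  have 2: "cp ?q ?p ?q g ?al = vid C ?q"
  proof -
    let ?k = "cp (tn a u) ?q ?q (eta (tn a u) v) (cp ?q ?p ?q g ?al)"
    have gal: "?k = cp (tn a u) ?p ?q h ?al"
      using g cp_assoc [of "tn a u" ?q ?p ?q "eta (tn a u) v" g ?al] by (simp del: cp_assoc)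
    have "cp a (tn a u) ?q (eta a u) (cp (tn a u) ?p ?q h ?al) = cp a ?p ?q (eta a (u \<odot> v)) ?al"
      using h cp_assoc [of a "tn a u" ?p ?q "eta a u" h ?al] by (simp del: cp_assoc)
    also have "\<dots> = cp a (tn a u) ?q (eta a u) (eta (tn a u) v)"
      using eta_cp_talpha [of a u v ?q "vid C ?q"] by simp
    finally have "cp (tn a u) ?p ?q h ?al = eta (tn a u) v"
      by (rule eta_inj) (use h in simp_all)
    then show ?thesis
      by - (rule eta_inj [of "tn a u" v], use gal g in simp_all)
  qed
  have inv: "u_inverse V C ?p ?q ?al g"
    using 1 2 g by (intro u_inverseI) simp_all
  show ?thesis
    unfolding talpha_inv_def proof (rule theI [where P = "u_inverse V C ?p ?q ?al"])
    show "u_inverse V C ?p ?q ?al g" by (rule inv)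
    show "h = g" if "u_inverse V C ?p ?q ?al h" for h
      using u_inverse_unique [OF that inv] by simp
  qed
qed

lemma talpha_inv_simps [simp]:
  assumes "a \<in> vob C" "u \<in> obj V" "v \<in> obj V"
  shows "talpha_inv V C T a u v \<in> arr V" "src V (talpha_inv V C T a u v) = \<one>"
    "trg V (talpha_inv V C T a u v) = hm (tn (tn a u) v) (tn a (u \<odot> v))"
    and eta_cp_talpha_inv: "\<lbrakk>c \<in> vob C; k \<in> arr V; trg V k = hm (tn a (u \<odot> v)) c\<rbrakk> \<Longrightarrow>
      cp a (tn a u) c (eta a u) (cp (tn a u) (tn (tn a u) v) c (eta (tn a u) v)
        (cp (tn (tn a u) v) (tn a (u \<odot> v)) c (talpha_inv V C T a u v) k))
      = cp a (tn a (u \<odot> v)) c (eta a (u \<odot> v)) k"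
proof -
  let ?p = "tn a (u \<odot> v)" and ?q = "tn (tn a u) v"
  note [simp] = u_inverseD [OF talpha_inv [OF assms]] assms
  show "talpha_inv V C T a u v \<in> arr V" "src V (talpha_inv V C T a u v) = \<one>"
    "trg V (talpha_inv V C T a u v) = hm ?q ?p" by simp_all
  assume k: "c \<in> vob C" "k \<in> arr V" "trg V k = hm ?p c"
  have "cp ?p ?q c (talpha V C T a u v) (cp ?q ?p c (talpha_inv V C T a u v) k) = k"
    using k cp_assoc [of ?p ?q ?p c "talpha V C T a u v" "talpha_inv V C T a u v" k]
    by (simp del: cp_assoc)
  then show "cp a (tn a u) c (eta a u) (cp (tn a u) ?q c (eta (tn a u) v)
        (cp ?q ?p c (talpha_inv V C T a u v) k))
      = cp a ?p c (eta a (u \<odot> v)) k"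
    using eta_cp_talpha [of a u v c "cp ?q ?p c (talpha_inv V C T a u v) k"] k by simp
qed

end

section \<open>Whiskered composites and uncurrying\<close>

context strict_monoidal
begin

lemma cmp_atens_idt:
  "\<lbrakk>f \<in> arr V; g \<in> arr V; trg V f = src V g; u \<in> obj V\<rbrakk>
    \<Longrightarrow> (f \<Zsemi> g) \<otimes> \<iota> u = f \<otimes> \<iota> u \<Zsemi> g \<otimes> \<iota> u"
  by (simp add: tens_cmp)

lemma idt_atens_cmp:
  "\<lbrakk>f \<in> arr V; g \<in> arr V; trg V f = src V g; u \<in> obj V\<rbrakk>
    \<Longrightarrow> \<iota> u \<otimes> (f \<Zsemi> g) = \<iota> u \<otimes> f \<Zsemi> \<iota> u \<otimes> g"
  by (simp add: tens_cmp)

text \<open>Both sides are \<open>f \<otimes> g\<close> followed by \<open>k\<close>.\<close>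

lemma whisker_swap:
  "\<lbrakk>f \<in> arr V; g \<in> arr V; src V f = u; trg V f = u'; src V g = v; trg V g = v'; k \<in> arr V;
     src V k = u' \<odot> v'\<rbrakk>
    \<Longrightarrow> f \<otimes> \<iota> v \<Zsemi> (\<iota> u' \<otimes> g \<Zsemi> k) = \<iota> u \<otimes> g \<Zsemi> (f \<otimes> \<iota> v' \<Zsemi> k)"
  by (auto simp: tens_cmp_chain)

end

context braided_closed_monoidal
begin

text \<open>Inverse to \<open>mate\<close>. Equations between morphisms into an internal hom are
  proved below by comparing their images under this map.\<close>

definition uncurry :: "'a \<Rightarrow> 'a \<Rightarrow> 'b \<Rightarrow> 'b" where
  "uncurry u x h = \<iota> u \<otimes> h \<Zsemi> \<epsilon> u x"

lemma uncurry_simps [simp]: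
  assumes "u \<in> obj V" "x \<in> obj V" "h \<in> arr V" "trg V h = ihom V u x"
  shows "uncurry u x h \<in> arr V" "src V (uncurry u x h) = u \<odot> src V h" "trg V (uncurry u x h) = x"
  using assms by (simp_all add: uncurry_def)

lemma uncurry_mate [simp]:
  assumes "g \<in> arr V" "src V g = u \<odot> w" "trg V g = v" "u \<in> obj V" "w \<in> obj V"
  shows "uncurry u v (mate V u w v g) = g"
  using assms by (simp add: uncurry_def mate_evl)

lemma uncurry_cmp:
  assumes "u \<in> obj V" "x \<in> obj V" "p \<in> arr V" "h \<in> arr V" "trg V p = src V h"
    "trg V h = ihom V u x"
  shows "uncurry u x (p \<Zsemi> h) = \<iota> u \<otimes> p \<Zsemi> uncurry u x h"
  using assms by (simp add: uncurry_def uncurry_pre)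

lemma uncurry_inj:
  assumes "uncurry u x h = uncurry u x k" "u \<in> obj V" "x \<in> obj V" "h \<in> arr V" "k \<in> arr V"
    "trg V h = ihom V u x" "trg V k = ihom V u x" "src V h = src V k"
  shows "h = k"
  by (rule evl_inj [of u x _ "src V h"]) (use assms in \<open>auto simp: uncurry_def hom_iff\<close>)

lemma evl_eq_uncurry: "\<lbrakk>u \<in> obj V; x \<in> obj V\<rbrakk> \<Longrightarrow> \<epsilon> u x = uncurry u x (\<iota> (ihom V u x))"
  by (simp add: uncurry_def)

end

section \<open>Products of graded elements and the completion\<close>

locale enriched_monoidal_category = enriched_category V C + v_monoidal_category V C
  for V :: "('o, 'm, 'z) bcm_data_scheme" (structure)
    and C :: "('c, 'o, 'm, 'y) vmoncat_data_scheme"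
begin

abbreviation pr where "pr \<equiv> vprod C"
abbreviation tp where "tp \<equiv> utens V C"
abbreviation K where "K \<equiv> completion V C"

declare vunit_vob [simp] vprod_vob [simp] vprod_assoc [simp] vunit_vprod [simp] vprod_vunit [simp]

lemma vtens_simps [simp]:
  assumes "a \<in> vob C" "b \<in> vob C" "c \<in> vob C" "d \<in> vob C"
  shows "vtens C a b c d \<in> arr V" "src V (vtens C a b c d) = hm a b \<odot> hm c d"
    "trg V (vtens C a b c d) = hm (pr a c) (pr b d)"
  using vtens_hom [OF assms] by (simp_all add: hom_def)

lemma tp_simps [simp]:
  assumes "a \<in> vob C" "b \<in> vob C" "c \<in> vob C" "d \<in> vob C"
    "f \<in> arr V" "trg V f = hm a b" "g \<in> arr V" "trg V g = hm c d"
  shows "tp a b c d f g \<in> arr V" "src V (tp a b c d f g) = src V f \<odot> src V g"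
    "trg V (tp a b c d f g) = hm (pr a c) (pr b d)"
  using assms by (simp_all add: utens_def)

lemma pre_tp:
  assumes "a \<in> vob C" "b \<in> vob C" "c \<in> vob C" "d \<in> vob C" "f \<in> arr V" "trg V f = hm a b"
    "g \<in> arr V" "trg V g = hm c d" "p \<in> arr V" "trg V p = src V f" "q \<in> arr V" "trg V q = src V g"
  shows "p \<otimes> q \<Zsemi> tp a b c d f g = tp a b c d (p \<Zsemi> f) (q \<Zsemi> g)"
  using assms by (simp add: utens_def tens_cmp_chain)

lemma vtens_eq_tp: "\<lbrakk>a \<in> vob C; b \<in> vob C; c \<in> vob C; d \<in> vob C\<rbrakk>
    \<Longrightarrow> vtens C a b c d = tp a b c d (\<iota> (hm a b)) (\<iota> (hm c d))"
  by (simp add: utens_def)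

lemma tp_assoc [simp]:
  assumes "a \<in> vob C" "b \<in> vob C" "c \<in> vob C" "d \<in> vob C" "a' \<in> vob C" "b' \<in> vob C"
    "f \<in> arr V" "trg V f = hm a b" "g \<in> arr V" "trg V g = hm c d" "h \<in> arr V" "trg V h = hm a' b'"
  shows "tp (pr a c) (pr b d) a' b' (tp a b c d f g) h = tp a b (pr c a') (pr d b') f (tp c d a' b' g h)"
proof -
  have "tp (pr a c) (pr b d) a' b' (tp a b c d f g) h
      = f \<otimes> g \<otimes> h \<Zsemi> (vtens C a b c d \<otimes> \<iota> (hm a' b') \<Zsemi> vtens C (pr a c) (pr b d) a' b')"
    using assms by (simp add: utens_def tens_cmp_chain flip: atens_assoc)
  also have "\<dots> = tp a b (pr c a') (pr d b') f (tp c d a' b' g h)"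
    using assms by (simp add: vtens_assoc utens_def tens_cmp_chain)
  finally show ?thesis .
qed

lemma vunit_tp [simp]:
  assumes "a \<in> vob C" "b \<in> vob C" "f \<in> arr V" "trg V f = hm a b"
  shows "tp (vunit C) (vunit C) a b (vid C (vunit C)) f = f"
proof -
  have "tp (vunit C) (vunit C) a b (vid C (vunit C)) f
      = \<iota> \<one> \<otimes> f \<Zsemi> (vid C (vunit C) \<otimes> \<iota> (hm a b) \<Zsemi> vtens C (vunit C) (vunit C) a b)"
    using assms unfolding utens_def by (subst tens_cmp_chain) auto
  then show ?thesis using assms by (simp add: vunit_vtens)
qed

lemma tp_vunit [simp]:
  assumes "a \<in> vob C" "b \<in> vob C" "f \<in> arr V" "trg V f = hm a b"
  shows "tp a b (vunit C) (vunit C) f (vid C (vunit C)) = f"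
proof -
  have "tp a b (vunit C) (vunit C) f (vid C (vunit C))
      = f \<otimes> \<iota> \<one> \<Zsemi> (\<iota> (hm a b) \<otimes> vid C (vunit C) \<Zsemi> vtens C a b (vunit C) (vunit C))"
    using assms unfolding utens_def by (subst tens_cmp_chain) auto
  then show ?thesis using assms by (simp add: vtens_vunit)
qed

lemma vid_tp_vid [simp]:
  "\<lbrakk>a \<in> vob C; b \<in> vob C\<rbrakk> \<Longrightarrow> tp a a b b (vid C a) (vid C b) = vid C (pr a b)"
  by (simp add: utens_def vtens_vid)

text \<open>\<open>braided_interchange\<close> is the case of identities. For elements of other
  grades, naturality moves the braiding from the hom objects to the sources of \<open>g\<close> and
  \<open>f'\<close>.\<close>

lemma cp_tp:
  assumes "a \<in> vob C" "b \<in> vob C" "c \<in> vob C" "d \<in> vob C" "e \<in> vob C" "x \<in> vob C"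
    "f \<in> arr V" "trg V f = hm a b" "g \<in> arr V" "trg V g = hm d e"
    "f' \<in> arr V" "trg V f' = hm b c" "g' \<in> arr V" "trg V g' = hm e x"
  shows "cp (pr a d) (pr b e) (pr c x) (tp a b d e f g) (tp b c e x f' g')
    = \<iota> (src V f) \<otimes> \<beta> (src V g) (src V f') \<otimes> \<iota> (src V g')
      \<Zsemi> tp a c d x (cp a b c f f') (cp d e x g g')"
proof -
  have br: "g \<otimes> f' \<Zsemi> \<beta> (hm d e) (hm b c) = \<beta> (src V g) (src V f') \<Zsemi> f' \<otimes> g"
    by (rule brd_natural) (use assms in \<open>auto simp: hom_iff\<close>)
  let ?R = "vcomp C a b c \<otimes> vcomp C d e x \<Zsemi> vtens C a c d x"
  have "cp (pr a d) (pr b e) (pr c x) (tp a b d e f g) (tp b c e x f' g')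
      = (f \<otimes> g) \<otimes> (f' \<otimes> g') \<Zsemi> (vtens C a b d e \<otimes> vtens C b c e x
        \<Zsemi> vcomp C (pr a d) (pr b e) (pr c x))"
    using assms by (simp add: ucomp_def utens_def tens_cmp_chain del: atens_assoc)
  also have "\<dots> = f \<otimes> ((g \<otimes> f') \<otimes> g')
      \<Zsemi> (\<iota> (hm a b) \<otimes> (\<beta> (hm d e) (hm b c) \<otimes> \<iota> (hm e x)) \<Zsemi> ?R)"
    using assms by (simp add: braided_interchange)
  also have "\<dots> = f \<otimes> ((g \<otimes> f' \<Zsemi> \<beta> (hm d e) (hm b c)) \<otimes> g') \<Zsemi> ?R"
    using assms by (simp add: tens_cmp_chain tens_cmp del: atens_assoc)
  also have "\<dots> = \<iota> (src V f) \<otimes> (\<beta> (src V g) (src V f') \<otimes> \<iota> (src V g'))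
      \<Zsemi> (f \<otimes> ((f' \<otimes> g) \<otimes> g') \<Zsemi> ?R)"
    unfolding br using assms by (simp add: tens_cmp_chain tens_cmp del: atens_assoc)
  also have "f \<otimes> ((f' \<otimes> g) \<otimes> g') = (f \<otimes> f') \<otimes> (g \<otimes> g')"
    using assms by simp
  also have "(f \<otimes> f') \<otimes> (g \<otimes> g') \<Zsemi> ?R = tp a c d x (cp a b c f f') (cp d e x g g')"
    using assms by (simp add: ucomp_def utens_def tens_cmp_chain del: atens_assoc)
  finally show ?thesis using assms by simp
qed

text \<open>Braiding with the unit object is the identity. This case is frequent because the
  structure morphisms have grade \<one>.\<close>

lemma cp_tp_unt:
  assumes "a \<in> vob C" "b \<in> vob C" "c \<in> vob C" "d \<in> vob C" "e \<in> vob C" "x \<in> vob C"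
    "f \<in> arr V" "trg V f = hm a b" "g \<in> arr V" "trg V g = hm d e"
    "f' \<in> arr V" "trg V f' = hm b c" "g' \<in> arr V" "trg V g' = hm e x"
    and "src V g = \<one> \<or> src V f' = \<one>"
  shows "cp (pr a d) (pr b e) (pr c x) (tp a b d e f g) (tp b c e x f' g')
    = tp a c d x (cp a b c f f') (cp d e x g g')"
  using assms(15) by (subst cp_tp) (use assms(1-14) in auto)

lemma u_iso_tp:
  assumes "u_iso V C a b f" "u_iso V C c d g" "a \<in> vob C" "b \<in> vob C" "c \<in> vob C" "d \<in> vob C"
  shows "u_iso V C (pr a c) (pr b d) (tp a b c d f g)"
proof -
  obtain f' where f': "u_inverse V C a b f f'" using assms by (auto simp: u_iso_def)
  obtain g' where g': "u_inverse V C c d g g'" using assms by (auto simp: u_iso_def)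
  note [simp] = u_inverseD [OF f' assms(3,4)] u_inverseD [OF g' assms(5,6)]
  have "u_inverse V C (pr a c) (pr b d) (tp a b c d f g) (tp b a d c f' g')"
    using assms(3-) by (intro u_inverseI) (simp_all add: cp_tp_unt)
  then show ?thesis by (auto simp: u_iso_def)
qed


section \<open>The completion as an enriched category\<close>

lemma completion_simps [simp]:
  "vob K = vob C \<times> obj V" "vhom K (a, u) (b, v) = ihom V u (hm a b \<odot> v)"
  "vunit K = (vunit C, \<one>)" "vprod K (a, u) (b, v) = (pr a b, u \<odot> v)"
  by (simp_all add: completion_def)

lemma completion_vid_simps [simp]:
  assumes "a \<in> vob C" "u \<in> obj V"
  shows "vid K (a, u) \<in> arr V" "src V (vid K (a, u)) = \<one>"
    "trg V (vid K (a, u)) = ihom V u (hm a a \<odot> u)"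
    and uncurry_vid: "uncurry u (hm a a \<odot> u) (vid K (a, u)) = vid C a \<otimes> \<iota> u"
  using assms by (simp_all add: completion_def)

lemma completion_vcomp_simps:
  assumes "a \<in> vob C" "b \<in> vob C" "c \<in> vob C" "u \<in> obj V" "v \<in> obj V" "w \<in> obj V"
  shows "vcomp K (a, u) (b, v) (c, w) \<in> arr V"
    "src V (vcomp K (a, u) (b, v) (c, w)) = ihom V u (hm a b \<odot> v) \<odot> ihom V v (hm b c \<odot> w)"
    "trg V (vcomp K (a, u) (b, v) (c, w)) = ihom V u (hm a c \<odot> w)"
    "uncurry u (hm a c \<odot> w) (vcomp K (a, u) (b, v) (c, w))
      = \<epsilon> u (hm a b \<odot> v) \<otimes> \<iota> (ihom V v (hm b c \<odot> w))
        \<Zsemi> (\<iota> (hm a b) \<otimes> \<epsilon> v (hm b c \<odot> w) \<Zsemi> vcomp C a b c \<otimes> \<iota> w)"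
  using assms by (simp_all add: completion_def Let_def)

text \<open>Uncurried elements of the completion compose like Kleisli morphisms: \<open>p\<close>
  takes values in \<open>hm a b \<odot> v\<close> and \<open>q\<close> starts at \<open>v\<close>.
  Once \<open>whisker_swap\<close> has moved \<open>r\<close> past the composition of the first two
  hom objects, associativity of \<open>C\<close>, whiskered with \<open>x\<close>, remains.\<close>

lemma kleisli_assoc:
  assumes "a \<in> vob C" "b \<in> vob C" "c \<in> vob C" "d \<in> vob C"
    "p \<in> arr V" "trg V p = hm a b \<odot> v" "q \<in> arr V" "src V q = v \<odot> s" "trg V q = hm b c \<odot> w"
    "r \<in> arr V" "src V r = w \<odot> t" "trg V r = hm c d \<odot> x"
    "v \<in> obj V" "s \<in> obj V" "w \<in> obj V" "t \<in> obj V" "x \<in> obj V"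
  shows "(p \<otimes> \<iota> s \<Zsemi> (\<iota> (hm a b) \<otimes> q \<Zsemi> vcomp C a b c \<otimes> \<iota> w)) \<otimes> \<iota> t
      \<Zsemi> (\<iota> (hm a c) \<otimes> r \<Zsemi> vcomp C a c d \<otimes> \<iota> x)
    = p \<otimes> \<iota> (s \<odot> t)
      \<Zsemi> (\<iota> (hm a b) \<otimes> (q \<otimes> \<iota> t \<Zsemi> (\<iota> (hm b c) \<otimes> r \<Zsemi> vcomp C b c d \<otimes> \<iota> x)) \<Zsemi> vcomp C a b d \<otimes> \<iota> x)"
proof -
  have as: "vcomp C a b c \<otimes> \<iota> (hm c d \<odot> x) \<Zsemi> vcomp C a c d \<otimes> \<iota> x
      = \<iota> (hm a b) \<otimes> vcomp C b c d \<otimes> \<iota> x \<Zsemi> vcomp C a b d \<otimes> \<iota> x"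
    using assms arg_cong [OF vcomp_assoc [of a b c d], of "\<lambda>z. z \<otimes> \<iota> x"]
    by (simp add: cmp_atens_idt)
  have "(p \<otimes> \<iota> s \<Zsemi> (\<iota> (hm a b) \<otimes> q \<Zsemi> vcomp C a b c \<otimes> \<iota> w)) \<otimes> \<iota> t
      \<Zsemi> (\<iota> (hm a c) \<otimes> r \<Zsemi> vcomp C a c d \<otimes> \<iota> x)
    = p \<otimes> \<iota> (s \<odot> t) \<Zsemi> (\<iota> (hm a b) \<otimes> q \<otimes> \<iota> t \<Zsemi> (vcomp C a b c \<otimes> \<iota> (w \<odot> t)
      \<Zsemi> (\<iota> (hm a c) \<otimes> r \<Zsemi> vcomp C a c d \<otimes> \<iota> x)))"
    using assms by (simp add: cmp_atens_idt)
  also have "vcomp C a b c \<otimes> \<iota> (w \<odot> t) \<Zsemi> (\<iota> (hm a c) \<otimes> r \<Zsemi> vcomp C a c d \<otimes> \<iota> x)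
     = \<iota> (hm a b \<odot> hm b c) \<otimes> r \<Zsemi> (vcomp C a b c \<otimes> \<iota> (hm c d \<odot> x) \<Zsemi> vcomp C a c d \<otimes> \<iota> x)"
    using assms by (intro whisker_swap) simp_all
  finally show ?thesis
    unfolding as using assms by (simp add: idt_atens_cmp)
qed

lemma completion_enriched: "enriched_category V K"
proof
  show "vhom K x y \<in> obj V" if "x \<in> vob K" "y \<in> vob K" for x y
    using that by (cases x; cases y) auto
  show "vid K x \<in> hom V \<one> (vhom K x x)" if "x \<in> vob K" for x
    using that by (cases x) (auto simp: hom_iff)
  show "vcomp K x y z \<in> hom V (vhom K x y \<odot> vhom K y z) (vhom K x z)"
    if "x \<in> vob K" "y \<in> vob K" "z \<in> vob K" for x y z
    using that by (cases x; cases y; cases z) (auto simp: hom_iff completion_vcomp_simps)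
  show "vcomp K x y z \<otimes> \<iota> (vhom K z t) \<Zsemi> vcomp K x z t
        = \<iota> (vhom K x y) \<otimes> vcomp K y z t \<Zsemi> vcomp K x y t"
    if "x \<in> vob K" "y \<in> vob K" "z \<in> vob K" "t \<in> vob K" for x y z t
  proof -
    obtain a u b v c w d r where [simp]: "x = (a, u)" "y = (b, v)" "z = (c, w)" "t = (d, r)"
      by (cases x; cases y; cases z; cases t)
    have [simp]: "a \<in> vob C" "b \<in> vob C" "c \<in> vob C" "d \<in> vob C"
      "u \<in> obj V" "v \<in> obj V" "w \<in> obj V" "r \<in> obj V" using that by auto
    let ?X = "ihom V u (hm a b \<odot> v)" and ?Y = "ihom V v (hm b c \<odot> w)" and ?Z = "ihom V w (hm c d \<odot> r)"
    \<comment> \<open>Uncurrying turns the two sides of associativity into the two sides of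
      \<open>kleisli_assoc\<close>, with the three evaluations as \<open>p\<close>, \<open>q\<close>
      and \<open>r\<close>.\<close>
    have "uncurry u (hm a d \<odot> r) (vcomp K x y z \<otimes> \<iota> ?Z \<Zsemi> vcomp K x z t)
        = uncurry u (hm a c \<odot> w) (vcomp K x y z) \<otimes> \<iota> ?Z
          \<Zsemi> (\<iota> (hm a c) \<otimes> \<epsilon> w (hm c d \<odot> r) \<Zsemi> vcomp C a c d \<otimes> \<iota> r)"
    proof -
      have "uncurry u (hm a d \<odot> r) (vcomp K x y z \<otimes> \<iota> ?Z \<Zsemi> vcomp K x z t)
        = (\<iota> u \<otimes> vcomp K x y z) \<otimes> \<iota> ?Z \<Zsemi> (\<epsilon> u (hm a c \<odot> w) \<otimes> \<iota> ?Z
          \<Zsemi> (\<iota> (hm a c) \<otimes> \<epsilon> w (hm c d \<odot> r) \<Zsemi> vcomp C a c d \<otimes> \<iota> r))"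
        by (simp add: uncurry_cmp completion_vcomp_simps)
      then show ?thesis
        by (simp add: uncurry_def tens_cmp_chain completion_vcomp_simps(1-3) del: atens_assoc)
    qed
    moreover have "uncurry u (hm a d \<odot> r) (\<iota> ?X \<otimes> vcomp K y z t \<Zsemi> vcomp K x y t)
        = \<epsilon> u (hm a b \<odot> v) \<otimes> \<iota> (?Y \<odot> ?Z)
          \<Zsemi> (\<iota> (hm a b) \<otimes> uncurry v (hm b d \<odot> r) (vcomp K y z t) \<Zsemi> vcomp C a b d \<otimes> \<iota> r)"
    proof -
      have "uncurry u (hm a d \<odot> r) (\<iota> ?X \<otimes> vcomp K y z t \<Zsemi> vcomp K x y t)
        = \<iota> (u \<odot> ?X) \<otimes> vcomp K y z t \<Zsemi> (\<epsilon> u (hm a b \<odot> v) \<otimes> \<iota> (ihom V v (hm b d \<odot> r))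
          \<Zsemi> (\<iota> (hm a b) \<otimes> \<epsilon> v (hm b d \<odot> r) \<Zsemi> vcomp C a b d \<otimes> \<iota> r))"
        by (simp add: uncurry_cmp completion_vcomp_simps)
      then show ?thesis
        by (simp add: uncurry_def idt_atens_cmp completion_vcomp_simps(1-3))
          (simp add: tens_cmp_chain completion_vcomp_simps(1-3))
    qed
    ultimately have "uncurry u (hm a d \<odot> r) (vcomp K x y z \<otimes> \<iota> ?Z \<Zsemi> vcomp K x z t)
      = uncurry u (hm a d \<odot> r) (\<iota> ?X \<otimes> vcomp K y z t \<Zsemi> vcomp K x y t)"
      by (simp add: kleisli_assoc completion_vcomp_simps(4))
    then show ?thesis
      by - (rule uncurry_inj [of u "hm a d \<odot> r"], simp_all add: completion_vcomp_simps(1-3))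
  qed
  show "vid K x \<otimes> \<iota> (vhom K x y) \<Zsemi> vcomp K x x y = \<iota> (vhom K x y)"
    if "x \<in> vob K" "y \<in> vob K" for x y
  proof -
    obtain a u b v where [simp]: "x = (a, u)" "y = (b, v)" by (cases x; cases y)
    have [simp]: "a \<in> vob C" "b \<in> vob C" "u \<in> obj V" "v \<in> obj V" using that by auto
    let ?X = "ihom V u (hm a b \<odot> v)"
    have "uncurry u (hm a b \<odot> v) (vid K x \<otimes> \<iota> ?X \<Zsemi> vcomp K x x y)
      = uncurry u (hm a a \<odot> u) (vid K x) \<otimes> \<iota> ?X \<Zsemi> (\<iota> (hm a a) \<otimes> \<epsilon> u (hm a b \<odot> v) \<Zsemi> vcomp C a a b \<otimes> \<iota> v)"
    proof -
      have "uncurry u (hm a b \<odot> v) (vid K x \<otimes> \<iota> ?X \<Zsemi> vcomp K x x y)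
        = (\<iota> u \<otimes> vid K x) \<otimes> \<iota> ?X \<Zsemi> (\<epsilon> u (hm a a \<odot> u) \<otimes> \<iota> ?X
          \<Zsemi> (\<iota> (hm a a) \<otimes> \<epsilon> u (hm a b \<odot> v) \<Zsemi> vcomp C a a b \<otimes> \<iota> v))"
        by (simp add: uncurry_cmp completion_vcomp_simps)
      then show ?thesis
        by (simp add: uncurry_def tens_cmp_chain del: atens_assoc)
    qed
    \<comment> \<open>The identity element \<open>vid C a\<close> slides behind the evaluation, so
      that the unit law of \<open>C\<close> applies.\<close>
    also have "\<dots> = \<epsilon> u (hm a b \<odot> v) \<Zsemi> (vid C a \<otimes> \<iota> (hm a b) \<Zsemi> vcomp C a a b) \<otimes> \<iota> v"
      using atens_factor(2) [of "vid C a" "\<epsilon> u (hm a b \<odot> v)"]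
      by (simp add: uncurry_vid cmp_atens_idt) (simp add: tens_cmp_chain)
    finally show ?thesis
      by - (rule uncurry_inj [of u "hm a b \<odot> v"],
        simp_all add: completion_vcomp_simps vid_vcomp flip: evl_eq_uncurry)
  qed
  show "\<iota> (vhom K x y) \<otimes> vid K y \<Zsemi> vcomp K x y y = \<iota> (vhom K x y)"
    if "x \<in> vob K" "y \<in> vob K" for x y
  proof -
    obtain a u b v where [simp]: "x = (a, u)" "y = (b, v)" by (cases x; cases y)
    have [simp]: "a \<in> vob C" "b \<in> vob C" "u \<in> obj V" "v \<in> obj V" using that by auto
    let ?X = "ihom V u (hm a b \<odot> v)"
    have "uncurry u (hm a b \<odot> v) (\<iota> ?X \<otimes> vid K y \<Zsemi> vcomp K x y y)
      = \<epsilon> u (hm a b \<odot> v) \<Zsemi> (\<iota> (hm a b) \<otimes> uncurry v (hm b b \<odot> v) (vid K y) \<Zsemi> vcomp C a b b \<otimes> \<iota> v)"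
    proof -
      have "uncurry u (hm a b \<odot> v) (\<iota> ?X \<otimes> vid K y \<Zsemi> vcomp K x y y)
        = \<iota> (u \<odot> ?X) \<otimes> vid K y \<Zsemi> (\<epsilon> u (hm a b \<odot> v) \<otimes> \<iota> (ihom V v (hm b b \<odot> v))
          \<Zsemi> (\<iota> (hm a b) \<otimes> \<epsilon> v (hm b b \<odot> v) \<Zsemi> vcomp C a b b \<otimes> \<iota> v))"
        by (simp add: uncurry_cmp completion_vcomp_simps)
      then show ?thesis
        using atens_factor(1) [of "\<epsilon> u (hm a b \<odot> v)" "vid K y"]
        by (simp add: uncurry_def idt_atens_cmp) (simp add: tens_cmp_chain)
    qed
    also have "\<dots> = \<epsilon> u (hm a b \<odot> v) \<Zsemi> (\<iota> (hm a b) \<otimes> vid C b \<Zsemi> vcomp C a b b) \<otimes> \<iota> v"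
      by (simp add: uncurry_vid cmp_atens_idt)
    finally show ?thesis
      by - (rule uncurry_inj [of u "hm a b \<odot> v"],
        simp_all add: completion_vcomp_simps vcomp_vid flip: evl_eq_uncurry)
  qed
qed

sublocale K: enriched_category V K by (rule completion_enriched)

text \<open>The Kleisli form of composition for elements of arbitrary grades; most computations in
  the completion pass through it.\<close>

lemma uncurry_cp:
  assumes "a \<in> vob C" "b \<in> vob C" "c \<in> vob C" "u \<in> obj V" "v \<in> obj V" "w \<in> obj V"
    "f \<in> arr V" "trg V f = ihom V u (hm a b \<odot> v)" "g \<in> arr V" "trg V g = ihom V v (hm b c \<odot> w)"
  shows "uncurry u (hm a c \<odot> w) (K.cp (a, u) (b, v) (c, w) f g)
    = uncurry u (hm a b \<odot> v) f \<otimes> \<iota> (src V g)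
      \<Zsemi> (\<iota> (hm a b) \<otimes> uncurry v (hm b c \<odot> w) g \<Zsemi> vcomp C a b c \<otimes> \<iota> w)"
proof -
  have "uncurry u (hm a c \<odot> w) (K.cp (a, u) (b, v) (c, w) f g)
      = (\<iota> u \<otimes> f) \<otimes> g \<Zsemi> (\<epsilon> u (hm a b \<odot> v) \<otimes> \<iota> (ihom V v (hm b c \<odot> w))
        \<Zsemi> (\<iota> (hm a b) \<otimes> \<epsilon> v (hm b c \<odot> w) \<Zsemi> vcomp C a b c \<otimes> \<iota> w))"
    using assms by (simp add: ucomp_def uncurry_cmp completion_vcomp_simps)
  also have "\<dots> = uncurry u (hm a b \<odot> v) f \<otimes> g
      \<Zsemi> (\<iota> (hm a b) \<otimes> \<epsilon> v (hm b c \<odot> w) \<Zsemi> vcomp C a b c \<otimes> \<iota> w)"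
    using assms by (simp add: uncurry_def tens_cmp_chain del: atens_assoc)
  also have "\<dots> = uncurry u (hm a b \<odot> v) f \<otimes> \<iota> (src V g)
      \<Zsemi> (\<iota> (hm a b) \<otimes> uncurry v (hm b c \<odot> w) g \<Zsemi> vcomp C a b c \<otimes> \<iota> w)"
    using assms by (simp add: uncurry_def idt_atens_cmp) (simp add: tens_cmp_chain)
  finally show ?thesis .
qed

text \<open>When the target is an included object, the last whiskering disappears and composition in
  \<open>C\<close> remains.\<close>

lemma uncurry_cp_unt:
  assumes "a \<in> vob C" "b \<in> vob C" "c \<in> vob C" "u \<in> obj V" "v \<in> obj V"
    "f \<in> arr V" "trg V f = ihom V u (hm a b \<odot> v)" "g \<in> arr V" "trg V g = ihom V v (hm b c)"
  shows "uncurry u (hm a c) (K.cp (a, u) (b, v) (c, \<one>) f g)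
    = uncurry u (hm a b \<odot> v) f \<otimes> \<iota> (src V g) \<Zsemi> cp a b c (\<iota> (hm a b)) (uncurry v (hm b c) g)"
  using uncurry_cp [of a b c u v \<one> f g] assms by (simp add: ucomp_def)

end

section \<open>Products in the completion and the inclusion functor\<close>

context enriched_monoidal_category
begin

abbreviation ktp where "ktp \<equiv> utens V K"
abbreviation J where "J \<equiv> fhom (incl_vfun V C)"

lemma completion_vtens_simps:
  assumes "a \<in> vob C" "b \<in> vob C" "c \<in> vob C" "d \<in> vob C"
    and "u \<in> obj V" "v \<in> obj V" "w \<in> obj V" "x \<in> obj V"
  shows "vtens K (a, u) (b, v) (c, w) (d, x) \<in> arr V"
    "src V (vtens K (a, u) (b, v) (c, w) (d, x)) = ihom V u (hm a b \<odot> v) \<odot> ihom V w (hm c d \<odot> x)"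
    "trg V (vtens K (a, u) (b, v) (c, w) (d, x))
      = ihom V (u \<odot> w) (hm (pr a c) (pr b d) \<odot> (v \<odot> x))"
    "uncurry (u \<odot> w) (hm (pr a c) (pr b d) \<odot> (v \<odot> x)) (vtens K (a, u) (b, v) (c, w) (d, x))
      = \<iota> u \<otimes> (\<beta> w (ihom V u (hm a b \<odot> v)) \<otimes> \<iota> (ihom V w (hm c d \<odot> x)))
        \<Zsemi> (\<epsilon> u (hm a b \<odot> v) \<otimes> \<epsilon> w (hm c d \<odot> x)
        \<Zsemi> (\<iota> (hm a b) \<otimes> (inverse_of V (\<beta> (hm c d) v) \<otimes> \<iota> x)
        \<Zsemi> vtens C a b c d \<otimes> \<iota> (v \<odot> x)))"
  using assms by (simp_all add: completion_def Let_def)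

text \<open>Naturality replaces the braiding with an internal hom by the braiding with the grade of
  \<open>f\<close>, which vanishes in grade \<one>.\<close>

lemma uncurry_tp:
  assumes "a \<in> vob C" "b \<in> vob C" "c \<in> vob C" "d \<in> vob C"
    and "u \<in> obj V" "v \<in> obj V" "w \<in> obj V" "x \<in> obj V"
    and "f \<in> arr V" "trg V f = ihom V u (hm a b \<odot> v)" "g \<in> arr V" "trg V g = ihom V w (hm c d \<odot> x)"
  shows "ktp (a, u) (b, v) (c, w) (d, x) f g \<in> arr V"
    "src V (ktp (a, u) (b, v) (c, w) (d, x) f g) = src V f \<odot> src V g"
    "trg V (ktp (a, u) (b, v) (c, w) (d, x) f g) = ihom V (u \<odot> w) (hm (pr a c) (pr b d) \<odot> (v \<odot> x))"
    "uncurry (u \<odot> w) (hm (pr a c) (pr b d) \<odot> (v \<odot> x)) (ktp (a, u) (b, v) (c, w) (d, x) f g)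
      = \<iota> u \<otimes> (\<beta> w (src V f) \<otimes> \<iota> (src V g))
        \<Zsemi> (uncurry u (hm a b \<odot> v) f \<otimes> uncurry w (hm c d \<odot> x) g
        \<Zsemi> (\<iota> (hm a b) \<otimes> (inverse_of V (\<beta> (hm c d) v) \<otimes> \<iota> x)
        \<Zsemi> vtens C a b c d \<otimes> \<iota> (v \<odot> x)))"
proof -
  let ?X = "ihom V u (hm a b \<odot> v)" and ?Y = "ihom V w (hm c d \<odot> x)"
  let ?R = "\<iota> (hm a b) \<otimes> (inverse_of V (\<beta> (hm c d) v) \<otimes> \<iota> x) \<Zsemi> vtens C a b c d \<otimes> \<iota> (v \<odot> x)"
  show "ktp (a, u) (b, v) (c, w) (d, x) f g \<in> arr V"
    "src V (ktp (a, u) (b, v) (c, w) (d, x) f g) = src V f \<odot> src V g"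
    "trg V (ktp (a, u) (b, v) (c, w) (d, x) f g) = ihom V (u \<odot> w) (hm (pr a c) (pr b d) \<odot> (v \<odot> x))"
    using assms by (simp_all add: utens_def completion_vtens_simps)
  have br: "\<iota> w \<otimes> f \<Zsemi> \<beta> w ?X = \<beta> w (src V f) \<Zsemi> f \<otimes> \<iota> w"
    by (rule brd_natural) (use assms in \<open>auto simp: hom_iff\<close>)
  have "uncurry (u \<odot> w) (hm (pr a c) (pr b d) \<odot> (v \<odot> x)) (ktp (a, u) (b, v) (c, w) (d, x) f g)
      = \<iota> u \<otimes> ((\<iota> w \<otimes> f) \<otimes> g) \<Zsemi> (\<iota> u \<otimes> (\<beta> w ?X \<otimes> \<iota> ?Y)
        \<Zsemi> (\<epsilon> u (hm a b \<odot> v) \<otimes> \<epsilon> w (hm c d \<odot> x) \<Zsemi> ?R))"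
    using assms by (simp add: utens_def uncurry_cmp completion_vtens_simps)
  also have "\<dots> = \<iota> u \<otimes> ((\<iota> w \<otimes> f \<Zsemi> \<beta> w ?X) \<otimes> g)
        \<Zsemi> (\<epsilon> u (hm a b \<odot> v) \<otimes> \<epsilon> w (hm c d \<odot> x) \<Zsemi> ?R)"
    using assms by (simp add: tens_cmp_chain tens_cmp del: atens_assoc)
  also have "\<dots> = \<iota> u \<otimes> (\<beta> w (src V f) \<otimes> \<iota> (src V g))
      \<Zsemi> ((\<iota> u \<otimes> f) \<otimes> (\<iota> w \<otimes> g) \<Zsemi> (\<epsilon> u (hm a b \<odot> v) \<otimes> \<epsilon> w (hm c d \<odot> x) \<Zsemi> ?R))"
  proof -
    have "(\<iota> u \<otimes> f) \<otimes> (\<iota> w \<otimes> g) = \<iota> u \<otimes> ((f \<otimes> \<iota> w) \<otimes> g)" using assms by simp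
    then show ?thesis
      unfolding br using assms by (simp add: tens_cmp_chain tens_cmp del: atens_assoc)
  qed
  also have "(\<iota> u \<otimes> f) \<otimes> (\<iota> w \<otimes> g) \<Zsemi> (\<epsilon> u (hm a b \<odot> v) \<otimes> \<epsilon> w (hm c d \<odot> x) \<Zsemi> ?R)
      = uncurry u (hm a b \<odot> v) f \<otimes> uncurry w (hm c d \<odot> x) g \<Zsemi> ?R"
    using assms by (simp add: uncurry_def tens_cmp_chain del: atens_assoc)
  finally show "uncurry (u \<odot> w) (hm (pr a c) (pr b d) \<odot> (v \<odot> x)) (ktp (a, u) (b, v) (c, w) (d, x) f g)
      = \<iota> u \<otimes> (\<beta> w (src V f) \<otimes> \<iota> (src V g))
        \<Zsemi> (uncurry u (hm a b \<odot> v) f \<otimes> uncurry w (hm c d \<odot> x) g \<Zsemi> ?R)" .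
qed

text \<open>The braided interchange law cancels the inverse braiding in the product of the completion.\<close>

lemma uncurry_tp_cp:
  assumes "a \<in> vob C" "b \<in> vob C" "c \<in> vob C" "d \<in> vob C" "b' \<in> vob C" "d' \<in> vob C"
    and "u \<in> obj V" "v \<in> obj V" "w \<in> obj V" "x \<in> obj V"
    and "f \<in> arr V" "trg V f = ihom V u (hm a b \<odot> v)" "g \<in> arr V" "trg V g = ihom V w (hm c d \<odot> x)"
    and "s \<in> arr V" "src V s = v" "trg V s = hm b b'" "t \<in> arr V" "src V t = x" "trg V t = hm d d'"
  shows "uncurry (u \<odot> w) (hm (pr a c) (pr b d) \<odot> (v \<odot> x)) (ktp (a, u) (b, v) (c, w) (d, x) f g)
      \<Zsemi> cp (pr a c) (pr b d) (pr b' d') (\<iota> (hm (pr a c) (pr b d))) (tp b b' d d' s t)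
    = \<iota> u \<otimes> (\<beta> w (src V f) \<otimes> \<iota> (src V g))
      \<Zsemi> tp a b' c d' (uncurry u (hm a b \<odot> v) f \<Zsemi> cp a b b' (\<iota> (hm a b)) s)
          (uncurry w (hm c d \<odot> x) g \<Zsemi> cp c d d' (\<iota> (hm c d)) t)"
proof -
  let ?H = "hm a b" and ?L = "hm c d"
  let ?bi = "\<iota> ?H \<otimes> (inverse_of V (\<beta> ?L v) \<otimes> \<iota> x)"
  have "?bi \<Zsemi> (vtens C a b c d \<otimes> \<iota> (v \<odot> x)
      \<Zsemi> cp (pr a c) (pr b d) (pr b' d') (\<iota> (hm (pr a c) (pr b d))) (tp b b' d d' s t))
    = ?bi \<Zsemi> cp (pr a c) (pr b d) (pr b' d') (tp a b c d (\<iota> ?H) (\<iota> ?L)) (tp b b' d d' s t)"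
    using assms by (simp add: pre_cp flip: vtens_eq_tp)
  also have "\<dots> = ?bi \<Zsemi> (\<iota> ?H \<otimes> (\<beta> ?L v \<otimes> \<iota> x)
      \<Zsemi> tp a b' c d' (cp a b b' (\<iota> ?H) s) (cp c d d' (\<iota> ?L) t))"
    using assms by (simp add: cp_tp)
  also have "\<dots> = tp a b' c d' (cp a b b' (\<iota> ?H) s) (cp c d d' (\<iota> ?L) t)"
    using assms by (simp add: tens_cmp_chain tens_cmp inverse_brd)
  finally show ?thesis
    using assms by (simp add: uncurry_tp pre_tp)
qed

lemma incl_simps [simp]:
  "fob (incl_vfun V C) a = (a, \<one>)"
  "\<lbrakk>a \<in> vob C; b \<in> vob C\<rbrakk> \<Longrightarrow> J a b \<in> arr V"
  "\<lbrakk>a \<in> vob C; b \<in> vob C\<rbrakk> \<Longrightarrow> src V (J a b) = hm a b"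
  "\<lbrakk>a \<in> vob C; b \<in> vob C\<rbrakk> \<Longrightarrow> trg V (J a b) = ihom V \<one> (hm a b)"
  "\<lbrakk>a \<in> vob C; b \<in> vob C\<rbrakk> \<Longrightarrow> uncurry \<one> (hm a b) (J a b) = \<iota> (hm a b)"
  by (simp_all add: incl_vfun_def)

lemma uncurry_incl [simp]:
  "\<lbrakk>a \<in> vob C; b \<in> vob C; f \<in> arr V; trg V f = hm a b\<rbrakk> \<Longrightarrow> uncurry \<one> (hm a b) (f \<Zsemi> J a b) = f"
  by (simp add: uncurry_cmp)

text \<open>Uncurrying over \<one> preserves sources, so equality of the sources is itself a
  consequence of the assumed equation.\<close>

lemma uncurry_unt_inj:
  assumes "uncurry \<one> x h = uncurry \<one> x k" "x \<in> obj V" "h \<in> arr V" "k \<in> arr V"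
    "trg V h = ihom V \<one> x" "trg V k = ihom V \<one> x"
  shows "h = k"
proof (rule uncurry_inj [OF assms(1) _ assms(2-6)])
  show "src V h = src V k" using arg_cong [OF assms(1), of "src V"] assms(2-) by simp
qed simp

lemma incl_v_functor: "v_functor V C K (incl_vfun V C)"
proof
  show "fob (incl_vfun V C) a \<in> vob K" if "a \<in> vob C" for a using that by simp
  show "J a b \<in> hom V (hm a b) (vhom K (fob (incl_vfun V C) a) (fob (incl_vfun V C) b))"
    if "a \<in> vob C" "b \<in> vob C" for a b using that by (simp add: hom_iff)
  show "vid C a \<Zsemi> J a a = vid K (fob (incl_vfun V C) a)" if "a \<in> vob C" for a
    by (rule uncurry_unt_inj [of "hm a a"]) (use that uncurry_vid [of a \<one>] in simp_all)
  show "vcomp C a b c \<Zsemi> J a c = J a b \<otimes> J b c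
      \<Zsemi> vcomp K (fob (incl_vfun V C) a) (fob (incl_vfun V C) b) (fob (incl_vfun V C) c)"
    if "a \<in> vob C" "b \<in> vob C" "c \<in> vob C" for a b c
    using that uncurry_cp_unt [of a b c \<one> \<one> "J a b" "J b c"]
    by - (rule uncurry_unt_inj [of "hm a c"],
      simp_all add: completion_vcomp_simps ucomp_def)
qed

text \<open>With all four objects of \<open>V\<close> equal to \<one>, both braidings in the product
  of the completion are identities.\<close>

lemma incl_vtens:
  assumes "a \<in> vob C" "b \<in> vob C" "c \<in> vob C" "d \<in> vob C"
  shows "vtens C a b c d \<Zsemi> J (pr a c) (pr b d) = ktp (a, \<one>) (b, \<one>) (c, \<one>) (d, \<one>) (J a b) (J c d)"
  by (rule uncurry_unt_inj [of "hm (pr a c) (pr b d)"])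
    (use assms uncurry_tp [of a b c d \<one> \<one> \<one> \<one> "J a b" "J c d"] in simp_all)

lemma incl_utens:
  assumes "a \<in> vob C" "b \<in> vob C" "c \<in> vob C" "d \<in> vob C"
    "f \<in> arr V" "trg V f = hm a b" "g \<in> arr V" "trg V g = hm c d"
  shows "ktp (a, \<one>) (b, \<one>) (c, \<one>) (d, \<one>) (f \<Zsemi> J a b) (g \<Zsemi> J c d)
    = tp a b c d f g \<Zsemi> J (pr a c) (pr b d)"
proof -
  have "tp a b c d f g \<Zsemi> J (pr a c) (pr b d) = f \<otimes> g \<Zsemi> ktp (a, \<one>) (b, \<one>) (c, \<one>) (d, \<one>) (J a b) (J c d)"
    using assms incl_vtens [of a b c d] by (simp add: utens_def)
  also have "\<dots> = ktp (a, \<one>) (b, \<one>) (c, \<one>) (d, \<one>) (f \<Zsemi> J a b) (g \<Zsemi> J c d)"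
    using assms completion_vtens_simps(1-3) [of a b c d \<one> \<one> \<one> \<one>]
    by (simp add: utens_def tens_cmp_chain)
  finally show ?thesis by simp
qed

lemma incl_vid: "a \<in> vob C \<Longrightarrow> vid C a \<Zsemi> J a a = vid K (a, \<one>)"
  using v_functor.fhom_vid [OF incl_v_functor] by simp

lemma incl_cp:
  assumes "a \<in> vob C" "b \<in> vob C" "c \<in> vob C" "f \<in> arr V" "trg V f = hm a b" "g \<in> arr V" "trg V g = hm b c"
  shows "K.cp (a, \<one>) (b, \<one>) (c, \<one>) (f \<Zsemi> J a b) (g \<Zsemi> J b c) = cp a b c f g \<Zsemi> J a c"
  using v_functor_ucomp [OF incl_v_functor enriched_category_axioms completion_enriched assms] by simp

lemma incl_nu_eq: "incl_nu V C a b = vid K (pr a b, \<one>)"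
  by (simp add: incl_nu_def completion_def)

lemma incl_v_monoidal_functor: "v_monoidal_functor V C K (incl_vfun V C) (incl_nu V C)"
proof (rule v_monoidal_functor.intro [OF incl_v_functor], unfold_locales)
  \<comment> \<open>Since \<open>J\<close> preserves identities and products, identities at included
    objects multiply to identities; the associativity condition on \<open>incl_nu\<close> reduces to
    this.\<close>
  have vt: "ktp (a, \<one>) (a, \<one>) (b, \<one>) (b, \<one>) (vid K (a, \<one>)) (vid K (b, \<one>)) = vid K (pr a b, \<one>)"
    if "a \<in> vob C" "b \<in> vob C" for a b
    using incl_utens [of a a b b "vid C a" "vid C b"] that by (simp add: incl_vid)
  show "fob (incl_vfun V C) (vunit C) = vunit K" by simp
  show "u_iso V K (fob (incl_vfun V C) (pr a b)) (vprod K (fob (incl_vfun V C) a) (fob (incl_vfun V C) b))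
      (incl_nu V C a b)" if "a \<in> vob C" "b \<in> vob C" for a b
    using that by (simp add: incl_nu_eq K.u_iso_vid)
  show "incl_nu V C (vunit C) a = vid K (fob (incl_vfun V C) a)" if "a \<in> vob C" for a
    using that by (simp add: incl_nu_eq)
  show "incl_nu V C a (vunit C) = vid K (fob (incl_vfun V C) a)" if "a \<in> vob C" for a
    using that by (simp add: incl_nu_eq)
  let ?F = "fob (incl_vfun V C)"
  show "K.cp (?F (pr (pr a b) c)) (vprod K (?F (pr a b)) (?F c))
          (vprod K (vprod K (?F a) (?F b)) (?F c)) (incl_nu V C (pr a b) c)
          (ktp (?F (pr a b)) (vprod K (?F a) (?F b)) (?F c) (?F c) (incl_nu V C a b) (vid K (?F c)))
      = K.cp (?F (pr a (pr b c))) (vprod K (?F a) (?F (pr b c)))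
          (vprod K (?F a) (vprod K (?F b) (?F c))) (incl_nu V C a (pr b c))
          (ktp (?F a) (?F a) (?F (pr b c)) (vprod K (?F b) (?F c)) (vid K (?F a)) (incl_nu V C b c))"
    if "a \<in> vob C" "b \<in> vob C" "c \<in> vob C" for a b c
    using that by (simp add: incl_nu_eq vt)
  show "(vtens C a c b d \<Zsemi> J (pr a b) (pr c d)) \<otimes> incl_nu V C c d
      \<Zsemi> vcomp K (?F (pr a b)) (?F (pr c d)) (vprod K (?F c) (?F d))
    = incl_nu V C a b \<otimes> (J a c \<otimes> J b d \<Zsemi> vtens K (?F a) (?F c) (?F b) (?F d))
      \<Zsemi> vcomp K (?F (pr a b)) (vprod K (?F a) (?F b)) (vprod K (?F c) (?F d))"
    if "a \<in> vob C" "b \<in> vob C" "c \<in> vob C" "d \<in> vob C" for a b c d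
    using that incl_vtens [of a c b d]
      K.cp_vid [of "(pr a b, \<one>)" "(pr c d, \<one>)" "vtens C a c b d \<Zsemi> J (pr a b) (pr c d)"]
      K.vid_cp [of "(pr a b, \<one>)" "(pr c d, \<one>)" "vtens C a c b d \<Zsemi> J (pr a b) (pr c d)"]
    completion_vtens_simps(1-3) [of a c b d \<one> \<one> \<one> \<one>]
    by (simp add: incl_nu_eq ucomp_def utens_def)
qed

end

section \<open>The extension of the identity and its monoidal structure\<close>

locale tensored_monoidal_category = enriched_monoidal_category V C + tensored_category V C T
  for V :: "('o, 'm, 'z) bcm_data_scheme" (structure)
    and C :: "('c, 'o, 'm, 'y) vmoncat_data_scheme" and T +
  assumes monoidal_tensoring: "monoidal_tensoring V C T"
begin

abbreviation g where "g \<equiv> free_ob C T"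
abbreviation e where "e \<equiv> free_unit V C T"
abbreviation E where "E \<equiv> ext_hom V C T"

declare ext_hom.simps [simp del] ext_nu.simps [simp del]

lemma g_vob [simp]: "v \<in> obj V \<Longrightarrow> g v \<in> vob C"
  by (simp add: free_ob_def)

text \<open>Tensors are normalised to products by the simplifier, whereas \<open>eta_eq\<close> is
  applied by hand, so that \<open>eta\<close> stays folded for the rules about it.\<close>

lemma tn_eq [simp]: "\<lbrakk>a \<in> vob C; v \<in> obj V\<rbrakk> \<Longrightarrow> tn a v = pr a (g v)"
  and eta_eq: "\<lbrakk>a \<in> vob C; v \<in> obj V\<rbrakk> \<Longrightarrow> eta a v = tp a a (vunit C) (g v) (vid C a) (e v)"
  and g_unt [simp]: "g \<one> = vunit C"
  and e_unt [simp]: "e \<one> = vid C (vunit C)"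
  using monoidal_tensoring by (simp_all add: monoidal_tensoring_def utens_def)

lemma e_simps [simp]:
  assumes "v \<in> obj V"
  shows "e v \<in> arr V" "src V (e v) = v" "trg V (e v) = hm (vunit C) (g v)"
  using assms eta_simps [of "vunit C" v] by (simp_all add: free_unit_def)

lemma eta_unt [simp]: "a \<in> vob C \<Longrightarrow> eta a \<one> = vid C a"
  by (simp add: eta_eq)

text \<open>Unfolded, \<tau> is an iterated mate of \<open>eta a u\<close> followed by the inverse
  of \<open>curry_iso\<close>; \<open>uncurried_curry_inverse\<close> collapses this to a single
  mate.\<close>

lemma tau_eq:
  assumes "a \<in> vob C" "u \<in> obj V"
  shows "tau V C T (a, u) = mate V u \<one> (hm a (pr a (g u))) (eta a u)"
proof -
  let ?H = "hm a (pr a (g u))"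
  have "eta a u \<Zsemi> J a (pr a (g u)) = mate V \<one> u ?H (eta a u)"
    using assms by (simp add: incl_vfun_def mate_pre)
  then show ?thesis
    using assms uncurried_curry_inverse [of \<one> u \<one> "eta a u" ?H]
    by (simp add: tau_def mu_def tmate_def completion_tensoring_def hom_iff)
qed

lemma tau_simps [simp]:
  assumes "a \<in> vob C" "u \<in> obj V"
  shows "tau V C T (a, u) \<in> arr V" "src V (tau V C T (a, u)) = \<one>"
    "trg V (tau V C T (a, u)) = ihom V u (hm a (pr a (g u)))"
    "uncurry u (hm a (pr a (g u))) (tau V C T (a, u)) = eta a u"
  using assms by (simp_all add: tau_eq)

text \<open>The composite defining \<open>ext_hom\<close> is consumed from the left:
  \<open>eta\<close> passes the inverse associator, the tensored evaluation, the associator and the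
  tensored counit in turn, each by the rule for that factor.\<close>

lemma ext_hom_facts:
  assumes "a \<in> vob C" "b \<in> vob C" "u \<in> obj V" "v \<in> obj V"
  shows ext_hom_simps [simp]: "E (a, u) (b, v) \<in> arr V"
    "src V (E (a, u) (b, v)) = ihom V u (hm a b \<odot> v)"
    "trg V (E (a, u) (b, v)) = hm (pr a (g u)) (pr b (g v))"
    and eta_ext_hom: "cp a (pr a (g u)) (pr b (g v)) (eta a u) (E (a, u) (b, v))
      = \<epsilon> u (hm a b \<odot> v) \<Zsemi> cp a b (pr b (g v)) (\<iota> (hm a b)) (eta b v)"
proof -
  \<comment> \<open>Tensors stay unexpanded, so that the rules about \<open>talpha\<close>,
    \<open>tmap\<close> and \<open>tcounit\<close> match; objects and factors receive opaque names
    for the same reason.\<close>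
  note [simp] = assms and [simp del] = tn_eq
  define H where "H = hm a b"
  define X where "X = ihom V u (H \<odot> v)"
  define p where "p = tn (tn a u) X"
  define q where "q = tn a (u \<odot> X)"
  define r where "r = tn a (H \<odot> v)"
  define s where "s = tn (tn a H) v"
  define t where "t = tn b v"
  have o [simp]: "H \<in> obj V" "X \<in> obj V" by (simp_all add: H_def X_def)
  define m1 where "m1 = tmap V C T a a (u \<odot> X) (H \<odot> v) (vid C a) (\<epsilon> u (H \<odot> v))"
  define m2 where "m2 = tmap V C T (tn a H) b v v (tcounit V C T a b) (\<iota> v)"
  define k2 where "k2 = cp r s t (talpha V C T a H v) m2"
  define k1 where "k1 = cp q r t m1 k2"
  define k where "k = cp p q t (talpha_inv V C T a u X) k1"
  have [simp]: "p \<in> vob C" "q \<in> vob C" "r \<in> vob C" "s \<in> vob C" "t \<in> vob C"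
    by (simp_all add: p_def q_def r_def s_def t_def)
  have m1 [simp]: "m1 \<in> arr V" "src V m1 = \<one>" "trg V m1 = hm q r"
    unfolding m1_def q_def r_def X_def by simp_all
  have m2 [simp]: "m2 \<in> arr V" "src V m2 = \<one>" "trg V m2 = hm s t"
    unfolding m2_def s_def t_def H_def by simp_all
  have al [simp]: "talpha V C T a H v \<in> arr V" "src V (talpha V C T a H v) = \<one>"
    "trg V (talpha V C T a H v) = hm r s"
    unfolding r_def s_def by simp_all
  have ali [simp]: "talpha_inv V C T a u X \<in> arr V" "src V (talpha_inv V C T a u X) = \<one>"
    "trg V (talpha_inv V C T a u X) = hm p q"
    unfolding p_def q_def by simp_all
  have k2 [simp]: "k2 \<in> arr V" "src V k2 = \<one>" "trg V k2 = hm r t" by (simp_all add: k2_def)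
  have k1 [simp]: "k1 \<in> arr V" "src V k1 = \<one>" "trg V k1 = hm q t" by (simp_all add: k1_def)
  have k [simp]: "k \<in> arr V" "src V k = \<one>" "trg V k = hm p t" by (simp_all add: k_def)
  have etap [simp]: "eta (tn a u) X \<in> arr V" "src V (eta (tn a u) X) = X"
    "trg V (eta (tn a u) X) = hm (tn a u) p"
    by (simp_all add: p_def)
  have E_eq: "E (a, u) (b, v) = cp (tn a u) p t (eta (tn a u) X) k"
  proof -
    have "E (a, u) (b, v) = tcomate V C T (tn a u) X t
        (cp p s t (cp p r s (cp p q r (talpha_inv V C T a u X) m1) (talpha V C T a H v)) m2)"
      by (simp add: ext_hom.simps Let_def H_def X_def p_def q_def r_def s_def t_def m1_def m2_def)
    also have "\<dots> = tcomate V C T (tn a u) X t k"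
      by (simp add: k_def k1_def k2_def)
    finally show ?thesis
      by (simp add: tcomate_eq p_def [symmetric])
  qed
  have E: "E (a, u) (b, v) \<in> arr V" "src V (E (a, u) (b, v)) = X"
    "trg V (E (a, u) (b, v)) = hm (tn a u) t"
    by (simp_all add: E_eq)
  then show "E (a, u) (b, v) \<in> arr V" "src V (E (a, u) (b, v)) = ihom V u (hm a b \<odot> v)"
    "trg V (E (a, u) (b, v)) = hm (pr a (g u)) (pr b (g v))"
    by (simp_all add: t_def tn_eq X_def H_def)
  have "cp a (tn a u) t (eta a u) (E (a, u) (b, v)) = cp a q t (eta a (u \<odot> X)) k1"
    unfolding E_eq k_def p_def q_def by (rule eta_cp_talpha_inv) (simp_all flip: q_def)
  also have "\<dots> = cp a r t (\<epsilon> u (H \<odot> v) \<Zsemi> eta a (H \<odot> v)) k2"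
  proof -
    have "cp a q t (eta a (u \<odot> X)) k1
      = cp a a t (vid C a) (cp a r t (\<epsilon> u (H \<odot> v) \<Zsemi> eta a (H \<odot> v)) k2)"
      unfolding k1_def m1_def q_def r_def
      by (rule eta_cp_tmap) (simp_all add: X_def flip: r_def)
    then show ?thesis by (simp add: r_def)
  qed
  also have "\<dots> = \<epsilon> u (H \<odot> v) \<Zsemi> cp a r t (eta a (H \<odot> v)) k2"
    using pre_cp [of a r t "eta a (H \<odot> v)" k2 "\<epsilon> u (H \<odot> v)" "\<iota> \<one>"] by (simp add: r_def)
  also have "cp a r t (eta a (H \<odot> v)) k2
      = cp a (tn a H) t (eta a H) (cp (tn a H) s t (eta (tn a H) v) m2)"
    unfolding k2_def r_def s_def by (rule eta_cp_talpha) (simp_all flip: s_def)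
  also have "cp (tn a H) s t (eta (tn a H) v) m2 = cp (tn a H) b t (tcounit V C T a b) (eta b v)"
    unfolding m2_def s_def t_def by (subst eta_tmap) (simp_all add: H_def)
  also have "cp a (tn a H) t (eta a H) (cp (tn a H) b t (tcounit V C T a b) (eta b v))
      = cp a b t (\<iota> H) (eta b v)"
    unfolding H_def by (rule eta_cp_tcounit) (simp_all add: t_def)
  finally show "cp a (pr a (g u)) (pr b (g v)) (eta a u) (E (a, u) (b, v))
      = \<epsilon> u (hm a b \<odot> v) \<Zsemi> cp a b (pr b (g v)) (\<iota> (hm a b)) (eta b v)"
    by (simp add: H_def t_def tn_eq)
qed

text \<open>The working form of \<open>eta_ext_hom\<close>: the action of \<open>ext_hom\<close> on
  an element \<open>f\<close> of any grade is read off from the uncurried form of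
  \<open>f\<close>.\<close>

lemma eta_cp_ext:
  assumes "a \<in> vob C" "b \<in> vob C" "u \<in> obj V" "v \<in> obj V" "f \<in> arr V" "trg V f = ihom V u (hm a b \<odot> v)"
  shows "cp a (pr a (g u)) (pr b (g v)) (eta a u) (f \<Zsemi> E (a, u) (b, v))
    = uncurry u (hm a b \<odot> v) f \<Zsemi> cp a b (pr b (g v)) (\<iota> (hm a b)) (eta b v)"
proof -
  have "cp a (pr a (g u)) (pr b (g v)) (eta a u) (f \<Zsemi> E (a, u) (b, v))
      = \<iota> u \<otimes> f \<Zsemi> cp a (pr a (g u)) (pr b (g v)) (eta a u) (E (a, u) (b, v))"
    using assms by (simp add: pre_cp)
  then show ?thesis using assms by (simp add: eta_ext_hom uncurry_def)
qed

end

section \<open>Functoriality of the extension\<close>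

context tensored_monoidal_category
begin

lemma ext_fob: "\<lbrakk>a \<in> vob C; u \<in> obj V\<rbrakk> \<Longrightarrow> fob (ext_vfun V C T) (a, u) = pr a (g u)"
  and ext_fhom: "fhom (ext_vfun V C T) = E"
  by (simp_all add: ext_vfun_def)

text \<open>A copy of \<open>eta_inj\<close> in the shape which \<open>tn_eq\<close>
  produces.\<close>

lemma eta_inj':
  assumes "cp a (pr a (g v)) b (eta a v) h = cp a (pr a (g v)) b (eta a v) k"
    and "a \<in> vob C" "v \<in> obj V" "b \<in> vob C" "h \<in> arr V" "trg V h = hm (pr a (g v)) b"
    and "k \<in> arr V" "trg V k = hm (pr a (g v)) b" "src V h = src V k"
  shows "h = k"
  by (rule eta_inj [of a v b]) (use assms in simp_all)

lemma ext_v_functor: "v_functor V K C (ext_vfun V C T)"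
proof
  show "fob (ext_vfun V C T) x \<in> vob C" if "x \<in> vob K" for x
    using that by (cases x) (simp add: ext_fob)
  show "fhom (ext_vfun V C T) x y
      \<in> hom V (vhom K x y) (hm (fob (ext_vfun V C T) x) (fob (ext_vfun V C T) y))"
    if "x \<in> vob K" "y \<in> vob K" for x y
    using that by (cases x; cases y) (simp add: ext_fob ext_fhom hom_iff)
  show "vid K x \<Zsemi> fhom (ext_vfun V C T) x x = vid C (fob (ext_vfun V C T) x)"
    if "x \<in> vob K" for x
  proof -
    obtain a u where x: "x = (a, u)" by (cases x)
    with that have [simp]: "a \<in> vob C" "u \<in> obj V" by auto
    have "cp a (pr a (g u)) (pr a (g u)) (eta a u) (vid K (a, u) \<Zsemi> E (a, u) (a, u)) = eta a u"
      by (simp add: eta_cp_ext uncurry_vid pre_cp)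
    then show ?thesis
      unfolding x by - (rule eta_inj' [of a u], simp_all add: ext_fob ext_fhom)
  qed
  show "vcomp K x y z \<Zsemi> fhom (ext_vfun V C T) x z
      = fhom (ext_vfun V C T) x y \<otimes> fhom (ext_vfun V C T) y z
        \<Zsemi> vcomp C (fob (ext_vfun V C T) x) (fob (ext_vfun V C T) y) (fob (ext_vfun V C T) z)"
    if "x \<in> vob K" "y \<in> vob K" "z \<in> vob K" for x y z
  proof -
    obtain a u b v c w where xyz: "x = (a, u)" "y = (b, v)" "z = (c, w)"
      by (cases x; cases y; cases z)
    with that have [simp]: "a \<in> vob C" "u \<in> obj V" "b \<in> vob C" "v \<in> obj V" "c \<in> vob C" "w \<in> obj V"
      by auto
    let ?p = "pr a (g u)" and ?q = "pr b (g v)" and ?r = "pr c (g w)"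
    let ?Y = "ihom V v (hm b c \<odot> w)"
    let ?k = "cp a b ?r (\<iota> (hm a b)) (cp b c ?r (\<iota> (hm b c)) (eta c w))"
    \<comment> \<open>The common value of both sides after composition with \<open>eta a u\<close>:
      evaluate twice, then compose both hom objects with \<open>eta c w\<close>.\<close>
    let ?m = "\<epsilon> u (hm a b \<odot> v) \<otimes> \<iota> ?Y \<Zsemi> (\<iota> (hm a b) \<otimes> \<epsilon> v (hm b c \<odot> w) \<Zsemi> ?k)"
    have "cp a ?p ?r (eta a u) (vcomp K x y z \<Zsemi> E x z)
        = \<epsilon> u (hm a b \<odot> v) \<otimes> \<iota> ?Y \<Zsemi> (\<iota> (hm a b) \<otimes> \<epsilon> v (hm b c \<odot> w)
          \<Zsemi> cp a c ?r (vcomp C a b c) (eta c w))"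
      by (simp add: xyz eta_cp_ext completion_vcomp_simps pre_cp)
    also have "cp a c ?r (vcomp C a b c) (eta c w) = ?k"
      by (simp add: vcomp_eq_cp)
    finally have 1: "cp a ?p ?r (eta a u) (vcomp K x y z \<Zsemi> E x z) = ?m" .
    have "cp a ?p ?r (eta a u) (cp ?p ?q ?r (E x y) (E y z))
        = cp a ?q ?r (cp a ?p ?q (eta a u) (E x y)) (E y z)"
      by (simp add: xyz)
    also have "\<dots> = \<epsilon> u (hm a b \<odot> v) \<otimes> \<iota> ?Y \<Zsemi> cp a b ?r (\<iota> (hm a b)) (cp b ?q ?r (eta b v) (E y z))"
      using pre_cp [of a ?q ?r "cp a b ?q (\<iota> (hm a b)) (eta b v)" "E y z" "\<epsilon> u (hm a b \<odot> v)" "\<iota> ?Y"]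
      by (simp add: xyz eta_ext_hom)
    also have "cp a b ?r (\<iota> (hm a b)) (cp b ?q ?r (eta b v) (E y z))
        = \<iota> (hm a b) \<otimes> \<epsilon> v (hm b c \<odot> w) \<Zsemi> ?k"
      by (simp add: xyz eta_ext_hom pre_cp)
    finally have 2: "cp a ?p ?r (eta a u) (cp ?p ?q ?r (E x y) (E y z)) = ?m" .
    have "vcomp K x y z \<Zsemi> E x z = cp ?p ?q ?r (E x y) (E y z)"
      by (rule eta_inj' [of a u]) (use 1 2 in \<open>simp_all add: xyz completion_vcomp_simps\<close>)
    then show ?thesis by (simp add: xyz ext_fob ext_fhom ucomp_def)
  qed
qed

lemma eta_vunit [simp]: "eta (vunit C) v = e v"
  by (simp add: free_unit_def)

text \<open>The object arguments are matched up to provable equality, so that the rules still apply after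
  the simplifier has normalised products of objects.\<close>

lemma tp_assoc' [simp]:
  assumes "P = pr a c" "Q = pr b d" "a \<in> vob C" "b \<in> vob C" "c \<in> vob C" "d \<in> vob C"
    "a' \<in> vob C" "b' \<in> vob C" "f \<in> arr V" "trg V f = hm a b" "h \<in> arr V" "trg V h = hm c d"
    "k \<in> arr V" "trg V k = hm a' b'"
  shows "tp P Q a' b' (tp a b c d f h) k = tp a b (pr c a') (pr d b') f (tp c d a' b' h k)"
  using assms by simp

lemma cp_tp_unt':
  assumes "P = pr a d" "Q = pr b e'" "R = pr c x"
    "a \<in> vob C" "b \<in> vob C" "c \<in> vob C" "d \<in> vob C" "e' \<in> vob C" "x \<in> vob C"
    "f \<in> arr V" "trg V f = hm a b" "h \<in> arr V" "trg V h = hm d e'"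
    "f' \<in> arr V" "trg V f' = hm b c" "h' \<in> arr V" "trg V h' = hm e' x"
    and "src V h = \<one> \<or> src V f' = \<one>"
  shows "cp P Q R (tp a b d e' f h) (tp b c e' x f' h') = tp a c d x (cp a b c f f') (cp d e' x h h')"
  using assms by (simp add: cp_tp_unt)

section \<open>The monoidal structure of the extension\<close>

lemma free_nu_simps [simp]:
  assumes "u \<in> obj V" "v \<in> obj V"
  shows "free_nu V C T u v \<in> arr V" "src V (free_nu V C T u v) = \<one>"
    "trg V (free_nu V C T u v) = hm (g (u \<odot> v)) (pr (g u) (g v))"
    and e_free_nu: "cp (vunit C) (g (u \<odot> v)) (pr (g u) (g v)) (e (u \<odot> v)) (free_nu V C T u v)
      = tp (vunit C) (g u) (vunit C) (g v) (e u) (e v)"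
proof -
  let ?k = "tp (vunit C) (g u) (vunit C) (g v) (e u) (e v)"
  have "?k \<in> arr V" "src V ?k = u \<odot> v" "trg V ?k = hm (vunit C) (pr (g u) (g v))"
    using assms by simp_all
  then show "free_nu V C T u v \<in> arr V" "src V (free_nu V C T u v) = \<one>"
    "trg V (free_nu V C T u v) = hm (g (u \<odot> v)) (pr (g u) (g v))"
    "cp (vunit C) (g (u \<odot> v)) (pr (g u) (g v)) (e (u \<odot> v)) (free_nu V C T u v) = ?k"
    using assms tmate_simps [of "vunit C" "u \<odot> v" "pr (g u) (g v)" ?k]
      eta_tmate [of "vunit C" "u \<odot> v" "pr (g u) (g v)" ?k]
    by (simp_all add: free_nu_def utens_def)
qed

lemma half_braiding_simps [simp]:
  assumes "b \<in> vob C" "u \<in> obj V"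
  shows "half_braiding V C T b u \<in> arr V" "src V (half_braiding V C T b u) = \<one>"
    "trg V (half_braiding V C T b u) = hm (pr b (g u)) (pr (g u) b)"
    and eta_half_braiding: "cp b (pr b (g u)) (pr (g u) b) (eta b u) (half_braiding V C T b u)
      = tp (vunit C) (g u) b b (e u) (vid C b)"
proof -
  let ?k = "tp (vunit C) (g u) b b (e u) (vid C b)"
  have "?k \<in> arr V" "src V ?k = u" "trg V ?k = hm b (pr (g u) b)"
    using assms by simp_all
  then show "half_braiding V C T b u \<in> arr V" "src V (half_braiding V C T b u) = \<one>"
    "trg V (half_braiding V C T b u) = hm (pr b (g u)) (pr (g u) b)"
    "cp b (pr b (g u)) (pr (g u) b) (eta b u) (half_braiding V C T b u) = ?k"
    using assms tmate_simps [of b u "pr (g u) b" ?k] eta_tmate [of b u "pr (g u) b" ?k]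
    by (simp_all add: half_braiding_def utens_def)
qed

abbreviation nu where "nu \<equiv> ext_nu V C T"

text \<open>The morphisms making up \<open>ext_nu\<close> have grade \<one>, so interchange
  introduces no braiding. \<open>eta\<close> first meets \<open>free_nu\<close>, which yields the
  product of \<open>e u\<close> and \<open>e v\<close>; then \<open>half_braiding\<close> exchanges
  \<open>e u\<close> with the identity of \<open>b\<close>.\<close>

lemma ext_nu_facts:
  assumes "a \<in> vob C" "b \<in> vob C" "u \<in> obj V" "v \<in> obj V"
  shows ext_nu_simps [simp]: "nu (a, u) (b, v) \<in> arr V" "src V (nu (a, u) (b, v)) = \<one>"
    "trg V (nu (a, u) (b, v)) = hm (pr a (pr b (g (u \<odot> v)))) (pr a (pr (g u) (pr b (g v))))"
    and eta_nu: "cp (pr a b) (pr a (pr b (g (u \<odot> v)))) (pr a (pr (g u) (pr b (g v))))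
        (eta (pr a b) (u \<odot> v)) (nu (a, u) (b, v))
      = tp a (pr a (g u)) b (pr b (g v)) (eta a u) (eta b v)"
proof -
  note [simp] = assms
  let ?P = "pr a (pr b (g (u \<odot> v)))" and ?Q = "pr a (pr (g u) (pr b (g v)))"
  let ?R = "pr a (pr b (pr (g u) (g v)))"
  let ?n1 = "tp (pr a b) (pr a b) (g (u \<odot> v)) (pr (g u) (g v)) (vid C (pr a b)) (free_nu V C T u v)"
  let ?h = "tp (pr b (g u)) (pr (g u) b) (g v) (g v) (half_braiding V C T b u) (vid C (g v))"
  let ?n2 = "tp a a (pr b (pr (g u) (g v))) (pr (g u) (pr b (g v))) (vid C a) ?h"
  have nu: "nu (a, u) (b, v) = cp ?P ?R ?Q ?n1 ?n2"
    by (simp add: ext_nu.simps Let_def)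
  show "nu (a, u) (b, v) \<in> arr V" "src V (nu (a, u) (b, v)) = \<one>"
    "trg V (nu (a, u) (b, v)) = hm ?P ?Q"
    by (simp_all add: nu)
  have 1: "cp (pr a b) ?P ?R (eta (pr a b) (u \<odot> v)) ?n1
      = tp (pr a b) (pr a b) (vunit C) (pr (g u) (g v)) (vid C (pr a b))
          (tp (vunit C) (g u) (vunit C) (g v) (e u) (e v))"
    by (simp add: eta_eq cp_tp_unt' e_free_nu)
  \<comment> \<open>Regrouping combines the identity of \<open>b\<close> with \<open>e u\<close> to
    \<open>eta b u\<close>, on which \<open>half_braiding\<close> is known.\<close>
  have 2: "tp (pr a b) (pr a b) (vunit C) (pr (g u) (g v)) (vid C (pr a b))
          (tp (vunit C) (g u) (vunit C) (g v) (e u) (e v))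
      = tp a a b (pr b (pr (g u) (g v))) (vid C a) (tp b (pr b (g u)) (vunit C) (g v) (eta b u) (e v))"
    by (simp add: eta_eq flip: vid_tp_vid)
  have 3: "tp b (pr (g u) b) (vunit C) (g v) (tp (vunit C) (g u) b b (e u) (vid C b)) (e v)
      = tp (vunit C) (g u) b (pr b (g v)) (e u) (eta b v)"
    using tp_assoc [of "vunit C" "g u" b b "vunit C" "g v" "e u" "vid C b" "e v"]
    by (simp add: eta_eq)
  have 4: "tp a a b (pr (g u) (pr b (g v))) (vid C a) (tp (vunit C) (g u) b (pr b (g v)) (e u) (eta b v))
      = tp a (pr a (g u)) b (pr b (g v)) (eta a u) (eta b v)"
    using tp_assoc [of a a "vunit C" "g u" b "pr b (g v)" "vid C a" "e u" "eta b v"]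
    by (simp add: eta_eq [of a])
  have "cp (pr a b) ?P ?Q (eta (pr a b) (u \<odot> v)) (nu (a, u) (b, v))
      = cp (pr a b) ?R ?Q (cp (pr a b) ?P ?R (eta (pr a b) (u \<odot> v)) ?n1) ?n2"
    unfolding nu by (rule cp_assoc [symmetric]) simp_all
  also have "\<dots> = tp a a b (pr (g u) (pr b (g v))) (vid C a)
      (cp b (pr b (pr (g u) (g v))) (pr (g u) (pr b (g v)))
        (tp b (pr b (g u)) (vunit C) (g v) (eta b u) (e v)) ?h)"
    unfolding 1 2 by (subst cp_tp_unt') simp_all
  also have "cp b (pr b (pr (g u) (g v))) (pr (g u) (pr b (g v)))
        (tp b (pr b (g u)) (vunit C) (g v) (eta b u) (e v)) ?h
      = tp b (pr (g u) b) (vunit C) (g v) (tp (vunit C) (g u) b b (e u) (vid C b)) (e v)"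
    by (subst cp_tp_unt') (simp_all add: eta_half_braiding)
  finally show "cp (pr a b) ?P ?Q (eta (pr a b) (u \<odot> v)) (nu (a, u) (b, v))
      = tp a (pr a (g u)) b (pr b (g v)) (eta a u) (eta b v)"
    unfolding 3 4 .
qed

text \<open>By \<open>eta_inj'\<close>, the formula \<open>eta_nu\<close> characterises
  \<open>ext_nu\<close>.\<close>

lemma ext_nu_eqI:
  assumes "a \<in> vob C" "b \<in> vob C" "u \<in> obj V" "v \<in> obj V"
    and "k \<in> arr V" "src V k = \<one>" "trg V k = hm (pr a (pr b (g (u \<odot> v)))) (pr a (pr (g u) (pr b (g v))))"
    and "cp (pr a b) (pr a (pr b (g (u \<odot> v)))) (pr a (pr (g u) (pr b (g v)))) (eta (pr a b) (u \<odot> v)) k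
      = tp a (pr a (g u)) b (pr b (g v)) (eta a u) (eta b v)"
  shows "nu (a, u) (b, v) = k"
  by (rule eta_inj' [of "pr a b" "u \<odot> v"]) (use assms in \<open>simp_all add: eta_nu\<close>)

text \<open>\<open>eta\<close> at \<one> is an identity, so the identity satisfies the
  characterising equation.\<close>

lemma ext_nu_unit:
  assumes "a \<in> vob C" "u \<in> obj V"
  shows "nu (vunit C, \<one>) (a, u) = vid C (pr a (g u))" "nu (a, u) (vunit C, \<one>) = vid C (pr a (g u))"
  by (rule ext_nu_eqI; use assms in simp)+

lemma ext_nu_unt_unt:
  assumes "a \<in> vob C" "b \<in> vob C"
  shows "nu (a, \<one>) (b, \<one>) = vid C (pr a b)"
  by (rule ext_nu_eqI; use assms in simp)

text \<open>Tested against \<open>eta\<close>, both sides become the product of the three units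
  \<open>eta a u\<close>, \<open>eta b v\<close> and \<open>eta c w\<close>.\<close>

lemma ext_nu_assoc:
  assumes "a \<in> vob C" "b \<in> vob C" "c \<in> vob C" "u \<in> obj V" "v \<in> obj V" "w \<in> obj V"
  defines "P \<equiv> pr a (pr b (pr c (g (u \<odot> (v \<odot> w)))))"
    and "Q \<equiv> pr a (pr (g u) (pr b (pr (g v) (pr c (g w)))))"
  shows "cp P (pr a (pr b (pr (g (u \<odot> v)) (pr c (g w))))) Q (nu (pr a b, u \<odot> v) (c, w))
      (tp (pr a (pr b (g (u \<odot> v)))) (pr a (pr (g u) (pr b (g v)))) (pr c (g w)) (pr c (g w))
        (nu (a, u) (b, v)) (vid C (pr c (g w))))
    = cp P (pr a (pr (g u) (pr b (pr c (g (v \<odot> w)))))) Q (nu (a, u) (pr b c, v \<odot> w))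
      (tp (pr a (g u)) (pr a (g u)) (pr b (pr c (g (v \<odot> w)))) (pr b (pr (g v) (pr c (g w))))
        (vid C (pr a (g u))) (nu (b, v) (c, w)))" (is "?l = ?r")
proof -
  note [simp] = assms(1-6)
  let ?abc = "pr a (pr b c)" and ?M = "pr a (pr b (pr (g (u \<odot> v)) (pr c (g w))))"
    and ?N = "pr a (pr (g u) (pr b (pr c (g (v \<odot> w)))))"
  let ?s = "tp (pr a (pr b (g (u \<odot> v)))) (pr a (pr (g u) (pr b (g v)))) (pr c (g w)) (pr c (g w))
        (nu (a, u) (b, v)) (vid C (pr c (g w)))"
  let ?t = "tp (pr a (g u)) (pr a (g u)) (pr b (pr c (g (v \<odot> w)))) (pr b (pr (g v) (pr c (g w))))
        (vid C (pr a (g u))) (nu (b, v) (c, w))"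
  let ?eta = "eta ?abc (u \<odot> (v \<odot> w))"
  let ?d = "tp a (pr a (g u)) (pr b c) (pr b (pr (g v) (pr c (g w)))) (eta a u)
    (tp b (pr b (g v)) c (pr c (g w)) (eta b v) (eta c w))"
  have PQ [simp]: "P \<in> vob C" "Q \<in> vob C" by (simp_all add: P_def Q_def)
  have "cp ?abc ?M Q (cp ?abc P ?M ?eta (nu (pr a b, u \<odot> v) (c, w))) ?s
      = cp ?abc ?M Q (tp (pr a b) (pr a (pr b (g (u \<odot> v)))) c (pr c (g w)) (eta (pr a b) (u \<odot> v)) (eta c w)) ?s"
    using eta_nu [of "pr a b" c "u \<odot> v" w] by (simp add: P_def)
  also have "\<dots> = tp (pr a b) (pr a (pr (g u) (pr b (g v)))) c (pr c (g w))
      (tp a (pr a (g u)) b (pr b (g v)) (eta a u) (eta b v)) (eta c w)"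
    by (subst cp_tp_unt') (simp_all add: Q_def eta_nu)
  also have "\<dots> = ?d"
    using tp_assoc [of a "pr a (g u)" b "pr b (g v)" c "pr c (g w)" "eta a u" "eta b v" "eta c w"]
    by simp
  finally have 1: "cp ?abc P Q ?eta ?l = ?d"
    by (subst (asm) cp_assoc) (simp_all add: P_def Q_def)
  have "cp ?abc ?N Q (cp ?abc P ?N ?eta (nu (a, u) (pr b c, v \<odot> w))) ?t
      = cp ?abc ?N Q (tp a (pr a (g u)) (pr b c) (pr b (pr c (g (v \<odot> w)))) (eta a u) (eta (pr b c) (v \<odot> w))) ?t"
    using eta_nu [of a "pr b c" u "v \<odot> w"] by (simp add: P_def)
  also have "\<dots> = ?d"
    by (subst cp_tp_unt') (simp_all add: Q_def eta_nu)
  finally have 2: "cp ?abc P Q ?eta ?r = ?d"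
    by (subst (asm) cp_assoc) (simp_all add: P_def Q_def)
  show ?thesis
    by (rule eta_inj' [of ?abc "u \<odot> (v \<odot> w)" Q])
      (use 1 2 in \<open>simp_all add: P_def Q_def\<close>)
qed

text \<open>Tested against \<open>eta\<close>, both sides become \<open>?d\<close>. On the left, the
  inverse braiding in the product of the completion cancels by \<open>uncurry_tp_cp\<close>; on the
  right, the braiding comes from \<open>cp_tp\<close>.\<close>

lemma ext_nu_natural:
  assumes "a \<in> vob C" "b \<in> vob C" "c \<in> vob C" "d \<in> vob C"
    and "u \<in> obj V" "v \<in> obj V" "w \<in> obj V" "x \<in> obj V"
  defines "P \<equiv> pr a (pr b (g (u \<odot> v)))" and "Q \<equiv> pr c (pr d (g (w \<odot> x)))"
    and "R \<equiv> pr c (pr (g w) (pr d (g x)))" and "S \<equiv> pr a (pr (g u) (pr b (g v)))"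
  shows "cp P Q R (vtens K (a, u) (c, w) (b, v) (d, x) \<Zsemi> E (pr a b, u \<odot> v) (pr c d, w \<odot> x))
      (nu (c, w) (d, x))
    = cp P S R (nu (a, u) (b, v))
      (tp (pr a (g u)) (pr c (g w)) (pr b (g v)) (pr d (g x)) (E (a, u) (c, w)) (E (b, v) (d, x)))"
    (is "?l = ?r")
proof -
  note [simp] = assms(1-8)
  have PQ [simp]: "P \<in> vob C" "Q \<in> vob C" "R \<in> vob C" "S \<in> vob C"
    by (simp_all add: P_def Q_def R_def S_def)
  let ?X = "ihom V u (hm a c \<odot> w)" and ?Y = "ihom V v (hm b d \<odot> x)"
  let ?eta = "eta (pr a b) (u \<odot> v)"
  let ?vt = "vtens K (a, u) (c, w) (b, v) (d, x)"
  let ?EE = "E (pr a b, u \<odot> v) (pr c d, w \<odot> x)"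
  let ?tt = "tp c (pr c (g w)) d (pr d (g x)) (eta c w) (eta d x)"
  let ?u = "uncurry (u \<odot> v) (hm (pr a b) (pr c d) \<odot> (w \<odot> x)) ?vt"
  let ?EE' = "tp (pr a (g u)) (pr c (g w)) (pr b (g v)) (pr d (g x)) (E (a, u) (c, w)) (E (b, v) (d, x))"
  let ?d = "\<iota> u \<otimes> (\<beta> v ?X \<otimes> \<iota> ?Y) \<Zsemi> tp a (pr c (g w)) b (pr d (g x))
     (cp a (pr a (g u)) (pr c (g w)) (eta a u) (E (a, u) (c, w)))
     (cp b (pr b (g v)) (pr d (g x)) (eta b v) (E (b, v) (d, x)))"
  have vt [simp]: "?vt \<in> arr V" "src V ?vt = ?X \<odot> ?Y"
    "trg V ?vt = ihom V (u \<odot> v) (hm (pr a b) (pr c d) \<odot> (w \<odot> x))"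
    by (simp_all add: completion_vtens_simps(1-3))
  \<comment> \<open>The product morphism is written as a product of universal elements, the form in
    which \<open>uncurry_tp_cp\<close> applies.\<close>
  have vt_eq: "?vt = ktp (a, u) (c, w) (b, v) (d, x) (\<iota> ?X) (\<iota> ?Y)"
    by (simp add: utens_def)
  have EE: "?EE \<in> arr V" "src V ?EE = ihom V (u \<odot> v) (hm (pr a b) (pr c d) \<odot> (w \<odot> x))"
    "trg V ?EE = hm P Q"
    using ext_hom_simps [of "pr a b" "pr c d" "u \<odot> v" "w \<odot> x"] by (simp_all add: P_def Q_def)
  have nu: "trg V (nu (c, w) (d, x)) = hm Q R" "trg V (nu (a, u) (b, v)) = hm P S"
    by (simp_all add: P_def Q_def R_def S_def)
  have EE': "?EE' \<in> arr V" "src V ?EE' = ?X \<odot> ?Y" "trg V ?EE' = hm S R"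
    by (simp_all add: R_def S_def)
  have eta: "trg V ?eta = hm (pr a b) P" by (simp add: P_def)
  have eta': "trg V (eta (pr c d) (w \<odot> x)) = hm (pr c d) Q" by (simp add: Q_def)
  have "cp (pr a b) P R ?eta ?l = cp (pr a b) Q R (cp (pr a b) P Q ?eta (?vt \<Zsemi> ?EE)) (nu (c, w) (d, x))"
    by (rule cp_assoc [symmetric]) (simp_all add: eta EE nu)
  also have "cp (pr a b) P Q ?eta (?vt \<Zsemi> ?EE)
      = ?u \<Zsemi> cp (pr a b) (pr c d) Q (\<iota> (hm (pr a b) (pr c d))) (eta (pr c d) (w \<odot> x))"
    using eta_cp_ext [of "pr a b" "pr c d" "u \<odot> v" "w \<odot> x" ?vt] by (simp add: P_def Q_def)
  also have "cp (pr a b) Q R (?u \<Zsemi> cp (pr a b) (pr c d) Q (\<iota> (hm (pr a b) (pr c d)))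
        (eta (pr c d) (w \<odot> x))) (nu (c, w) (d, x))
      = ?u \<Zsemi> cp (pr a b) Q R (cp (pr a b) (pr c d) Q (\<iota> (hm (pr a b) (pr c d)))
        (eta (pr c d) (w \<odot> x))) (nu (c, w) (d, x))"
    using pre_cp [of "pr a b" Q R "cp (pr a b) (pr c d) Q (\<iota> (hm (pr a b) (pr c d))) (eta (pr c d) (w \<odot> x))"
      "nu (c, w) (d, x)" ?u "\<iota> \<one>"] by (simp add: nu eta')
  also have "cp (pr a b) Q R (cp (pr a b) (pr c d) Q (\<iota> (hm (pr a b) (pr c d)))
        (eta (pr c d) (w \<odot> x))) (nu (c, w) (d, x))
      = cp (pr a b) (pr c d) R (\<iota> (hm (pr a b) (pr c d))) ?tt"
    using eta_nu [of c d w x] by (simp add: nu eta' flip: Q_def R_def)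
  also have "?u \<Zsemi> \<dots> = \<iota> u \<otimes> (\<beta> v ?X \<otimes> \<iota> ?Y) \<Zsemi> tp a (pr c (g w)) b (pr d (g x))
     (\<epsilon> u (hm a c \<odot> w) \<Zsemi> cp a c (pr c (g w)) (\<iota> (hm a c)) (eta c w))
     (\<epsilon> v (hm b d \<odot> x) \<Zsemi> cp b d (pr d (g x)) (\<iota> (hm b d)) (eta d x))"
    unfolding vt_eq R_def
    using uncurry_tp_cp [of a c b d "pr c (g w)" "pr d (g x)" u w v x "\<iota> ?X" "\<iota> ?Y" "eta c w" "eta d x"]
    by (simp flip: evl_eq_uncurry)
  also have "\<dots> = ?d"
    by (simp add: eta_ext_hom)
  finally have 1: "cp (pr a b) P R ?eta ?l = ?d" .
  have "cp (pr a b) P R ?eta ?r = cp (pr a b) S R (cp (pr a b) P S ?eta (nu (a, u) (b, v))) ?EE'"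
    by (rule cp_assoc [symmetric]) (simp_all add: eta EE' nu)
  also have "\<dots> = cp (pr a b) S R (tp a (pr a (g u)) b (pr b (g v)) (eta a u) (eta b v)) ?EE'"
    by (simp add: eta_nu P_def S_def)
  also have "\<dots> = ?d"
    using cp_tp [of a "pr a (g u)" "pr c (g w)" b "pr b (g v)" "pr d (g x)" "eta a u" "eta b v"
      "E (a, u) (c, w)" "E (b, v) (d, x)"] by (simp add: S_def R_def)
  finally have 2: "cp (pr a b) P R ?eta ?r = ?d" .
  show ?thesis
    by (rule eta_inj' [of "pr a b" "u \<odot> v" R])
      (use 1 2 in \<open>simp_all add: EE EE' nu flip: P_def\<close>)
qed

end

section \<open>The transformation \<open>\<tau>\<close>\<close>

context enriched_category
begin

text \<open>The vertical sides of a commuting square may be inverted. As \<open>f\<close> and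
  \<open>h\<close> have any grade, this covers naturality on whole hom objects.\<close>

lemma u_inverse_natural:
  assumes "x \<in> vob C" "y \<in> vob C" "x' \<in> vob C" "y' \<in> vob C"
    and s: "u_inverse V C x x' t s" and s': "u_inverse V C y y' t' s'"
    and f: "f \<in> arr V" "trg V f = hm x y" "h \<in> arr V" "trg V h = hm x' y'"
    and nat: "cp x x' y' t h = cp x y y' f t'"
  shows "cp x' x y s f = cp x' y' y h s'"
proof -
  note [simp] = assms(1-4) u_inverseD [OF s assms(1,3)] u_inverseD [OF s' assms(2,4)] f
  have "cp x' x y s f = cp x' x y s (cp x y' y (cp x y y' f t') s')" by simp
  also have "\<dots> = cp x' x y s (cp x x' y t (cp x' y' y h s'))" by (simp flip: nat)
  also have "\<dots> = cp x' x' y (cp x' x x' s t) (cp x' y' y h s')" by (subst cp_assoc) simp_all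
  finally show ?thesis by simp
qed

end

section \<open>Transport of isomorphisms along endofunctors and the inclusion\<close>

context enriched_monoidal_category
begin

text \<open>\<open>F\<close> extends to the completion by fixing the second coordinate: on uncurried
  elements it acts by \<open>fhom F a b \<otimes> \<iota> v\<close>. The effect on inverse pairs is
  worked out, from compatibility of \<open>F\<close> with composition and identities.\<close>

lemma v_functor_lift_iso:
  assumes F: "v_functor V C C F"
    and "a \<in> vob C" "b \<in> vob C" "u \<in> obj V" "v \<in> obj V"
    and iso: "u_iso V K (a, u) (b, v) f"
  shows "u_iso V K (fob F a, u) (fob F b, v)
    (mate V u \<one> (hm (fob F a) (fob F b) \<odot> v) (uncurry u (hm a b \<odot> v) f \<Zsemi> fhom F a b \<otimes> \<iota> v))"
proof -
  interpret F: v_functor V C C F by fact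
  \<comment> \<open>A function of all its data, since it is applied to \<open>f\<close> and, with
    the roles exchanged, to the inverse of \<open>f\<close>.\<close>
  define l where "l a b u v f
    = mate V u \<one> (hm (fob F a) (fob F b) \<odot> v) (uncurry u (hm a b \<odot> v) f \<Zsemi> fhom F a b \<otimes> \<iota> v)"
    for a b u v f
  have l: "l a b u v f \<in> arr V" "src V (l a b u v f) = \<one>"
    "trg V (l a b u v f) = ihom V u (hm (fob F a) (fob F b) \<odot> v)"
    "uncurry u (hm (fob F a) (fob F b) \<odot> v) (l a b u v f) = uncurry u (hm a b \<odot> v) f \<Zsemi> fhom F a b \<otimes> \<iota> v"
    if "a \<in> vob C" "b \<in> vob C" "u \<in> obj V" "v \<in> obj V" "f \<in> arr V" "src V f = \<one>"
      "trg V f = ihom V u (hm a b \<odot> v)" for a b u v f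
    using that by (simp_all add: l_def F.fob_vob)
  have l_inv: "K.cp (fob F a, u) (fob F b, v) (fob F a, u) (l a b u v f) (l b a v u h) = vid K (fob F a, u)"
    if "a \<in> vob C" "b \<in> vob C" "u \<in> obj V" "v \<in> obj V" "u_inverse V K (a, u) (b, v) f h" for a b u v f h
  proof -
    note [simp] = that(1-4)
    have fh [simp]: "f \<in> arr V" "src V f = \<one>" "trg V f = ihom V u (hm a b \<odot> v)"
      "h \<in> arr V" "src V h = \<one>" "trg V h = ihom V v (hm b a \<odot> u)"
      "K.cp (a, u) (b, v) (a, u) f h = vid K (a, u)"
      using K.u_inverseD [OF that(5)] by simp_all
    let ?f = "uncurry u (hm a b \<odot> v) f" and ?h = "uncurry v (hm b a \<odot> u) h"
    have fob [simp]: "fob F a \<in> vob C" "fob F b \<in> vob C" by (simp_all add: F.fob_vob)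
    have "uncurry u (hm (fob F a) (fob F a) \<odot> u)
        (K.cp (fob F a, u) (fob F b, v) (fob F a, u) (l a b u v f) (l b a v u h))
      = ?f \<Zsemi> (fhom F a b \<otimes> \<iota> v \<Zsemi> (\<iota> (hm (fob F a) (fob F b)) \<otimes> (?h \<Zsemi> fhom F b a \<otimes> \<iota> u)
          \<Zsemi> vcomp C (fob F a) (fob F b) (fob F a) \<otimes> \<iota> u))"
      by (simp add: uncurry_cp l)
    also have "fhom F a b \<otimes> \<iota> v \<Zsemi> (\<iota> (hm (fob F a) (fob F b)) \<otimes> (?h \<Zsemi> fhom F b a \<otimes> \<iota> u)
          \<Zsemi> vcomp C (fob F a) (fob F b) (fob F a) \<otimes> \<iota> u)
      = (\<iota> (hm a b) \<otimes> ?h) \<Zsemi> (fhom F a b \<otimes> (fhom F b a \<otimes> \<iota> u)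
          \<Zsemi> vcomp C (fob F a) (fob F b) (fob F a) \<otimes> \<iota> u)"
      by (simp add: tens_cmp_chain)
    also have "fhom F a b \<otimes> (fhom F b a \<otimes> \<iota> u) \<Zsemi> vcomp C (fob F a) (fob F b) (fob F a) \<otimes> \<iota> u
      = (fhom F a b \<otimes> fhom F b a \<Zsemi> vcomp C (fob F a) (fob F b) (fob F a)) \<otimes> \<iota> u"
      by (simp add: cmp_atens_idt)
    also have "\<dots> = vcomp C a b a \<otimes> \<iota> u \<Zsemi> fhom F a a \<otimes> \<iota> u"
      by (simp add: cmp_atens_idt flip: F.fhom_vcomp)
    also have "?f \<Zsemi> (\<iota> (hm a b) \<otimes> ?h \<Zsemi> (vcomp C a b a \<otimes> \<iota> u \<Zsemi> fhom F a a \<otimes> \<iota> u))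
      = uncurry u (hm a a \<odot> u) (vid K (a, u)) \<Zsemi> fhom F a a \<otimes> \<iota> u"
      using uncurry_cp [of a b a u v u f h] by simp
    also have "\<dots> = uncurry u (hm (fob F a) (fob F a) \<odot> u) (vid K (fob F a, u))"
      by (simp add: uncurry_vid F.fhom_vid flip: cmp_atens_idt)
    finally show ?thesis
      by - (rule uncurry_inj [of u "hm (fob F a) (fob F a) \<odot> u"], simp_all add: l)
  qed
  obtain h where h: "u_inverse V K (a, u) (b, v) f h" using iso by (auto simp: u_iso_def)
  have fh: "f \<in> arr V" "src V f = \<one>" "trg V f = ihom V u (hm a b \<odot> v)"
      "h \<in> arr V" "src V h = \<one>" "trg V h = ihom V v (hm b a \<odot> u)"
    using K.u_inverseD [OF h] assms(2-5) by simp_all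
  have "u_inverse V K (fob F a, u) (fob F b, v) (l a b u v f) (l b a v u h)"
    using l_inv [OF assms(2-5) h] l_inv [OF assms(3,2,5,4) K.u_inverse_sym [OF h]] assms(2-5) fh
    by (intro K.u_inverseI) (simp_all add: l)
  then show ?thesis by (auto simp: u_iso_def l_def)
qed

text \<open>Through \<open>v_functor_lift_iso\<close>, this functor will carry the component of
  \<tau> at \<open>(vunit C, u)\<close> to an isomorphism from \<open>(b, u)\<close> to
  \<open>(pr (g u) b, \<one>)\<close>.\<close>

definition rtens_vfun :: "'c \<Rightarrow> ('c, 'c, 'm) vfun_data" where
  "rtens_vfun b = \<lparr>fob = (\<lambda>a. pr a b), fhom = (\<lambda>a c. tp a c b b (\<iota> (hm a c)) (vid C b))\<rparr>"

text \<open>An identity has grade \<one>, so multiplication with it commutes with composition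
  without any braiding.\<close>

lemma rtens_v_functor:
  assumes "b \<in> vob C"
  shows "v_functor V C C (rtens_vfun b)"
proof
  fix a c d
  assume [simp]: "a \<in> vob C" "c \<in> vob C" "d \<in> vob C"
  note [simp] = assms
  have "cp (pr a b) (pr c b) (pr d b) (tp a c b b (\<iota> (hm a c)) (vid C b))
      (tp c d b b (\<iota> (hm c d)) (vid C b)) = tp a d b b (vcomp C a c d) (vid C b)"
    using cp_tp_unt [of a c d b b b "\<iota> (hm a c)" "vid C b" "\<iota> (hm c d)" "vid C b"]
    by (simp add: vcomp_eq_cp)
  then have "tp a c b b (\<iota> (hm a c)) (vid C b) \<otimes> tp c d b b (\<iota> (hm c d)) (vid C b)
      \<Zsemi> vcomp C (pr a b) (pr c b) (pr d b) = tp a d b b (vcomp C a c d) (vid C b)"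
    by (simp only: ucomp_def)
  then show "vcomp C a c d \<Zsemi> fhom (rtens_vfun b) a d
      = fhom (rtens_vfun b) a c
        \<otimes> fhom (rtens_vfun b) c d
        \<Zsemi> vcomp C (fob (rtens_vfun b) a)
          (fob (rtens_vfun b) c)
          (fob (rtens_vfun b) d)"
    using pre_tp [of a d b b "\<iota> (hm a d)" "vid C b" "vcomp C a c d" "\<iota> \<one>"] by (simp add: rtens_vfun_def)
next
  fix a assume [simp]: "a \<in> vob C"
  show "vid C a \<Zsemi> fhom (rtens_vfun b) a a
      = vid C (fob (rtens_vfun b) a)"
    using assms pre_tp [of a a b b "\<iota> (hm a a)" "vid C b" "vid C a" "\<iota> \<one>"] by (simp add: rtens_vfun_def)
qed (use assms in \<open>simp_all add: hom_iff rtens_vfun_def\<close>)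

text \<open>Composition with \<open>J\<close> is inverted by \<open>uncurry \<one>\<close>, so the
  given inverse comes from \<open>C\<close>, and the inverse laws can be compared there.\<close>

lemma incl_reflects_iso:
  assumes "u_iso V K (a, \<one>) (b, \<one>) (f \<Zsemi> J a b)" "a \<in> vob C" "b \<in> vob C"
    "f \<in> arr V" "src V f = \<one>" "trg V f = hm a b"
  shows "u_iso V C a b f"
proof -
  obtain h where h: "u_inverse V K (a, \<one>) (b, \<one>) (f \<Zsemi> J a b) h"
    using assms(1) by (auto simp: u_iso_def)
  have h' [simp]: "h \<in> arr V" "src V h = \<one>" "trg V h = ihom V \<one> (hm b a)"
    using K.u_inverseD [OF h] assms by simp_all
  note [simp] = assms(2-)
  let ?h = "uncurry \<one> (hm b a) h"
  have hJ: "h = ?h \<Zsemi> J b a"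
    by (rule uncurry_unt_inj [of "hm b a"]) simp_all
  have 1: "cp a b a f ?h = vid C a"
  proof -
    have "cp a b a f ?h \<Zsemi> J a a = vid K (a, \<one>)"
      using K.u_inverseD(7) [OF h] incl_cp [of a b a f ?h] by (simp flip: hJ)
    then have "uncurry \<one> (hm a a) (cp a b a f ?h \<Zsemi> J a a) = uncurry \<one> (hm a a) (vid C a \<Zsemi> J a a)"
      by (simp only: incl_vid assms)
    then show ?thesis by simp
  qed
  have 2: "cp b a b ?h f = vid C b"
  proof -
    have "cp b a b ?h f \<Zsemi> J b b = vid K (b, \<one>)"
      using K.u_inverseD(8) [OF h] incl_cp [of b a b ?h f] by (simp flip: hJ)
    then have "uncurry \<one> (hm b b) (cp b a b ?h f \<Zsemi> J b b) = uncurry \<one> (hm b b) (vid C b \<Zsemi> J b b)"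
      by (simp only: incl_vid assms)
    then show ?thesis by simp
  qed
  show ?thesis unfolding u_iso_def
    by (rule exI [of _ ?h], rule u_inverseI) (simp_all add: 1 2)
qed

end

section \<open>Naturality and monoidality of \<tau>\<close>

context tensored_monoidal_category
begin

abbreviation tau' where "tau' \<equiv> tau V C T"
abbreviation EI where "EI \<equiv> comp_vfun V (ext_vfun V C T) (incl_vfun V C)"
abbreviation nuEI where
  "nuEI \<equiv> comp_nu V K C K (ext_vfun V C T) nu (incl_vfun V C) (incl_nu V C)"

lemma EI_fob: "\<lbrakk>a \<in> vob C; u \<in> obj V\<rbrakk> \<Longrightarrow> fob EI (a, u) = (pr a (g u), \<one>)"
  and EI_fhom: "\<lbrakk>a \<in> vob C; u \<in> obj V; b \<in> vob C; v \<in> obj V\<rbrakk>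
    \<Longrightarrow> fhom EI (a, u) (b, v) = E (a, u) (b, v) \<Zsemi> J (pr a (g u)) (pr b (g v))"
  by (simp_all add: comp_vfun_def ext_fob ext_fhom)

lemma nuEI_eq:
  assumes "a \<in> vob C" "u \<in> obj V" "b \<in> vob C" "v \<in> obj V"
  shows "nuEI (a, u) (b, v)
    = nu (a, u) (b, v) \<Zsemi> J (pr a (pr b (g (u \<odot> v)))) (pr a (pr (g u) (pr b (g v))))"
  using assms by (simp add: comp_nu_def ext_fob incl_nu_eq)

lemma tau_unt: "a \<in> vob C \<Longrightarrow> tau' (a, \<one>) = vid K (a, \<one>)"
  by (rule uncurry_unt_inj [of "hm a a"]) (use uncurry_vid [of a \<one>] tau_simps [of a \<one>] in simp_all)

text \<open>This rule and the next translate composition with \<tau>, on either side, into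
  composition with \<open>eta\<close> in \<open>C\<close>; statements about \<tau> thus become facts
  already proved about \<open>eta\<close>.\<close>

lemma uncurry_cp_tau:
  assumes "a \<in> vob C" "b \<in> vob C" "u \<in> obj V" "v \<in> obj V" "f \<in> arr V" "trg V f = ihom V u (hm a b \<odot> v)"
  shows "uncurry u (hm a (pr b (g v))) (K.cp (a, u) (b, v) (pr b (g v), \<one>) f (tau' (b, v)))
    = uncurry u (hm a b \<odot> v) f \<Zsemi> cp a b (pr b (g v)) (\<iota> (hm a b)) (eta b v)"
  using assms by (simp add: uncurry_cp_unt)

lemma uncurry_tau_cp:
  assumes "a \<in> vob C" "c \<in> vob C" "u \<in> obj V" "f \<in> arr V" "trg V f = hm (pr a (g u)) c"
  shows "uncurry u (hm a c) (K.cp (a, u) (pr a (g u), \<one>) (c, \<one>) (tau' (a, u)) (f \<Zsemi> J (pr a (g u)) c))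
    = cp a (pr a (g u)) c (eta a u) f"
  using assms by (simp add: uncurry_cp_unt pre_cp)

text \<open>Uncurried, this is exactly \<open>eta_ext_hom\<close>.\<close>

lemma tau_natural:
  assumes "a \<in> vob C" "b \<in> vob C" "u \<in> obj V" "v \<in> obj V"
  shows "K.cp (a, u) (pr a (g u), \<one>) (pr b (g v), \<one>) (tau' (a, u)) (fhom EI (a, u) (b, v))
    = K.cp (a, u) (b, v) (pr b (g v), \<one>) (\<iota> (ihom V u (hm a b \<odot> v))) (tau' (b, v))"
  by (rule uncurry_inj [of u "hm a (pr b (g v))"])
    (use assms in \<open>simp_all add: EI_fhom uncurry_tau_cp uncurry_cp_tau eta_ext_hom flip: evl_eq_uncurry\<close>)

text \<open>Uncurried, this is \<open>eta_nu\<close>: the braidings in the product of the completion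
  vanish because the components of \<tau> have grade \<one> and their targets have second coordinate
  \<one>.\<close>

lemma tau_tp:
  assumes "a \<in> vob C" "b \<in> vob C" "u \<in> obj V" "v \<in> obj V"
  shows "K.cp (pr a b, u \<odot> v) (pr a (pr b (g (u \<odot> v))), \<one>) (pr a (pr (g u) (pr b (g v))), \<one>)
      (tau' (pr a b, u \<odot> v)) (nuEI (a, u) (b, v))
    = ktp (a, u) (pr a (g u), \<one>) (b, v) (pr b (g v), \<one>) (tau' (a, u)) (tau' (b, v))"
proof (rule uncurry_inj [of "u \<odot> v" "hm (pr a b) (pr a (pr (g u) (pr b (g v))))"])
  note [simp] = assms
  have [simp]: "trg V (tau' (pr a b, u \<odot> v)) = ihom V (u \<odot> v) (hm (pr a b) (pr a (pr b (g (u \<odot> v)))))"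
    using tau_simps [of "pr a b" "u \<odot> v"] by simp
  show "uncurry (u \<odot> v) (hm (pr a b) (pr a (pr (g u) (pr b (g v)))))
      (K.cp (pr a b, u \<odot> v) (pr a (pr b (g (u \<odot> v))), \<one>) (pr a (pr (g u) (pr b (g v))), \<one>)
        (tau' (pr a b, u \<odot> v)) (nuEI (a, u) (b, v)))
    = uncurry (u \<odot> v) (hm (pr a b) (pr a (pr (g u) (pr b (g v)))))
      (ktp (a, u) (pr a (g u), \<one>) (b, v) (pr b (g v), \<one>) (tau' (a, u)) (tau' (b, v)))"
    using uncurry_tau_cp [of "pr a b" "pr a (pr (g u) (pr b (g v)))" "u \<odot> v" "nu (a, u) (b, v)"]
      uncurry_tp(4) [of a "pr a (g u)" b "pr b (g v)" u \<one> v \<one> "tau' (a, u)" "tau' (b, v)"]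
    by (simp add: nuEI_eq eta_nu utens_def)
qed (use assms tau_simps [of "pr a b" "u \<odot> v"]
  uncurry_tp [of a "pr a (g u)" b "pr b (g v)" u \<one> v \<one> "tau' (a, u)" "tau' (b, v)"]
  in \<open>simp_all add: nuEI_eq\<close>)

lemma tau_monoidal_nat: "v_monoidal_nat V K K (id_vfun V K) (id_nu K) EI nuEI tau'"
proof (rule v_monoidal_nat.intro, unfold_locales)
  show "tau' x \<in> uhom V K (fob (id_vfun V K) x) (fob EI x)" if "x \<in> vob K" for x
    using that by (cases x) (simp add: uhom_def hom_iff id_vfun_def EI_fob)
  show "tau' x \<otimes> fhom EI x y \<Zsemi> vcomp K (fob (id_vfun V K) x) (fob EI x) (fob EI y)
      = fhom (id_vfun V K) x y \<otimes> tau' y \<Zsemi> vcomp K (fob (id_vfun V K) x) (fob (id_vfun V K) y) (fob EI y)"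
    if "x \<in> vob K" "y \<in> vob K" for x y
    using that tau_natural by (cases x; cases y) (simp add: EI_fob id_vfun_def ucomp_def)
  show "tau' (vunit K) = vid K (vunit K)" by (simp add: tau_unt)
  show "K.cp (fob (id_vfun V K) (vprod K x y)) (fob EI (vprod K x y)) (vprod K (fob EI x) (fob EI y))
        (tau' (vprod K x y)) (nuEI x y)
      = K.cp (fob (id_vfun V K) (vprod K x y)) (vprod K (fob (id_vfun V K) x) (fob (id_vfun V K) y))
        (vprod K (fob EI x) (fob EI y)) (id_nu K x y)
        (ktp (fob (id_vfun V K) x) (fob EI x) (fob (id_vfun V K) y) (fob EI y) (tau' x) (tau' y))"
    if "x \<in> vob K" "y \<in> vob K" for x y
  proof -
    obtain a u b v where xy: "x = (a, u)" "y = (b, v)" by (cases x; cases y)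
    with that have [simp]: "a \<in> vob C" "u \<in> obj V" "b \<in> vob C" "v \<in> obj V" by auto
    show ?thesis
      using tau_tp [of a b u v] uncurry_tp(1-3) [of a "pr a (g u)" b "pr b (g v)" u \<one> v \<one> "tau' (a, u)" "tau' (b, v)"]
      by (simp add: xy EI_fob id_vfun_def id_nu_def)
  qed
qed

section \<open>The extension is monoidal once \<tau> is invertible\<close>

definition tau_iso :: bool where
  "tau_iso \<longleftrightarrow> (\<forall>a \<in> vob C. \<forall>u \<in> obj V. u_iso V K (a, u) (pr a (g u), \<one>) (tau' (a, u)))"

text \<open>Right multiplication by \<open>b\<close> carries \<tau> at \<open>(vunit C, u)\<close>
  to an isomorphism \<open>?m\<close> out of \<open>(b, u)\<close>. It equals \<tau> at
  \<open>(b, u)\<close> followed by the included half braiding, which is therefore invertible by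
  cancellation in the completion, and then in \<open>C\<close>.\<close>

lemma half_braiding_iso:
  assumes "u_iso V K (vunit C, u) (g u, \<one>) (tau' (vunit C, u))"
    and "u_iso V K (b, u) (pr b (g u), \<one>) (tau' (b, u))" and "b \<in> vob C" "u \<in> obj V"
  shows "u_iso V C (pr b (g u)) (pr (g u) b) (half_braiding V C T b u)"
proof -
  note [simp] = assms(3,4)
  let ?hb = "half_braiding V C T b u"
  let ?k = "tp (vunit C) (g u) b b (e u) (vid C b)"
  let ?m = "mate V u \<one> (hm b (pr (g u) b)) ?k"
  have [simp]: "trg V ?k = hm b (pr (g u) b)" using tp_simps(3) [of "vunit C" "g u" b b "e u" "vid C b"] by simp
  have [simp]: "trg V (tau' (vunit C, u)) = ihom V u (hm (vunit C) (g u))"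
    "uncurry u (hm (vunit C) (g u)) (tau' (vunit C, u)) = e u"
    using tau_simps(3,4) [of "vunit C" u] by simp_all
  have "e u \<Zsemi> tp (vunit C) (g u) b b (\<iota> (hm (vunit C) (g u))) (vid C b) = ?k"
    using pre_tp [of "vunit C" "g u" b b "\<iota> (hm (vunit C) (g u))" "vid C b" "e u" "\<iota> \<one>"] by simp
  then have m: "u_iso V K (b, u) (pr (g u) b, \<one>) ?m"
    using v_functor_lift_iso [OF rtens_v_functor [of b] _ _ _ _ assms(1)] by (simp add: rtens_vfun_def)
  have "K.cp (b, u) (pr b (g u), \<one>) (pr (g u) b, \<one>) (tau' (b, u)) (?hb \<Zsemi> J (pr b (g u)) (pr (g u) b)) = ?m"
    by (rule uncurry_inj [of u "hm b (pr (g u) b)"])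
      (simp_all add: uncurry_tau_cp eta_half_braiding)
  then have "u_iso V K (pr b (g u), \<one>) (pr (g u) b, \<one>) (?hb \<Zsemi> J (pr b (g u)) (pr (g u) b))"
    using m by - (rule K.u_iso_cancel_left [OF assms(2)], simp_all)
  then show ?thesis by (rule incl_reflects_iso) simp_all
qed

text \<open>\<open>free_nu V C T u v\<close> is the associator \<open>talpha V C T (vunit C) u v\<close>.\<close>

lemma free_nu_iso:
  assumes "u \<in> obj V" "v \<in> obj V"
  shows "u_iso V C (g (u \<odot> v)) (pr (g u) (g v)) (free_nu V C T u v)"
proof -
  note [simp] = assms
  have "cp (vunit C) (g u) (pr (g u) (g v)) (e u) (eta (g u) v) = tp (vunit C) (g u) (vunit C) (g v) (e u) (e v)"
  proof -
    \<comment> \<open>Inserting an identity of the unit object writes \<open>e u\<close> as a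
      product, which makes interchange with \<open>eta (g u) v\<close> possible.\<close>
    have "tp (vunit C) (g u) (vunit C) (vunit C) (e u) (vid C (vunit C)) = e u" by simp
    then have "cp (vunit C) (g u) (pr (g u) (g v)) (e u) (eta (g u) v)
      = cp (vunit C) (g u) (pr (g u) (g v)) (tp (vunit C) (g u) (vunit C) (vunit C) (e u) (vid C (vunit C)))
         (tp (g u) (g u) (vunit C) (g v) (vid C (g u)) (e v))"
      by (simp only: eta_eq g_vob assms)
    also have "\<dots> = tp (vunit C) (g u) (vunit C) (g v) (e u) (e v)"
      by (subst cp_tp_unt') simp_all
    finally show ?thesis .
  qed
  then have "talpha V C T (vunit C) u v = free_nu V C T u v"
    by (simp add: talpha_def free_nu_def ucomp_def utens_def)
  then show ?thesis
    using talpha_inv [of "vunit C" u v] by (auto simp: u_iso_def)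
qed

text \<open>Invertibility of \<tau> enters through the half braiding; \<open>free_nu\<close> is an
  associator.\<close>

lemma ext_nu_iso:
  assumes "tau_iso" "a \<in> vob C" "b \<in> vob C" "u \<in> obj V" "v \<in> obj V"
  shows "u_iso V C (pr a (pr b (g (u \<odot> v)))) (pr a (pr (g u) (pr b (g v)))) (nu (a, u) (b, v))"
proof -
  note [simp] = assms(2-)
  have hb: "u_iso V C (pr b (g u)) (pr (g u) b) (half_braiding V C T b u)"
    using assms(1) [unfolded tau_iso_def, rule_format, of "vunit C" u]
      assms(1) [unfolded tau_iso_def, rule_format, of b u] by (intro half_braiding_iso) simp_all
  have 1: "u_iso V C (pr a (pr b (g (u \<odot> v)))) (pr a (pr b (pr (g u) (g v))))
      (tp (pr a b) (pr a b) (g (u \<odot> v)) (pr (g u) (g v)) (vid C (pr a b)) (free_nu V C T u v))"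
    using u_iso_tp [OF u_iso_vid [of "pr a b"] free_nu_iso [of u v]] by simp
  have "u_iso V C (pr b (pr (g u) (g v))) (pr (g u) (pr b (g v)))
      (tp (pr b (g u)) (pr (g u) b) (g v) (g v) (half_braiding V C T b u) (vid C (g v)))"
    using u_iso_tp [OF hb u_iso_vid [of "g v"]] by simp
  then have 2: "u_iso V C (pr a (pr b (pr (g u) (g v)))) (pr a (pr (g u) (pr b (g v))))
      (tp a a (pr b (pr (g u) (g v))) (pr (g u) (pr b (g v))) (vid C a)
        (tp (pr b (g u)) (pr (g u) b) (g v) (g v) (half_braiding V C T b u) (vid C (g v))))"
    using u_iso_tp [OF u_iso_vid [of a]] by simp
  show ?thesis
    using u_iso_cp [OF 1 2] by (simp add: ext_nu.simps Let_def)
qed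

lemma ext_v_monoidal_functor:
  assumes "tau_iso"
  shows "v_monoidal_functor V K C (ext_vfun V C T) nu"
proof (rule v_monoidal_functor.intro [OF ext_v_functor], unfold_locales)
  let ?F = "fob (ext_vfun V C T)"
  show "?F (vunit K) = vunit C" by (simp add: ext_fob)
  show "u_iso V C (?F (vprod K x y)) (pr (?F x) (?F y)) (nu x y)" if "x \<in> vob K" "y \<in> vob K" for x y
    using that ext_nu_iso [OF assms] by (cases x; cases y) (simp add: ext_fob)
  show "nu (vunit K) x = vid C (?F x)" if "x \<in> vob K" for x
    using that by (cases x) (simp add: ext_fob ext_nu_unit)
  show "nu x (vunit K) = vid C (?F x)" if "x \<in> vob K" for x
    using that by (cases x) (simp add: ext_fob ext_nu_unit)
  show "cp (?F (vprod K (vprod K x y) z)) (pr (?F (vprod K x y)) (?F z)) (pr (pr (?F x) (?F y)) (?F z))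
        (nu (vprod K x y) z)
        (tp (?F (vprod K x y)) (pr (?F x) (?F y)) (?F z) (?F z) (nu x y) (vid C (?F z)))
      = cp (?F (vprod K x (vprod K y z))) (pr (?F x) (?F (vprod K y z))) (pr (?F x) (pr (?F y) (?F z)))
        (nu x (vprod K y z))
        (tp (?F x) (?F x) (?F (vprod K y z)) (pr (?F y) (?F z)) (vid C (?F x)) (nu y z))"
    if "x \<in> vob K" "y \<in> vob K" "z \<in> vob K" for x y z
    using that ext_nu_assoc by (cases x; cases y; cases z) (simp add: ext_fob)
  show "(vtens K x x' y y' \<Zsemi> fhom (ext_vfun V C T) (vprod K x y) (vprod K x' y')) \<otimes> nu x' y'
        \<Zsemi> vcomp C (?F (vprod K x y)) (?F (vprod K x' y')) (pr (?F x') (?F y'))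
      = nu x y \<otimes> (fhom (ext_vfun V C T) x x' \<otimes> fhom (ext_vfun V C T) y y'
        \<Zsemi> vtens C (?F x) (?F x') (?F y) (?F y'))
        \<Zsemi> vcomp C (?F (vprod K x y)) (pr (?F x) (?F y)) (pr (?F x') (?F y'))"
    if "x \<in> vob K" "y \<in> vob K" "x' \<in> vob K" "y' \<in> vob K" for x y x' y'
    using that ext_nu_natural
    by (cases x; cases y; cases x'; cases y') (simp add: ext_fob ext_fhom ucomp_def utens_def)
qed

end

section \<open>The equivalences\<close>

context braided_closed_monoidal
begin

lemma self_vcat_simps [simp]:
  "vob (self_vcat V) = obj V" "vhom (self_vcat V) = ihom V"
  by (simp_all add: self_vcat_def)

lemma uncurry_self_ucomp:
  assumes "x \<in> obj V" "y \<in> obj V" "z \<in> obj V" "f \<in> arr V" "trg V f = ihom V x y"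
    "h \<in> arr V" "trg V h = ihom V y z"
  shows "ucomp V (self_vcat V) x y z f h \<in> arr V"
    "src V (ucomp V (self_vcat V) x y z f h) = src V f \<odot> src V h"
    "trg V (ucomp V (self_vcat V) x y z f h) = ihom V x z"
    "uncurry x z (ucomp V (self_vcat V) x y z f h)
      = uncurry x y f \<otimes> \<iota> (src V h) \<Zsemi> uncurry y z h"
proof -
  show "ucomp V (self_vcat V) x y z f h \<in> arr V"
    "src V (ucomp V (self_vcat V) x y z f h) = src V f \<odot> src V h"
    "trg V (ucomp V (self_vcat V) x y z f h) = ihom V x z"
    using assms by (simp_all add: ucomp_def self_vcat_def)
  have "uncurry x z (ucomp V (self_vcat V) x y z f h)
      = (\<iota> x \<otimes> f) \<otimes> h \<Zsemi> (\<epsilon> x y \<otimes> \<iota> (ihom V y z) \<Zsemi> \<epsilon> y z)"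
    using assms by (simp add: ucomp_def self_vcat_def uncurry_cmp)
  also have "\<dots> = uncurry x y f \<otimes> \<iota> (src V h) \<Zsemi> uncurry y z h"
    using assms by (simp add: uncurry_def tens_cmp_chain del: atens_assoc)
  finally show "uncurry x z (ucomp V (self_vcat V) x y z f h)
      = uncurry x y f \<otimes> \<iota> (src V h) \<Zsemi> uncurry y z h" .
qed

lemma self_vid_simps:
  assumes "x \<in> obj V"
  shows "vid (self_vcat V) x \<in> arr V" "src V (vid (self_vcat V) x) = \<one>"
    "trg V (vid (self_vcat V) x) = ihom V x x" "uncurry x x (vid (self_vcat V) x) = \<iota> x"
  using assms by (simp_all add: self_vcat_def)

text \<open>Elements of grade \<one> in \<open>self_vcat V\<close> are morphisms of \<open>V\<close>
  through \<open>uncurry\<close>, and composites correspond by \<open>uncurry_self_ucomp\<close>;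
  hence inverses correspond as well.\<close>

lemma self_u_iso_iff:
  assumes "x \<in> obj V" "y \<in> obj V" "f \<in> arr V" "src V f = \<one>" "trg V f = ihom V x y"
  shows "u_iso V (self_vcat V) x y f \<longleftrightarrow> is_iso V x y (uncurry x y f)"
proof
  assume "u_iso V (self_vcat V) x y f"
  then obtain h where h: "u_inverse V (self_vcat V) x y f h" by (auto simp: u_iso_def)
  then have [simp]: "h \<in> arr V" "src V h = \<one>" "trg V h = ihom V y x"
    by (auto simp: u_inverse_def uhom_def hom_def)
  have 1: "uncurry x x (ucomp V (self_vcat V) x y x f h) = uncurry x x (vid (self_vcat V) x)"
    "uncurry y y (ucomp V (self_vcat V) y x y h f) = uncurry y y (vid (self_vcat V) y)"
    using h by (simp_all add: u_inverse_def)
  then have "is_inverse V x y (uncurry x y f) (uncurry y x h)"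
    using assms by (simp add: is_inverse_def hom_iff uncurry_self_ucomp self_vid_simps)
  then show "is_iso V x y (uncurry x y f)" by (auto simp: is_iso_def)
next
  assume "is_iso V x y (uncurry x y f)"
  then obtain k where k: "is_inverse V x y (uncurry x y f) k" by (auto simp: is_iso_def)
  then have [simp]: "k \<in> arr V" "src V k = y" "trg V k = x"
    by (auto simp: is_inverse_def hom_def)
  let ?h = "mate V y \<one> x k"
  have 1: "ucomp V (self_vcat V) x y x f ?h = vid (self_vcat V) x"
    by (rule uncurry_inj [of x x])
      (use assms k in \<open>simp_all add: uncurry_self_ucomp self_vid_simps is_inverse_def\<close>)
  have 2: "ucomp V (self_vcat V) y x y ?h f = vid (self_vcat V) y"
    by (rule uncurry_inj [of y y])
      (use assms k in \<open>simp_all add: uncurry_self_ucomp self_vid_simps is_inverse_def\<close>)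
  show "u_iso V (self_vcat V) x y f"
    unfolding u_iso_def u_inverse_def uhom_def using assms 1 2 by (auto simp: hom_iff intro!: exI [of _ ?h])
qed

end

context enriched_category
begin

text \<open>Uncurrying the action of the representable gives \<open>vcomp\<close>, so functoriality
  amounts to associativity and a unit law of \<open>C\<close>.\<close>

lemma repr_v_functor:
  assumes "a \<in> vob C"
  shows "v_functor V C (self_vcat V) (repr_vfun V C a)"
proof
  let ?R = "repr_vfun V C a"
  have R: "fhom ?R b c \<in> arr V" "src V (fhom ?R b c) = hm b c" "trg V (fhom ?R b c) = ihom V (hm a b) (hm a c)"
    "uncurry (hm a b) (hm a c) (fhom ?R b c) = vcomp C a b c" if "b \<in> vob C" "c \<in> vob C" for b c
    using that assms by (simp_all add: repr_vfun_def)
  show "fob ?R b \<in> vob (self_vcat V)" if "b \<in> vob C" for b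
    using that assms by (simp add: repr_vfun_def)
  show "fhom ?R b c \<in> hom V (hm b c) (vhom (self_vcat V) (fob ?R b) (fob ?R c))"
    if "b \<in> vob C" "c \<in> vob C" for b c
    using that assms by (simp add: hom_iff R) (simp add: repr_vfun_def)
  show "vid C b \<Zsemi> fhom ?R b b = vid (self_vcat V) (fob ?R b)" if "b \<in> vob C" for b
  proof -
    have "vid C b \<Zsemi> fhom ?R b b = vid (self_vcat V) (hm a b)"
      by (rule uncurry_inj [of "hm a b" "hm a b"])
        (use that assms in \<open>simp_all add: R uncurry_cmp self_vid_simps vcomp_vid\<close>)
    then show ?thesis by (simp add: repr_vfun_def)
  qed
  show "vcomp C b c d \<Zsemi> fhom ?R b d
      = fhom ?R b c \<otimes> fhom ?R c d \<Zsemi> vcomp (self_vcat V) (fob ?R b) (fob ?R c) (fob ?R d)"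
    if "b \<in> vob C" "c \<in> vob C" "d \<in> vob C" for b c d
  proof -
    have "vcomp C b c d \<Zsemi> fhom ?R b d
        = ucomp V (self_vcat V) (hm a b) (hm a c) (hm a d) (fhom ?R b c) (fhom ?R c d)"
      by (rule uncurry_inj [of "hm a b" "hm a d"])
        (use that assms in \<open>simp_all add: R uncurry_cmp uncurry_self_ucomp vcomp_assoc\<close>)
    then show ?thesis by (simp add: repr_vfun_def ucomp_def)
  qed
qed

end

section \<open>Each of the four statements compared with invertibility of \<tau>\<close>

context tensored_monoidal_category
begin

text \<open>The counterpart of \<open>tau_eq\<close> for representables: again the inverse of
  \<open>curry_iso\<close> meets an iterated mate.\<close>

lemma mu_repr:
  assumes "a \<in> vob C" "c \<in> vob C" "v \<in> obj V"
  shows "mu V C T (self_vcat V) (self_tensoring V) (repr_vfun V C a) c v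
    = mate V (hm a c \<odot> v) \<one> (hm a (pr c (g v))) (cp a c (pr c (g v)) (\<iota> (hm a c)) (eta c v))"
proof -
  note [simp] = assms
  let ?t = "pr c (g v)"
  have "eta c v \<Zsemi> mate V (hm a c) (hm c ?t) (hm a ?t) (vcomp C a c ?t)
      = mate V (hm a c) v (hm a ?t) (cp a c ?t (\<iota> (hm a c)) (eta c v))"
    by (simp add: mate_pre ucomp_def)
  then show ?thesis
    using uncurried_curry_inverse [of "hm a c" v \<one> "cp a c ?t (\<iota> (hm a c)) (eta c v)" "hm a ?t"]
    by (simp add: mu_def tmate_def self_tensoring_def repr_vfun_def hom_iff)
qed

lemma repr_tensored_iff:
  assumes "a \<in> vob C"
  shows "tensored_functor V C T (self_vcat V) (self_tensoring V) (repr_vfun V C a) \<longleftrightarrow>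
    (\<forall>c \<in> vob C. \<forall>v \<in> obj V. is_iso V (hm a c \<odot> v) (hm a (pr c (g v)))
      (cp a c (pr c (g v)) (\<iota> (hm a c)) (eta c v)))"
proof -
  have "u_iso V (self_vcat V) (hm a c \<odot> v) (hm a (pr c (g v)))
      (mu V C T (self_vcat V) (self_tensoring V) (repr_vfun V C a) c v)
    \<longleftrightarrow> is_iso V (hm a c \<odot> v) (hm a (pr c (g v))) (cp a c (pr c (g v)) (\<iota> (hm a c)) (eta c v))"
    if "c \<in> vob C" "v \<in> obj V" for c v
    using assms that by (simp add: mu_repr self_u_iso_iff)
  then show ?thesis
    using assms repr_v_functor [OF assms]
    by (simp add: tensored_functor_def self_tensoring_def repr_vfun_def)
qed

text \<open>A morphism of \<open>V\<close> into \<open>hm a c \<odot> v\<close> is an element of the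
  completion from \<open>(a, \<one>)\<close> to \<open>(c, v)\<close>, and by
  \<open>uncurry_cp_tau\<close> the morphism in question is composition with \<tau>. Composition
  with the inverse \<open>h\<close> of \<tau> gives the inverse \<open>?N\<close>.\<close>

lemma tau_iso_imp_repr_iso:
  assumes "u_iso V K (c, v) (pr c (g v), \<one>) (tau' (c, v))" "a \<in> vob C" "c \<in> vob C" "v \<in> obj V"
  shows "is_iso V (hm a c \<odot> v) (hm a (pr c (g v))) (cp a c (pr c (g v)) (\<iota> (hm a c)) (eta c v))"
proof -
  note [simp] = assms(2-)
  let ?t = "pr c (g v)"
  let ?M = "cp a c ?t (\<iota> (hm a c)) (eta c v)"
  obtain h where h: "u_inverse V K (c, v) (?t, \<one>) (tau' (c, v)) h" using assms(1) by (auto simp: u_iso_def)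
  have h' [simp]: "h \<in> arr V" "src V h = \<one>" "trg V h = ihom V \<one> (hm ?t c \<odot> v)"
    "K.cp (c, v) (?t, \<one>) (c, v) (tau' (c, v)) h = vid K (c, v)"
    "K.cp (?t, \<one>) (c, v) (?t, \<one>) h (tau' (c, v)) = vid K (?t, \<one>)"
    using K.u_inverseD [OF h] by simp_all
  \<comment> \<open>\<open>?p\<close> and \<open>?q\<close> are the elements whose uncurried forms
    are identities; composed with \<tau> and \<open>h\<close> respectively, they uncurry to
    \<open>?M\<close> and \<open>?N\<close>.\<close>
  let ?p = "mate V \<one> (hm a c \<odot> v) (hm a c \<odot> v) (\<iota> (hm a c \<odot> v))"
  let ?q = "mate V \<one> (hm a ?t) (hm a ?t) (\<iota> (hm a ?t))"
  let ?h = "uncurry \<one> (hm ?t c \<odot> v) h"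
  let ?N = "\<iota> (hm a ?t) \<otimes> ?h \<Zsemi> vcomp C a ?t c \<otimes> \<iota> v"
  have "?M \<Zsemi> ?N = uncurry \<one> (hm a c \<odot> v)
      (K.cp (a, \<one>) (?t, \<one>) (c, v) (K.cp (a, \<one>) (c, v) (?t, \<one>) ?p (tau' (c, v))) h)"
    using uncurry_cp [of a ?t c \<one> \<one> v "K.cp (a, \<one>) (c, v) (?t, \<one>) ?p (tau' (c, v))" h]
      uncurry_cp_tau [of a c \<one> v ?p] K.cp_simps [of "(a, \<one>)" "(c, v)" "(?t, \<one>)" ?p "tau' (c, v)"]
    by simp
  also have "\<dots> = \<iota> (hm a c \<odot> v)"
    by simp
  finally have 1: "?M \<Zsemi> ?N = \<iota> (hm a c \<odot> v)" .
  have "?N \<Zsemi> ?M = uncurry \<one> (hm a ?t)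
      (K.cp (a, \<one>) (c, v) (?t, \<one>) (K.cp (a, \<one>) (?t, \<one>) (c, v) ?q h) (tau' (c, v)))"
    using uncurry_cp [of a ?t c \<one> \<one> v ?q h] K.cp_simps [of "(a, \<one>)" "(?t, \<one>)" "(c, v)" ?q h]
      uncurry_cp_tau [of a c \<one> v "K.cp (a, \<one>) (?t, \<one>) (c, v) ?q h"]
    by simp
  also have "\<dots> = \<iota> (hm a ?t)"
    by simp
  finally have 2: "?N \<Zsemi> ?M = \<iota> (hm a ?t)" .
  have "is_inverse V (hm a c \<odot> v) (hm a ?t) ?M ?N"
    unfolding is_inverse_def using 1 2 by (simp add: hom_iff)
  then show ?thesis by (auto simp: is_iso_def)
qed

text \<open>Invertibility at \<open>b = pr a (g u)\<close> yields \<open>?h\<close>, the preimage of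
  the identity, so that \<open>?h\<close> followed by \<tau> is the identity. Invertibility at
  \<open>b = a\<close> makes composition with \<tau> cancellable, which gives the other inverse
  law.\<close>

lemma repr_iso_imp_tau_iso:
  assumes iso: "\<And>b. b \<in> vob C \<Longrightarrow>
      is_iso V (hm b a \<odot> u) (hm b (pr a (g u))) (cp b a (pr a (g u)) (\<iota> (hm b a)) (eta a u))"
    and [simp]: "a \<in> vob C" "u \<in> obj V"
  shows "u_iso V K (a, u) (pr a (g u), \<one>) (tau' (a, u))"
proof -
  let ?t = "pr a (g u)"
  let ?M = "\<lambda>b. cp b a ?t (\<iota> (hm b a)) (eta a u)"
  obtain N where N: "is_inverse V (hm ?t a \<odot> u) (hm ?t ?t) (?M ?t) N"
    using iso [of ?t] by (auto simp: is_iso_def)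
  then have N' [simp]: "N \<in> arr V" "src V N = hm ?t ?t" "trg V N = hm ?t a \<odot> u" "N \<Zsemi> ?M ?t = \<iota> (hm ?t ?t)"
    by (auto simp: is_inverse_def hom_def)
  let ?h = "mate V \<one> \<one> (hm ?t a \<odot> u) (vid C ?t \<Zsemi> N)"
  have ht: "K.cp (?t, \<one>) (a, u) (?t, \<one>) ?h (tau' (a, u)) = vid K (?t, \<one>)"
    by (rule uncurry_unt_inj [of "hm ?t ?t"])
      (use uncurry_vid [of ?t \<one>] in \<open>simp_all add: uncurry_cp_tau\<close>)
  obtain L where L: "is_inverse V (hm a a \<odot> u) (hm a ?t) (?M a) L"
    using iso [of a] by (auto simp: is_iso_def)
  then have L' [simp]: "L \<in> arr V" "src V L = hm a ?t" "?M a \<Zsemi> L = \<iota> (hm a a \<odot> u)"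
    by (auto simp: is_inverse_def hom_def)
  let ?th = "K.cp (a, u) (?t, \<one>) (a, u) (tau' (a, u)) ?h"
  have th [simp]: "?th \<in> arr V" "src V ?th = \<one>" "trg V ?th = ihom V u (hm a a \<odot> u)"
    using K.cp_simps [of "(a, u)" "(?t, \<one>)" "(a, u)" "tau' (a, u)" ?h] by simp_all
  \<comment> \<open>Since \<open>?h\<close> followed by \<tau> is the identity, \<open>?th\<close>
    and \<open>vid K (a, u)\<close> agree after composition with \<tau>; \<open>L\<close> then
    cancels the factor \<open>?M a\<close>.\<close>
  have "K.cp (a, u) (a, u) (?t, \<one>) ?th (tau' (a, u)) = tau' (a, u)"
    using ht by simp
  then have "uncurry u (hm a a \<odot> u) ?th \<Zsemi> ?M a
      = uncurry u (hm a ?t) (K.cp (a, u) (a, u) (?t, \<one>) (vid K (a, u)) (tau' (a, u)))"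
    using uncurry_cp_tau [of a a u u ?th] by simp
  also have "\<dots> = uncurry u (hm a a \<odot> u) (vid K (a, u)) \<Zsemi> ?M a"
    by (rule uncurry_cp_tau) simp_all
  finally have "(uncurry u (hm a a \<odot> u) ?th \<Zsemi> ?M a) \<Zsemi> L
      = (uncurry u (hm a a \<odot> u) (vid K (a, u)) \<Zsemi> ?M a) \<Zsemi> L"
    by simp
  then have "uncurry u (hm a a \<odot> u) ?th = uncurry u (hm a a \<odot> u) (vid K (a, u))"
    by (simp del: uncurry_vid)
  then have "?th = vid K (a, u)"
    by (rule uncurry_inj) simp_all
  then show ?thesis
    unfolding u_iso_def using ht by (auto intro!: exI [of _ ?h] K.u_inverseI)
qed

lemma representables_tensored_iff:
  "(\<forall>a \<in> vob C. tensored_functor V C T (self_vcat V) (self_tensoring V) (repr_vfun V C a)) \<longleftrightarrow> tau_iso"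
  using tau_iso_imp_repr_iso repr_iso_imp_tau_iso by (auto simp: repr_tensored_iff tau_iso_def)

text \<open>By definition, \<tau> consists of the comparison morphisms \<open>mu\<close> of the
  inclusion.\<close>

lemma incl_tensored_iff:
  "tensored_functor V C T K (completion_tensoring V C) (incl_vfun V C) \<longleftrightarrow> tau_iso"
  by (simp add: tensored_functor_def tau_iso_def incl_v_functor tau_def completion_tensoring_def)

lemma id_fob: "fob (id_vfun V D) x = x"
  by (simp add: id_vfun_def)

lemma tau_monoidal_nat_iso_iff:
  "v_monoidal_nat_iso V K K (id_vfun V K) (id_nu K) EI nuEI tau' \<longleftrightarrow> tau_iso"
  by (auto simp: v_monoidal_nat_iso_def tau_monoidal_nat tau_iso_def id_fob EI_fob)

text \<open>The equivalence asks for a transformation from the composite to the identity, here given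
  by the inverses of the components of \<tau>. Its unit condition and naturality are formal; for
  products, \<open>?ss\<close> followed by \<open>?tt\<close> is computed to be the identity and the
  inverse of \<open>ext_nu\<close> supplies the rest.\<close>

lemma tau_inverse_monoidal_nat:
  assumes "tau_iso"
  shows "\<exists>\<sigma>. v_monoidal_nat_iso V K K EI nuEI (id_vfun V K) (id_nu K) \<sigma>"
proof -
  have "\<forall>x \<in> vob K. \<exists>s. u_inverse V K x (fob EI x) (tau' x) s"
    using assms by (auto simp: tau_iso_def EI_fob u_iso_def)
  then obtain \<sigma> where \<sigma>: "\<And>x. x \<in> vob K \<Longrightarrow> u_inverse V K x (fob EI x) (tau' x) (\<sigma> x)"
    using bchoice by metis
  have \<sigma>': "u_inverse V K (a, u) (pr a (g u), \<one>) (tau' (a, u)) (\<sigma> (a, u))" if "a \<in> vob C" "u \<in> obj V" for a u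
    using \<sigma> [of "(a, u)"] that by (simp add: EI_fob)
  have \<sigma>_simps: "\<sigma> (a, u) \<in> arr V" "src V (\<sigma> (a, u)) = \<one>" "trg V (\<sigma> (a, u)) = ihom V \<one> (hm (pr a (g u)) a \<odot> u)"
    if "a \<in> vob C" "u \<in> obj V" for a u
    using K.u_inverseD [OF \<sigma>' [OF that]] that by simp_all
  have "v_monoidal_nat V K K EI nuEI (id_vfun V K) (id_nu K) \<sigma>"
  proof (rule v_monoidal_nat.intro, unfold_locales)
    show "\<sigma> x \<in> uhom V K (fob EI x) (fob (id_vfun V K) x)" if "x \<in> vob K" for x
      using \<sigma> [OF that] by (simp add: u_inverse_def id_vfun_def)
    show "\<sigma> x \<otimes> fhom (id_vfun V K) x y \<Zsemi> vcomp K (fob EI x) (fob (id_vfun V K) x) (fob (id_vfun V K) y)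
      = fhom EI x y \<otimes> \<sigma> y \<Zsemi> vcomp K (fob EI x) (fob EI y) (fob (id_vfun V K) y)"
      if "x \<in> vob K" "y \<in> vob K" for x y
    proof -
      obtain a u b v where xy: "x = (a, u)" "y = (b, v)" by (cases x; cases y)
      with that have [simp]: "a \<in> vob C" "u \<in> obj V" "b \<in> vob C" "v \<in> obj V" by auto
      have "K.cp (pr a (g u), \<one>) (a, u) (b, v) (\<sigma> (a, u)) (\<iota> (ihom V u (hm a b \<odot> v)))
          = K.cp (pr a (g u), \<one>) (pr b (g v), \<one>) (b, v) (fhom EI (a, u) (b, v)) (\<sigma> (b, v))"
        by (rule K.u_inverse_natural [OF _ _ _ _ \<sigma>' \<sigma>'])
          (simp_all add: tau_natural, simp_all add: EI_fhom)
      then show ?thesis by (simp add: xy EI_fob id_vfun_def ucomp_def)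
    qed
    show "\<sigma> (vunit K) = vid K (vunit K)"
    proof -
      have "u_inverse V K (vunit C, \<one>) (vunit C, \<one>) (vid K (vunit C, \<one>)) (\<sigma> (vunit C, \<one>))"
        using \<sigma>' [of "vunit C" \<one>] by (simp add: tau_unt)
      moreover have "u_inverse V K (vunit C, \<one>) (vunit C, \<one>) (vid K (vunit C, \<one>)) (vid K (vunit C, \<one>))"
        by (rule K.u_inverseI) (use completion_vid_simps [of "vunit C" \<one>] in simp_all)
      ultimately show ?thesis using K.u_inverse_unique by simp
    qed
    show "K.cp (fob EI (vprod K x y)) (fob (id_vfun V K) (vprod K x y))
          (vprod K (fob (id_vfun V K) x) (fob (id_vfun V K) y)) (\<sigma> (vprod K x y)) (id_nu K x y)
        = K.cp (fob EI (vprod K x y)) (vprod K (fob EI x) (fob EI y))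
          (vprod K (fob (id_vfun V K) x) (fob (id_vfun V K) y)) (nuEI x y)
          (ktp (fob EI x) (fob (id_vfun V K) x) (fob EI y) (fob (id_vfun V K) y) (\<sigma> x) (\<sigma> y))"
      if "x \<in> vob K" "y \<in> vob K" for x y
    proof -
      obtain a u b v where xy: "x = (a, u)" "y = (b, v)" by (cases x; cases y)
      with that have [simp]: "a \<in> vob C" "u \<in> obj V" "b \<in> vob C" "v \<in> obj V" by auto
      let ?A = "pr a (g u)" and ?B = "pr b (g v)"
      let ?P = "pr a (pr b (g (u \<odot> v)))" and ?Q = "pr a (pr (g u) (pr b (g v)))"
      let ?tt = "ktp (a, u) (?A, \<one>) (b, v) (?B, \<one>) (tau' (a, u)) (tau' (b, v))"
      let ?ss = "ktp (?A, \<one>) (a, u) (?B, \<one>) (b, v) (\<sigma> (a, u)) (\<sigma> (b, v))"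
      let ?N = "nuEI (a, u) (b, v)"
      let ?t = "tau' (pr a b, u \<odot> v)" and ?s = "\<sigma> (pr a b, u \<odot> v)"
      have iss: "u_inverse V K (pr a b, u \<odot> v) (?P, \<one>) ?t ?s"
        using \<sigma>' [of "pr a b" "u \<odot> v"] by simp
      have t [simp]: "?t \<in> arr V" "src V ?t = \<one>" "trg V ?t = ihom V (u \<odot> v) (hm (pr a b) ?P)"
        "?s \<in> arr V" "src V ?s = \<one>" "trg V ?s = ihom V \<one> (hm ?P (pr a b) \<odot> (u \<odot> v))"
        using K.u_inverseD [OF iss] by simp_all
      have ss [simp]: "?ss \<in> arr V" "src V ?ss = \<one>" "trg V ?ss = ihom V \<one> (hm ?Q (pr a b) \<odot> (u \<odot> v))"
        using uncurry_tp(1-3) [of ?A a ?B b \<one> u \<one> v "\<sigma> (a, u)" "\<sigma> (b, v)"] by (simp_all add: \<sigma>_simps)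
      have tt [simp]: "?tt \<in> arr V" "src V ?tt = \<one>" "trg V ?tt = ihom V (u \<odot> v) (hm (pr a b) ?Q)"
        using uncurry_tp(1-3) [of a ?A b ?B u \<one> v \<one> "tau' (a, u)" "tau' (b, v)"] by simp_all
      have N [simp]: "?N \<in> arr V" "src V ?N = \<one>" "trg V ?N = ihom V \<one> (hm ?P ?Q)"
        by (simp_all add: nuEI_eq)
      \<comment> \<open>The uncurried form of the law that \<sigma> followed by \<tau> is the
        identity, to be used in each factor after \<open>uncurry_tp_cp\<close>.\<close>
      have st: "uncurry \<one> (hm (pr a (g u)) a \<odot> u) (\<sigma> (a, u))
          \<Zsemi> cp (pr a (g u)) a (pr a (g u)) (\<iota> (hm (pr a (g u)) a)) (eta a u) = vid C (pr a (g u))"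
        if "a \<in> vob C" "u \<in> obj V" for a u
        using that uncurry_cp_tau [of "pr a (g u)" a \<one> u "\<sigma> (a, u)"]
          K.u_inverseD(8) [OF \<sigma>' [of a u]] uncurry_vid [of "pr a (g u)" \<one>] by (simp add: \<sigma>_simps)
      have utt: "uncurry (u \<odot> v) (hm (pr a b) ?Q) ?tt = tp a ?A b ?B (eta a u) (eta b v)"
        using uncurry_tp(4) [of a ?A b ?B u \<one> v \<one> "tau' (a, u)" "tau' (b, v)"]
        by (simp add: utens_def)
      have "uncurry \<one> (hm ?Q ?Q) (K.cp (?Q, \<one>) (pr a b, u \<odot> v) (?Q, \<one>) ?ss ?tt)
          = tp ?A ?A ?B ?B (vid C ?A) (vid C ?B)"
        using uncurry_cp_unt [of ?Q "pr a b" ?Q \<one> "u \<odot> v" ?ss ?tt] st [of a u] st [of b v]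
          uncurry_tp_cp [of ?A a ?B b ?A ?B \<one> u \<one> v "\<sigma> (a, u)" "\<sigma> (b, v)" "eta a u" "eta b v"]
        by (simp add: utt \<sigma>_simps)
      then have sst: "K.cp (?Q, \<one>) (pr a b, u \<odot> v) (?Q, \<one>) ?ss ?tt = vid K (?Q, \<one>)"
        using uncurry_vid [of ?Q \<one>] completion_vid_simps(1-3) [of ?Q \<one>]
          K.cp_simps [of "(?Q, \<one>)" "(pr a b, u \<odot> v)" "(?Q, \<one>)" ?ss ?tt]
        by - (rule uncurry_unt_inj [of "hm ?Q ?Q"], simp_all)
      \<comment> \<open>An inverse of \<open>?N\<close> comes from \<open>C\<close>, because
        \<open>ext_nu\<close> is invertible and the inclusion preserves inverses.\<close>
      obtain M0 where M0: "u_inverse V C ?P ?Q (nu (a, u) (b, v)) M0"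
        using ext_nu_iso [OF assms, of a b u v] by (auto simp: u_iso_def)
      define M where "M = M0 \<Zsemi> J ?Q ?P"
      have "u_inverse V K (?P, \<one>) (?Q, \<one>) ?N M"
        using v_functor_u_inverse [OF incl_v_functor enriched_category_axioms completion_enriched _ _ M0]
        by (simp add: nuEI_eq M_def)
      then have M [simp]: "M \<in> arr V" "src V M = \<one>" "trg V M = ihom V \<one> (hm ?Q ?P)"
        "K.cp (?P, \<one>) (?Q, \<one>) (?P, \<one>) ?N M = vid K (?P, \<one>)"
        using K.u_inverseD [of "(?P, \<one>)" "(?Q, \<one>)" ?N M] by simp_all
      \<comment> \<open>By \<open>tau_tp\<close>, \<open>?D\<close> followed by \<open>?N\<close>
        equals \<open>?ss\<close> followed by \<open>?tt\<close>, the identity. Hence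
        \<open>?D\<close> is the inverse \<open>M\<close> of \<open>?N\<close>.\<close>
      let ?D = "K.cp (?Q, \<one>) (pr a b, u \<odot> v) (?P, \<one>) ?ss ?t"
      have D [simp]: "?D \<in> arr V" "src V ?D = \<one>" "trg V ?D = ihom V \<one> (hm ?Q ?P)"
        using K.cp_simps [of "(?Q, \<one>)" "(pr a b, u \<odot> v)" "(?P, \<one>)" ?ss ?t] by simp_all
      have DN: "K.cp (?Q, \<one>) (?P, \<one>) (?Q, \<one>) ?D ?N = vid K (?Q, \<one>)"
        using sst tau_tp [of a b u v] by simp
      have "?D = K.cp (?Q, \<one>) (?P, \<one>) (?P, \<one>) ?D (K.cp (?P, \<one>) (?Q, \<one>) (?P, \<one>) ?N M)"
        using K.cp_vid [of "(?Q, \<one>)" "(?P, \<one>)" ?D] by simp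
      also have "\<dots> = K.cp (?Q, \<one>) (?Q, \<one>) (?P, \<one>) (K.cp (?Q, \<one>) (?P, \<one>) (?Q, \<one>) ?D ?N) M"
        by (rule K.cp_assoc [symmetric]) (use D in simp_all)
      also have "\<dots> = M"
        unfolding DN by simp
      finally have D_eq: "?D = M" .
      \<comment> \<open>Inserting \<open>?t\<close> followed by \<open>?s\<close> behind
        \<open>?ss\<close> exposes \<open>?D\<close>, which cancels against
        \<open>?N\<close>.\<close>
      have "K.cp (?P, \<one>) (?Q, \<one>) (pr a b, u \<odot> v) ?N ?ss
          = K.cp (?P, \<one>) (?Q, \<one>) (pr a b, u \<odot> v) ?N
             (K.cp (?Q, \<one>) (pr a b, u \<odot> v) (pr a b, u \<odot> v) ?ss
               (K.cp (pr a b, u \<odot> v) (?P, \<one>) (pr a b, u \<odot> v) ?t ?s))"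
        using K.u_inverseD(7) [OF iss] by simp
      also have "\<dots> = K.cp (?P, \<one>) (?Q, \<one>) (pr a b, u \<odot> v) ?N
             (K.cp (?Q, \<one>) (?P, \<one>) (pr a b, u \<odot> v) ?D ?s)"
        by simp
      also have "\<dots> = K.cp (?P, \<one>) (?P, \<one>) (pr a b, u \<odot> v)
          (K.cp (?P, \<one>) (?Q, \<one>) (?P, \<one>) ?N M) ?s"
        unfolding D_eq by (rule K.cp_assoc [symmetric]) simp_all
      also have "\<dots> = ?s" by simp
      finally show ?thesis by (simp add: xy EI_fob id_fob id_nu_def)
    qed
  qed
  moreover have "u_iso V K (fob EI x) (fob (id_vfun V K) x) (\<sigma> x)" if "x \<in> vob K" for x
    using K.u_inverse_sym [OF \<sigma> [OF that]] by (auto simp: u_iso_def id_fob)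
  ultimately show ?thesis by (auto simp: v_monoidal_nat_iso_def)
qed

text \<open>\<open>eta\<close> at \<one> is an identity and \<open>J\<close> uncurries to one, so
  \<open>eta_cp_ext\<close> leaves only the identity.\<close>

lemma incl_ext_hom:
  assumes "a \<in> vob C" "b \<in> vob C"
  shows "J a b \<Zsemi> E (a, \<one>) (b, \<one>) = \<iota> (hm a b)"
  using eta_cp_ext [of a b \<one> \<one> "J a b"] ext_hom_simps [of a b \<one> \<one>] assms by simp

text \<open>On \<open>C\<close>, the composite functor and its structure are identities on the nose,
  so \<open>vid C\<close> serves as the isomorphism.\<close>

lemma incl_ext_monoidal_nat:
  "v_monoidal_nat_iso V C C (comp_vfun V (incl_vfun V C) (ext_vfun V C T))
    (comp_nu V C K C (incl_vfun V C) (incl_nu V C) (ext_vfun V C T) nu) (id_vfun V C) (id_nu C) (vid C)"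
proof -
  let ?IE = "comp_vfun V (incl_vfun V C) (ext_vfun V C T)"
  let ?n = "comp_nu V C K C (incl_vfun V C) (incl_nu V C) (ext_vfun V C T) nu"
  have IE: "fob ?IE a = a" if "a \<in> vob C" for a
    using that by (simp add: comp_vfun_def ext_fob)
  have IE_hom: "fhom ?IE a b = \<iota> (hm a b)" if "a \<in> vob C" "b \<in> vob C" for a b
    using that incl_ext_hom by (simp add: comp_vfun_def ext_fhom)
  have n: "?n a b = vid C (pr a b)" if "a \<in> vob C" "b \<in> vob C" for a b
  proof -
    have "vid K (pr a b, \<one>) \<Zsemi> E (pr a b, \<one>) (pr a b, \<one>) = vid C (pr a b)"
      using v_functor.fhom_vid [OF ext_v_functor, of "(pr a b, \<one>)"] that
      by (simp add: ext_fob ext_fhom)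
    then show ?thesis
      using that by (simp add: comp_nu_def ext_fob ext_fhom incl_nu_eq ext_nu_unt_unt)
  qed
  have "v_monoidal_nat V C C ?IE ?n (id_vfun V C) (id_nu C) (vid C)"
  proof (rule v_monoidal_nat.intro, unfold_locales)
    show "vid C a \<in> uhom V C (fob ?IE a) (fob (id_vfun V C) a)" if "a \<in> vob C" for a
      using that by (simp add: IE id_fob uhom_def hom_iff)
    show "vid C a \<otimes> fhom (id_vfun V C) a b \<Zsemi> vcomp C (fob ?IE a) (fob (id_vfun V C) a) (fob (id_vfun V C) b)
      = fhom ?IE a b \<otimes> vid C b \<Zsemi> vcomp C (fob ?IE a) (fob ?IE b) (fob (id_vfun V C) b)"
      if "a \<in> vob C" "b \<in> vob C" for a b
      using that by (simp add: IE IE_hom id_vfun_def vid_vcomp vcomp_vid)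
    show "cp (fob ?IE (pr a b)) (fob (id_vfun V C) (pr a b)) (pr (fob (id_vfun V C) a) (fob (id_vfun V C) b))
        (vid C (pr a b)) (id_nu C a b)
      = cp (fob ?IE (pr a b)) (pr (fob ?IE a) (fob ?IE b)) (pr (fob (id_vfun V C) a) (fob (id_vfun V C) b))
        (?n a b) (tp (fob ?IE a) (fob (id_vfun V C) a) (fob ?IE b) (fob (id_vfun V C) b) (vid C a) (vid C b))"
      if "a \<in> vob C" "b \<in> vob C" for a b
      using that by (simp add: IE n id_fob id_nu_def)
  qed simp
  then show ?thesis
    by (simp add: v_monoidal_nat_iso_def IE id_fob u_iso_vid)
qed

lemma witness_equivalence_iff:
  "witness_v_monoidal_equivalence V C K (incl_vfun V C) (incl_nu V C) (ext_vfun V C T) nu \<longleftrightarrow> tau_iso"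
proof
  assume "tau_iso"
  then show "witness_v_monoidal_equivalence V C K (incl_vfun V C) (incl_nu V C) (ext_vfun V C T) nu"
    unfolding witness_v_monoidal_equivalence_def
    using incl_v_monoidal_functor ext_v_monoidal_functor incl_ext_monoidal_nat
      tau_inverse_monoidal_nat by blast
next
  assume "witness_v_monoidal_equivalence V C K (incl_vfun V C) (incl_nu V C) (ext_vfun V C T) nu"
  then obtain \<sigma> where \<sigma>: "\<And>x. x \<in> vob K \<Longrightarrow> u_iso V K (fob EI x) x (\<sigma> x)"
    by (auto simp: witness_v_monoidal_equivalence_def v_monoidal_nat_iso_def id_fob)
  show tau_iso
    unfolding tau_iso_def
  proof (intro ballI)
    fix a u
    assume [simp]: "a \<in> vob C" "u \<in> obj V"
    let ?A = "pr a (g u)" and ?s = "\<sigma> (a, u)"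
    obtain h where h: "u_inverse V K (?A, \<one>) (a, u) ?s h"
      using \<sigma> [of "(a, u)"] by (auto simp: EI_fob u_iso_def)
    then have s [simp]: "?s \<in> arr V" "src V ?s = \<one>" "trg V ?s = ihom V \<one> (hm ?A a \<odot> u)"
      using K.u_inverseD [OF h] by simp_all
    \<comment> \<open>Both functors preserve inverses, so the composite \<open>EI\<close> maps
      \<open>?s\<close> to an isomorphism.\<close>
    have "u_inverse V C ?A ?A (?s \<Zsemi> E (?A, \<one>) (a, u)) (h \<Zsemi> E (a, u) (?A, \<one>))"
      using v_functor_u_inverse [OF ext_v_functor completion_enriched enriched_category_axioms _ _ h]
      by (simp add: ext_fob ext_fhom)
    from v_functor_u_inverse [OF incl_v_functor enriched_category_axioms completion_enriched _ _ this]
    have "u_iso V K (?A, \<one>) (?A, \<one>) ((?s \<Zsemi> E (?A, \<one>) (a, u)) \<Zsemi> J ?A ?A)"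
      by (auto simp: u_iso_def simp del: cmp_assoc')
    moreover have "K.cp (?A, \<one>) (a, u) (?A, \<one>) ?s (tau' (a, u)) = (?s \<Zsemi> E (?A, \<one>) (a, u)) \<Zsemi> J ?A ?A"
    proof -
      have EI: "fhom EI (?A, \<one>) (a, u) = E (?A, \<one>) (a, u) \<Zsemi> J ?A ?A" by (simp add: EI_fhom)
      have [simp]: "src V (E (?A, \<one>) (a, u)) = ihom V \<one> (hm ?A a \<odot> u)" "trg V (E (?A, \<one>) (a, u)) = hm ?A ?A"
        using ext_hom_simps [of ?A a \<one> u] by simp_all
      \<comment> \<open>Naturality of \<tau> from \<open>(?A, \<one>)\<close>, where its component
        is the identity, expresses \<open>EI\<close> on this hom object as composition with
        \<tau>.\<close>
      have "K.cp (?A, \<one>) (?A, \<one>) (?A, \<one>) (vid K (?A, \<one>)) (fhom EI (?A, \<one>) (a, u))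
        = K.cp (?A, \<one>) (a, u) (?A, \<one>) (\<iota> (ihom V \<one> (hm ?A a \<odot> u))) (tau' (a, u))"
        using tau_natural [of ?A a \<one> u] by (simp add: tau_unt)
      then have "E (?A, \<one>) (a, u) \<Zsemi> J ?A ?A
        = K.cp (?A, \<one>) (a, u) (?A, \<one>) (\<iota> (ihom V \<one> (hm ?A a \<odot> u))) (tau' (a, u))"
        by (simp add: EI)
      then have "?s \<Zsemi> (E (?A, \<one>) (a, u) \<Zsemi> J ?A ?A)
        = (?s \<otimes> \<iota> \<one>) \<Zsemi> K.cp (?A, \<one>) (a, u) (?A, \<one>) (\<iota> (ihom V \<one> (hm ?A a \<odot> u))) (tau' (a, u))"
        by simp
      also have "\<dots> = K.cp (?A, \<one>) (a, u) (?A, \<one>) ?s (tau' (a, u))"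
        by (subst K.pre_cp) simp_all
      finally show ?thesis by simp
    qed
    ultimately have "u_iso V K (?A, \<one>) (?A, \<one>) (K.cp (?A, \<one>) (a, u) (?A, \<one>) ?s (tau' (a, u)))"
      by simp
    moreover have "u_iso V K (?A, \<one>) (a, u) ?s" using h by (auto simp: u_iso_def)
    ultimately show "u_iso V K (a, u) (?A, \<one>) (tau' (a, u))"
      by - (rule K.u_iso_cancel_left [of "(?A, \<one>)" "(a, u)" ?s], simp_all)
  qed
qed

end

theorem theorem8p5:
  fixes V :: "('o, 'm) bcm_data"
    and C :: "('c, 'o, 'm) vmoncat_data"
    and T :: "('c, 'o, 'm) tensoring_data"
  assumes "braided_closed_monoidal V"
    and "v_monoidal_category V C"
    and "v_closed V C"
    and "tensoring V C T"
    and "monoidal_tensoring V C T"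
  defines "Cbar \<equiv> completion V C"
    and "I \<equiv> incl_vfun V C"
    and "E \<equiv> ext_vfun V C T"
  defines "stmt1 \<equiv> \<forall>a \<in> vob C.
      tensored_functor V C T (self_vcat V) (self_tensoring V) (repr_vfun V C a)"
    and "stmt2 \<equiv> tensored_functor V C T Cbar (completion_tensoring V C) I"
    and "stmt3 \<equiv> v_monoidal_nat_iso V Cbar Cbar
      (id_vfun V Cbar) (id_nu Cbar)
      (comp_vfun V E I) (comp_nu V Cbar C Cbar E (ext_nu V C T) I (incl_nu V C))
      (tau V C T)"
    and "stmt4 \<equiv> witness_v_monoidal_equivalence V C Cbar I (incl_nu V C) E (ext_nu V C T)"
  shows "(stmt1 \<longleftrightarrow> stmt2) \<and> (stmt2 \<longleftrightarrow> stmt3) \<and> (stmt3 \<longleftrightarrow> stmt4)"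
proof -
  interpret tensored_monoidal_category V C T
    by (intro tensored_monoidal_category.intro enriched_monoidal_category.intro
        tensored_category.intro enriched_category.intro
        tensored_category_axioms.intro tensored_monoidal_category_axioms.intro
        v_monoidal_category.axioms(1) assms(1,2,4,5))
  show ?thesis
    unfolding assms(6-) using representables_tensored_iff incl_tensored_iff tau_monoidal_nat_iso_iff witness_equivalence_iff
    by simp
qed

end
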